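(* Let $K$ be a field of characteristic $0$, let $n\ge 2$, let $\omega=(\omega_0,\dots,\omega_n)$ be a vector of positive integers, and let $S=K[x_0,\dots,x_n]$ with $\deg x_i=\omega_i$. Let $V(f)\subset\mathbb{P}^n_\omega$ be a reduced divisor, defined by a reduced weighted homogeneous polynomial $f$ of weighted degree $d$. Let $\delta_i=g_0^i\partial_{x_0}+g_1^i\partial_{x_1}+\dots+g_n^i\partial_{x_n}$, $i=1,\dots,n-1$, be $n-1$ generators of $\mathrm{Der}(f)$ (i.e. members of a system of generators of $\mathrm{Der}(f)$) that are weighted homogeneous of weighted degrees $d_1\le\dots\le d_{n-1}$, with respective tensors $T_i=(g_0^i,g_1^i,\dots,g_n^i)$, such that the weighted Multiple eigenscheme $E(T_1,\dots,T_{n-1})$ has codimension $2$. Then $V(f)$ is free with weighted exponents $$\Big(d_1,\dots,d_{n-1},\ d+\sum_{i=0}^n(1-\omega_i)-d_1-\dots-d_{n-1}-1\Big)$$ if and only if $f\in I_{E(T_1,\dots,T_{n-1})}$.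
   Context: $\mathbb{P}^n_\omega=\mathrm{Proj}\,S$ is weighted projective space. A polynomial is weighted homogeneous of (weighted) degree $e$ if each of its monomials $\prod x_i^{s_i}$ has weighted degree $\sum s_i\omega_i=e$. $\mathrm{Der}_K(S)=\bigoplus_i S\,\partial_{x_i}$ is graded by setting $\deg_\omega(\partial_{x_i})=1-\omega_i$; a derivation $\sum_j g_j\partial_{x_j}$ is weighted homogeneous of degree $e$ if each $g_j$ is weighted homogeneous of weighted degree $e-(1-\omega_j)$ (or zero). $\mathrm{Der}(f)=\{\delta\in\mathrm{Der}_K(S): \delta(f)\in Sf\}$ and $\mathrm{Der}_0(f)=\{\delta\in\mathrm{Der}_K(S):\delta(f)=0\}$. With the weighted Euler derivation $\delta_{\mathcal{E}_\omega}=\sum_i\omega_ix_i\partial_{x_i}$ (of weighted degree $1$) one has $\mathrm{Der}(f)=S\delta_{\mathcal{E}_\omega}\oplus\mathrm{Der}_0(f)$. The divisor $V(f)$ is free with weighted exponents $(a_1,\dots,a_n)$ if $\mathrm{Der}_0(f)$ is a free $S$-module with a basis of weighted homogeneous derivations of weighted degrees $a_1,\dots,a_n$ (the order of the exponents being irrelevant). The weighted Multiple eigenscheme $E(T_1,\dots,T_{n-1})\subset\mathbb{P}^n_\omega$ is the closed subscheme defined by the ideal $I_{E(T_1,\dots,T_{n-1})}\subset S$ generated by the $n\times n$ minors of the $n\times(n+1)$ matrix whose first row is $(\omega_0x_0,\omega_1x_1,\dots,\omega_nx_n)$ and whose $(i+1)$-st row is $(g_0^i,g_1^i,\dots,g_n^i)$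 for $i=1,\dots,n-1$. Its codimension is the codimension (height) of this ideal. *)

theory Defs
  imports
    "HOL-Library.Poly_Mapping"
    "HOL-Library.Extended_Nat"
    "HOL-Algebra.Ideal"
    "HOL-Algebra.Divisibility"
    "Jordan_Normal_Form.Determinant"
begin

section \<open>The polynomial ring\<close>

text \<open>A monomial is its exponent vector; a polynomial maps monomials to coefficients, and its
  multiplication is the convolution product of \<^theory>\<open>HOL-Library.Poly_Mapping\<close>.\<close>

type_synonym 'k mpoly = "(nat \<Rightarrow>\<^sub>0 nat) \<Rightarrow>\<^sub>0 'k"

definition mvar :: "nat \<Rightarrow> 'k::field_char_0 mpoly" where
  "mvar i = Poly_Mapping.single (Poly_Mapping.single i 1) 1"

text \<open>The ring K[x_0,...,x_n]: since the number of variables is not fixed by the type, it is a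
  carrier inside the polynomials in countably many variables.\<close>

definition poly_ring :: "nat \<Rightarrow> 'k::field_char_0 mpoly ring" where
  "poly_ring n =
     \<lparr>carrier = {p. \<forall>m \<in> Poly_Mapping.keys p. Poly_Mapping.keys m \<subseteq> {0..n}},
      monoid.mult = (*), monoid.one = 1, ring.zero = 0, ring.add = (+)\<rparr>"

lemma poly_ring_simps [simp]:
  "monoid.mult (poly_ring n) = (*)" "monoid.one (poly_ring n) = 1"
  "ring.zero (poly_ring n) = 0" "ring.add (poly_ring n) = (+)"
  by (simp_all add: poly_ring_def)

lemma poly_ring_add_closed:
  "p \<in> carrier (poly_ring n) \<Longrightarrow> q \<in> carrier (poly_ring n) \<Longrightarrow> p + q \<in> carrier (poly_ring n)"
  using Poly_Mapping.keys_add[of p q] by (fastforce simp: poly_ring_def)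

lemma poly_ring_mult_closed:
  assumes "p \<in> carrier (poly_ring n)" "q \<in> carrier (poly_ring n)"
  shows "p * q \<in> carrier (poly_ring n)"
proof -
  have "Poly_Mapping.keys m \<subseteq> {0..n}" if m: "m \<in> Poly_Mapping.keys (p * q)" for m
  proof -
    from m Poly_Mapping.keys_mult[of p q] obtain a b
      where "m = a + b" "a \<in> Poly_Mapping.keys p" "b \<in> Poly_Mapping.keys q" by blast
    then show ?thesis
      using assms Poly_Mapping.keys_add[of a b] by (fastforce simp: poly_ring_def)
  qed
  then show ?thesis by (simp add: poly_ring_def)
qed

lemma cring_poly_ring: "cring (poly_ring n :: 'k::field_char_0 mpoly ring)"
proof (rule cringI)
  show "abelian_group (poly_ring n :: 'k mpoly ring)"
  proof (rule abelian_groupI)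
    fix x :: "'k mpoly" assume "x \<in> carrier (poly_ring n)"
    then show "\<exists>y\<in>carrier (poly_ring n). y \<oplus>\<^bsub>poly_ring n\<^esub> x = \<zero>\<^bsub>poly_ring n\<^esub>"
      by (intro bexI[of _ "- x"]) (auto simp: poly_ring_def)
  qed (auto simp: poly_ring_add_closed algebra_simps, auto simp: poly_ring_def)
  show "comm_monoid (poly_ring n :: 'k mpoly ring)"
    by (rule comm_monoidI) (auto simp: poly_ring_mult_closed algebra_simps, auto simp: poly_ring_def)
qed (auto simp: algebra_simps)

text \<open>Reduced means without multiple factors.\<close>

definition reduced_poly :: "nat \<Rightarrow> 'k::field_char_0 mpoly \<Rightarrow> bool" where
  "reduced_poly n f \<longleftrightarrow> f \<in> carrier (poly_ring n) \<and> f \<noteq> 0 \<and>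
     (\<forall>g \<in> carrier (poly_ring n).
        (g \<otimes>\<^bsub>poly_ring n\<^esub> g) divides\<^bsub>poly_ring n\<^esub> f \<longrightarrow> g \<in> Units (poly_ring n))"


section \<open>Weighted degrees\<close>

definition wdeg :: "(nat \<Rightarrow> nat) \<Rightarrow> (nat \<Rightarrow>\<^sub>0 nat) \<Rightarrow> nat" where
  "wdeg \<omega> m = (\<Sum>i \<in> Poly_Mapping.keys m. Poly_Mapping.lookup m i * \<omega> i)"

text \<open>Degrees are integers because the coefficients of a homogeneous derivation may formally have
  negative degree; the zero polynomial is homogeneous of every degree.\<close>

definition weighted_homogeneous :: "(nat \<Rightarrow> nat) \<Rightarrow> int \<Rightarrow> 'k::field_char_0 mpoly \<Rightarrow> bool" where
  "weighted_homogeneous \<omega> e p \<longleftrightarrow> (\<forall>m \<in> Poly_Mapping.keys p. int (wdeg \<omega> m) = e)"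


section \<open>Derivations\<close>

text \<open>The derivation sum_j g_j d/dx_j of K[x_0,...,x_n] is represented by its family of
  coefficients g, extended by 0 beyond the index n.\<close>

type_synonym 'k derivation = "nat \<Rightarrow> 'k mpoly"

definition Der_all :: "nat \<Rightarrow> 'k::field_char_0 derivation set" where
  "Der_all n = {g. (\<forall>j\<le>n. g j \<in> carrier (poly_ring n)) \<and> (\<forall>j>n. g j = 0)}"

text \<open>For monomials not containing x_i the truncated exponent is harmless, as the new
  coefficient is 0.\<close>

definition partial_deriv :: "nat \<Rightarrow> 'k::field_char_0 mpoly \<Rightarrow> 'k mpoly" where
  "partial_deriv i p = (\<Sum>m \<in> Poly_Mapping.keys p.
     Poly_Mapping.single (m - Poly_Mapping.single i 1)
       (of_nat (Poly_Mapping.lookup m i) * Poly_Mapping.lookup p m))"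

definition apply_der :: "nat \<Rightarrow> 'k::field_char_0 derivation \<Rightarrow> 'k mpoly \<Rightarrow> 'k mpoly" where
  "apply_der n g p = (\<Sum>j=0..n. g j * partial_deriv j p)"

definition Der :: "nat \<Rightarrow> 'k::field_char_0 mpoly \<Rightarrow> 'k derivation set" where
  "Der n f = {g \<in> Der_all n. apply_der n g f \<in> PIdl\<^bsub>poly_ring n\<^esub> f}"

definition Der0 :: "nat \<Rightarrow> 'k::field_char_0 mpoly \<Rightarrow> 'k derivation set" where
  "Der0 n f = {g \<in> Der_all n. apply_der n g f = 0}"

definition homogeneous_der ::
    "nat \<Rightarrow> (nat \<Rightarrow> nat) \<Rightarrow> int \<Rightarrow> 'k::field_char_0 derivation \<Rightarrow> bool" where
  "homogeneous_der n \<omega> e g \<longleftrightarrow>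
     (\<forall>j\<le>n. weighted_homogeneous \<omega> (e - (1 - int (\<omega> j))) (g j))"

definition euler :: "nat \<Rightarrow> (nat \<Rightarrow> nat) \<Rightarrow> 'k::field_char_0 derivation" where
  "euler n \<omega> j = (if j \<le> n then of_nat (\<omega> j) * mvar j else 0)"

definition system_of_generators ::
    "nat \<Rightarrow> 'k::field_char_0 derivation set \<Rightarrow> 'k derivation set \<Rightarrow> bool" where
  "system_of_generators n G M \<longleftrightarrow> G \<subseteq> M \<and>
     (\<forall>\<eta> \<in> M. \<exists>F c. finite F \<and> F \<subseteq> G \<and> (\<forall>\<theta>\<in>F. c \<theta> \<in> carrier (poly_ring n)) \<and>
        \<eta> = (\<lambda>j. \<Sum>\<theta>\<in>F. c \<theta> * \<theta> j))"

definition module_basis ::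
    "nat \<Rightarrow> 'k::field_char_0 derivation list \<Rightarrow> 'k derivation set \<Rightarrow> bool" where
  "module_basis n \<theta>s M \<longleftrightarrow> set \<theta>s \<subseteq> M \<and>
     (\<forall>\<eta> \<in> M. \<exists>!cs. length cs = length \<theta>s \<and> set cs \<subseteq> carrier (poly_ring n) \<and>
        \<eta> = (\<lambda>j. \<Sum>k<length \<theta>s. cs ! k * (\<theta>s ! k) j))"

text \<open>As the basis may be reordered, this does not depend on the order of the list of exponents.\<close>

definition free_with_exponents ::
    "nat \<Rightarrow> (nat \<Rightarrow> nat) \<Rightarrow> 'k::field_char_0 mpoly \<Rightarrow> int list \<Rightarrow> bool" where
  "free_with_exponents n \<omega> f as \<longleftrightarrow> length as = n \<and>
     (\<exists>\<theta>s. length \<theta>s = n \<and> module_basis n \<theta>s (Der0 n f) \<and>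
        (\<forall>k<n. homogeneous_der n \<omega> (as ! k) (\<theta>s ! k)))"


section \<open>The multiple eigenscheme\<close>

text \<open>Rows and columns are counted from 0: row 0 is the Euler row, row i for i = 1,...,n-1 is the
  tensor of the i-th derivation.\<close>

definition eigen_matrix ::
    "nat \<Rightarrow> (nat \<Rightarrow> nat) \<Rightarrow> (nat \<Rightarrow> 'k::field_char_0 derivation) \<Rightarrow> 'k mpoly mat" where
  "eigen_matrix n \<omega> \<delta> = mat n (n + 1) (\<lambda>(i, j). if i = 0 then euler n \<omega> j else \<delta> i j)"

text \<open>The maximal minors arise by deleting one column k: \<^const>\<open>insert_index\<close> enumerates
  the remaining columns in increasing order.\<close>

definition eigen_ideal ::
    "nat \<Rightarrow> (nat \<Rightarrow> nat) \<Rightarrow> (nat \<Rightarrow> 'k::field_char_0 derivation) \<Rightarrow> 'k mpoly set" where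
  "eigen_ideal n \<omega> \<delta> = Idl\<^bsub>poly_ring n\<^esub>
     {det (mat n n (\<lambda>(i, j). eigen_matrix n \<omega> \<delta> $$ (i, insert_index k j))) | k. k \<le> n}"


section \<open>Height of an ideal\<close>

definition prime_height :: "('a, 'b) ring_scheme \<Rightarrow> 'a set \<Rightarrow> enat" where
  "prime_height R P = Sup {enat k | k. \<exists>Q :: nat \<Rightarrow> 'a set.
     (\<forall>i\<le>k. primeideal (Q i) R) \<and> (\<forall>i<k. Q i \<subset> Q (Suc i)) \<and> Q k = P}"

text \<open>The unit ideal has height infinity, as the infimum of the empty set.\<close>

definition ideal_height :: "('a, 'b) ring_scheme \<Rightarrow> 'a set \<Rightarrow> enat" where
  "ideal_height R I = Inf {prime_height R P | P. primeideal P R \<and> I \<subseteq> P}"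

end

theory Submission
  imports Defs "HOL-Computational_Algebra.Polynomial"
begin

text \<open>For rows \<open>\<rho>\<^sub>0, \<dots>, \<rho>\<^sub>n\<close> of coefficients of derivations in \<open>Der f\<close>, multiplying the matrix by the
  gradient of \<open>f\<close> gives a vector divisible by \<open>f\<close>; Cramer's rule and reducedness of \<open>f\<close> show
  that \<open>f\<close> divides the determinant. If the determinant equals \<open>f\<close>, then Cramer's rule expresses
  every element of \<open>Der f\<close> through the rows (Saito's criterion).

  Codimension 2 means that the maximal minors of the eigenscheme matrix have no common prime
  factor. If \<open>f\<close> lies in their ideal, it is the determinant obtained by adding a row \<open>h\<close>, and
  \<open>f\<close> divides \<open>h(f)\<close> times each minor, so \<open>h\<close> lies in \<open>Der f\<close> and completes a basis.

  Conversely, comparing dimensions in the degree of the last exponent gives a homogeneous \<open>y\<close> in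
  \<open>Der\<^sub>0 f\<close> outside the span of the Euler derivation and the \<open>\<delta>\<^sub>i\<close>. The determinant with last row
  \<open>y\<close> has the degree of \<open>f\<close>, hence is a scalar multiple of \<open>f\<close>. It is not zero, since otherwise
  Cramer's rule and coprimality of the minors would put \<open>y\<close> into that span.\<close>

section \<open>Unique factorization for polynomial rings over subrings\<close>

text \<open>The ring K[x_0,...,x_n] is a subset of a type, so divisibility, primes and factorization
  are taken relative to a subset, and unique factorization is proved for subsets. Its main use is
  \<open>coprime_cancel\<close>: if q divides all products g * c_j, then q divides g, the c_j being
  the partial derivatives of f or the maximal minors. The last exponent is forced by degrees. A row
  of degree a has its entry in column j of degree a - (1 - \<omega> j), so the determinant has
  degree the sum of the row degrees minus the sum of all 1 - \<omega> j; the Euler row contributes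
  1, and the last row must supply what is missing to d. The obstacle in passing from freeness to
  membership is that the \<delta> i need not belong to the given basis: only their degrees agree
  with exponents. Hence a dimension count in place of an exchange argument. Moving between Der f and
  Der_0 f means dividing Euler's formula by d. A constant f, with d = 0, is therefore excluded
  separately on each side of the equivalence.\<close>

definition rdvd :: "'a::idom set \<Rightarrow> 'a \<Rightarrow> 'a \<Rightarrow> bool" where
  "rdvd R a b \<longleftrightarrow> (\<exists>c\<in>R. b = a * c)"

definition prime_in :: "'a::idom set \<Rightarrow> 'a \<Rightarrow> bool" where
  "prime_in R p \<longleftrightarrow> p \<in> R \<and> p \<noteq> 0 \<and> \<not> rdvd R p 1 \<and>
     (\<forall>a\<in>R. \<forall>b\<in>R. rdvd R p (a * b) \<longrightarrow> rdvd R p a \<or> rdvd R p b)"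

text \<open>The index counts the prime factors and is the measure for descents. As the factors are
  prime and not merely irreducible, existence of such a product already contains uniqueness up to
  order and units.\<close>

inductive prime_product :: "'a::idom set \<Rightarrow> nat \<Rightarrow> 'a \<Rightarrow> bool" for R where
  unit: "u \<in> R \<Longrightarrow> rdvd R u 1 \<Longrightarrow> prime_product R 0 u"
| prime: "prime_in R p \<Longrightarrow> prime_product R n r \<Longrightarrow> prime_product R (Suc n) (p * r)"

locale subring_of =
  fixes R :: "'a::idom set"
  assumes zero_closed [simp, intro]: "0 \<in> R"
    and one_closed [simp, intro]: "1 \<in> R"
    and add_closed [intro]: "a \<in> R \<Longrightarrow> b \<in> R \<Longrightarrow> a + b \<in> R"
    and uminus_closed [intro]: "a \<in> R \<Longrightarrow> - a \<in> R"
    and mult_closed [intro]: "a \<in> R \<Longrightarrow> b \<in> R \<Longrightarrow> a * b \<in> R"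
begin

lemma diff_closed [intro]: "a \<in> R \<Longrightarrow> b \<in> R \<Longrightarrow> a - b \<in> R"
  using add_closed[of a "- b"] uminus_closed[of b] by simp

lemma of_nat_closed [simp, intro]: "of_nat a \<in> R"
  by (induction a) auto

lemma power_closed [intro]: "a \<in> R \<Longrightarrow> a ^ k \<in> R"
  by (induction k) auto

lemma sum_closed: "(\<And>i. i \<in> I \<Longrightarrow> f i \<in> R) \<Longrightarrow> sum f I \<in> R"
  by (induction I rule: infinite_finite_induct) auto

lemma prod_closed: "(\<And>i. i \<in> I \<Longrightarrow> f i \<in> R) \<Longrightarrow> prod f I \<in> R"
  by (induction I rule: infinite_finite_induct) auto

lemma rdvd_refl [simp]: "rdvd R a a"
  unfolding rdvd_def by (rule bexI[of _ 1]) auto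

lemma rdvd_0 [simp]: "rdvd R a 0"
  unfolding rdvd_def by (rule bexI[of _ 0]) auto

lemma rdvd_trans: "rdvd R a b \<Longrightarrow> rdvd R b c \<Longrightarrow> rdvd R a c"
  unfolding rdvd_def by (metis mult.assoc mult_closed)

lemma rdvd_mult: "rdvd R a b \<Longrightarrow> c \<in> R \<Longrightarrow> rdvd R a (b * c)"
  unfolding rdvd_def by (metis mult.assoc mult_closed)

lemma rdvd_mult2: "rdvd R a b \<Longrightarrow> c \<in> R \<Longrightarrow> rdvd R a (c * b)"
  using rdvd_mult[of a b c] by (simp add: mult.commute)

lemma rdvd_triv: "c \<in> R \<Longrightarrow> rdvd R a (a * c)"
  unfolding rdvd_def by auto

lemma rdvd_add: "rdvd R a b \<Longrightarrow> rdvd R a c \<Longrightarrow> rdvd R a (b + c)"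
  unfolding rdvd_def by (metis add_closed distrib_left)

lemma rdvd_uminus: "rdvd R a b \<Longrightarrow> rdvd R a (- b)"
  unfolding rdvd_def by (metis minus_mult_right uminus_closed)

lemma rdvd_diff: "rdvd R a b \<Longrightarrow> rdvd R a c \<Longrightarrow> rdvd R a (b - c)"
  using rdvd_add[of a b "- c"] rdvd_uminus[of a c] by simp

lemma rdvd_sum: "(\<And>i. i \<in> I \<Longrightarrow> rdvd R a (f i)) \<Longrightarrow> rdvd R a (sum f I)"
  by (induction I rule: infinite_finite_induct) (auto intro: rdvd_add)

lemma rdvd_mult_cancel: "a \<noteq> 0 \<Longrightarrow> rdvd R (a * b) (a * c) \<longleftrightarrow> rdvd R b c"
  unfolding rdvd_def by (auto simp: mult.assoc)

lemma rdvd_mult_right: "b \<in> R \<Longrightarrow> rdvd R (a * b) c \<Longrightarrow> rdvd R a c"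
  unfolding rdvd_def by (metis mult.assoc mult_closed)

lemma unit_rdvd: "rdvd R u 1 \<Longrightarrow> a \<in> R \<Longrightarrow> rdvd R u a"
  using rdvd_mult[of u 1 a] by simp

lemma unit_mult: "rdvd R u 1 \<Longrightarrow> rdvd R v 1 \<Longrightarrow> rdvd R (u * v) 1"
  unfolding rdvd_def by (metis mult.assoc mult.left_commute mult_1_right mult_closed)

lemma prime_inD:
  assumes "prime_in R p"
  shows "p \<in> R" "p \<noteq> 0" "\<not> rdvd R p 1"
    "a \<in> R \<Longrightarrow> b \<in> R \<Longrightarrow> rdvd R p (a * b) \<Longrightarrow> rdvd R p a \<or> rdvd R p b"
  using assms unfolding prime_in_def by auto

lemma prime_product_closed: "prime_product R n r \<Longrightarrow> r \<in> R \<and> r \<noteq> 0"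
proof (induction rule: prime_product.induct)
  case (unit u)
  then show ?case by (auto simp: rdvd_def)
qed (auto dest: prime_inD)

lemma prime_product_unit_mult:
  assumes "prime_product R n r" "u \<in> R" "rdvd R u 1"
  shows "prime_product R n (u * r)"
  using assms
proof (induction rule: prime_product.induct)
  case (unit v)
  then show ?case by (intro prime_product.unit) (auto intro: unit_mult)
next
  case (prime p n r)
  then show ?case
    using prime_product.prime[of R p n "u * r"] by (simp add: mult.left_commute)
qed

lemma prime_product_mult:
  assumes "prime_product R n r" "prime_product R m s"
  shows "prime_product R (n + m) (r * s)"
  using assms
proof (induction rule: prime_product.induct)
  case (unit u)
  then show ?case by (simp add: prime_product_unit_mult)
next
  case (prime p n r)
  then show ?case using prime_product.prime[of R p "n + m" "r * s"] by (simp add: mult.assoc)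
qed

text \<open>The prime p divides the tail of the product, where the induction applies, or the head,
  which is then associated to p. The strict drop of the count is what later descents
  consume.\<close>

lemma prime_product_cancel:
  assumes "prime_product R n r" "prime_in R p" "r = p * s" "s \<in> R"
  shows "\<exists>m<n. prime_product R m s"
  using assms
proof (induction arbitrary: s rule: prime_product.induct)
  case (unit u)
  have "rdvd R p u" unfolding unit by (rule rdvd_triv) fact
  then show ?case using unit(2) prime_inD(3)[OF unit(3)] rdvd_trans by blast
next
  case (prime q n t)
  note q = prime_inD[OF prime(1)] and p = prime_inD[OF prime(4)]
  have t: "t \<in> R" "t \<noteq> 0" using prime_product_closed[OF prime(2)] by auto
  have "rdvd R p (q * t)" unfolding prime by (rule rdvd_triv) fact
  then consider "rdvd R p t" | "rdvd R p q" using p(4) q(1) t(1) by blast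
  then show ?case
  proof cases
    case 1
    then obtain s' where s': "s' \<in> R" "t = p * s'" by (auto simp: rdvd_def)
    then obtain m where m: "m < n" "prime_product R m s'" using prime.IH prime(4) by blast
    have "s = q * s'" using prime(5) s'(2) p(2) by (simp add: mult.left_commute)
    then show ?thesis using prime_product.prime[OF prime(1) m(2)] m(1) by (metis Suc_mono)
  next
    case 2
    then obtain u where u: "u \<in> R" "q = p * u" by (auto simp: rdvd_def)
    have "rdvd R q p \<or> rdvd R q u" using q(4)[OF p(1) u(1)] u(2) by simp
    moreover have "\<not> rdvd R q u"
    proof
      assume "rdvd R q u"
      then obtain v where v: "v \<in> R" "u = q * v" by (auto simp: rdvd_def)
      then have "q * 1 = q * (p * v)" using u(2) by (simp add: mult.left_commute)
      then have "1 = p * v" using q(2) by (metis mult_left_cancel)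
      then show False using p(3) v(1) by (auto simp: rdvd_def)
    qed
    ultimately obtain w where w: "w \<in> R" "p = q * w" by (auto simp: rdvd_def)
    then have "p * 1 = p * (u * w)" using u(2) by (simp add: mult.assoc)
    then have "1 = u * w" using p(2) by (metis mult_left_cancel)
    then have "rdvd R u 1" using w(1) by (auto simp: rdvd_def)
    moreover have "s = u * t" using prime(5) u(2) p(2) by (simp add: mult.assoc)
    ultimately show ?thesis using prime_product_unit_mult[OF prime(2)] u(1) by blast
  qed
qed

text \<open>The primes of q are stripped off one at a time; each divides g because it fails to
  divide some c j. The index j may vary with the prime, and no single c j need be coprime to q.
  Coprimality is demanded only at primes dividing q, which is all that is known of the partial
  derivatives of f.\<close>

lemma coprime_cancel:
  assumes "prime_product R n q" "g \<in> R" "\<And>j. j \<in> J \<Longrightarrow> c j \<in> R" "J \<noteq> {}"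
    and "\<And>j. j \<in> J \<Longrightarrow> rdvd R q (g * c j)"
    and "\<And>p. prime_in R p \<Longrightarrow> rdvd R p q \<Longrightarrow> \<exists>j\<in>J. \<not> rdvd R p (c j)"
  shows "rdvd R q g"
  using assms
proof (induction arbitrary: g rule: prime_product.induct)
  case (unit u)
  then show ?case using unit_rdvd by blast
next
  case (prime p n r)
  note p = prime_inD[OF prime(1)]
  have r: "r \<in> R" using prime_product_closed[OF prime(2)] by auto
  obtain j where j: "j \<in> J" "\<not> rdvd R p (c j)"
    using prime(8)[OF prime(1)] rdvd_triv[OF r] by blast
  have "rdvd R p (g * c j)" using prime(7)[OF j(1)] rdvd_mult_right[OF r] by blast
  then have "rdvd R p g" using p(4)[OF prime(4) prime(5)[OF j(1)]] j(2) by blast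
  then obtain g' where g': "g' \<in> R" "g = p * g'" by (auto simp: rdvd_def)
  have "rdvd R r g'"
  proof (rule prime.IH)
    show "rdvd R r (g' * c j)" if "j \<in> J" for j
      using prime(7)[OF that] rdvd_mult_cancel[OF p(2)] g'(2) by (simp add: mult.assoc)
    show "\<exists>j\<in>J. \<not> rdvd R s (c j)" if "prime_in R s" "rdvd R s r" for s
      using prime(8)[OF that(1)] rdvd_mult2[OF that(2) p(1)] by blast
  qed (use g' prime in auto)
  then show ?case using rdvd_mult_cancel[OF p(2)] g'(2) by simp
qed

end

locale factorial_subring = subring_of +
  assumes prime_product_exists: "r \<in> R \<Longrightarrow> r \<noteq> 0 \<Longrightarrow> \<exists>n. prime_product R n r"

section \<open>Univariate polynomials over a subring: Gauss's lemma and pseudo-division\<close>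

definition polys_over :: "'a::idom set \<Rightarrow> 'a poly set" where
  "polys_over R = {p. \<forall>i. coeff p i \<in> R}"

context subring_of
begin

lemma subring_polys_over: "subring_of (polys_over R)"
proof
  show "(1 :: 'a poly) \<in> polys_over R"
    by (auto simp: polys_over_def coeff_1)
qed (auto simp: polys_over_def coeff_mult intro!: sum_closed)

lemma pCons_over: "[:c:] \<in> polys_over R \<longleftrightarrow> c \<in> R"
  by (auto simp: polys_over_def coeff_pCons split: nat.splits)

lemma smult_over: "c \<in> R \<Longrightarrow> p \<in> polys_over R \<Longrightarrow> smult c p \<in> polys_over R"
  by (auto simp: polys_over_def)

lemma monom_over: "c \<in> R \<Longrightarrow> monom c k \<in> polys_over R"
  by (auto simp: polys_over_def)

lemma rdvd_const_iff:
  assumes "p \<in> polys_over R"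
  shows "rdvd (polys_over R) [:c:] p \<longleftrightarrow> (\<forall>i. rdvd R c (coeff p i))"
proof
  assume "rdvd (polys_over R) [:c:] p"
  then show "\<forall>i. rdvd R c (coeff p i)" by (auto simp: rdvd_def polys_over_def)
next
  assume "\<forall>i. rdvd R c (coeff p i)"
  then obtain g where g: "\<And>i. g i \<in> R \<and> coeff p i = c * g i" unfolding rdvd_def by metis
  define q where "q = Poly (map g [0..<Suc (degree p)])"
  have q: "coeff q i = (if i \<le> degree p then g i else 0)" for i
    by (auto simp: q_def coeff_Poly_eq nth_default_def simp del: upt_Suc)
  have "p = [:c:] * q"
    by (rule poly_eqI) (use g q coeff_eq_0[of p] in auto)
  moreover have "q \<in> polys_over R" using g q by (auto simp: polys_over_def)
  ultimately show "rdvd (polys_over R) [:c:] p" by (auto simp: rdvd_def)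
qed

lemma rdvd_const_const: "rdvd (polys_over R) [:c:] [:b:] \<longleftrightarrow> rdvd R c b" if "b \<in> R"
proof -
  have "[:b:] \<in> polys_over R" using that pCons_over by simp
  then show ?thesis
    by (auto simp: rdvd_const_iff coeff_pCons split: nat.splits)
qed

text \<open>Gauss's lemma. With i and j the least positions at which c fails to divide the
  coefficients of p and q, the coefficient of p * q at i + j has exactly one summand not divisible
  by c.\<close>

lemma prime_in_polys_over:
  assumes "prime_in R c"
  shows "prime_in (polys_over R) [:c:]"
proof -
  interpret P: subring_of "polys_over R" by (rule subring_polys_over)
  note c = prime_inD[OF assms]
  have "rdvd (polys_over R) [:c:] p \<or> rdvd (polys_over R) [:c:] q"
    if pq: "p \<in> polys_over R" "q \<in> polys_over R" "rdvd (polys_over R) [:c:] (p * q)" for p q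
  proof (rule ccontr)
    assume "\<not> ?thesis"
    then have ex: "\<exists>i. \<not> rdvd R c (coeff p i)" "\<exists>j. \<not> rdvd R c (coeff q j)"
      using pq(1,2) rdvd_const_iff by blast+
    define i j where "i = (LEAST i. \<not> rdvd R c (coeff p i))"
      and "j = (LEAST j. \<not> rdvd R c (coeff q j))"
    have i: "\<not> rdvd R c (coeff p i)" "\<And>k. k < i \<Longrightarrow> rdvd R c (coeff p k)"
      unfolding i_def using LeastI_ex[OF ex(1)] not_less_Least by blast+
    have j: "\<not> rdvd R c (coeff q j)" "\<And>k. k < j \<Longrightarrow> rdvd R c (coeff q k)"
      unfolding j_def using LeastI_ex[OF ex(2)] not_less_Least by blast+
    have cl: "coeff p k \<in> R" "coeff q k \<in> R" for k using pq by (auto simp: polys_over_def)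
    let ?f = "\<lambda>k. coeff p k * coeff q (i + j - k)"
    have "coeff (p * q) (i + j) = ?f i + (\<Sum>k\<in>{..i + j} - {i}. ?f k)"
      unfolding coeff_mult by (subst sum.remove[of _ i]) auto
    then have "?f i = coeff (p * q) (i + j) - (\<Sum>k\<in>{..i + j} - {i}. ?f k)" by simp
    moreover have "rdvd R c (\<Sum>k\<in>{..i + j} - {i}. ?f k)"
    proof (rule rdvd_sum)
      fix k assume "k \<in> {..i + j} - {i}"
      then consider "k < i" | "i + j - k < j" by fastforce
      then show "rdvd R c (?f k)"
        using i(2)[of k] j(2)[of "i + j - k"] cl by cases (auto intro: rdvd_mult rdvd_mult2)
    qed
    moreover have "rdvd R c (coeff (p * q) (i + j))"
      using pq rdvd_const_iff P.mult_closed by blast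
    ultimately have "rdvd R c (?f i)" using rdvd_diff by simp
    then show False using c(4)[of "coeff p i" "coeff q j"] cl i(1) j(1) by simp
  qed
  then show ?thesis
    using c rdvd_const_const[OF one_closed, of c] pCons_over
    unfolding prime_in_def by (simp add: pCons_one)
qed

lemma prime_product_polys_over:
  "prime_product R n r \<Longrightarrow> prime_product (polys_over R) n [:r:]"
proof (induction rule: prime_product.induct)
  case (unit u)
  then show ?case
    using rdvd_const_const[OF one_closed, of u] pCons_over
    by (intro prime_product.unit) (auto simp: pCons_one)
next
  case (prime p n r)
  then show ?case using prime_product.prime[OF prime_in_polys_over[OF prime(1)] prime(3)]
    by (simp add: mult.commute)
qed

text \<open>Leading coefficients cannot be inverted in R, so each division step multiplies by the
  leading coefficient of g instead; these multipliers accumulate in c.\<close>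

lemma pseudo_division:
  assumes "g \<in> polys_over R" "g \<noteq> 0" "a \<in> polys_over R"
  shows "\<exists>c\<in>R. c \<noteq> 0 \<and> (\<exists>q\<in>polys_over R. \<exists>r\<in>polys_over R.
           smult c a = g * q + r \<and> (r = 0 \<or> degree r < degree g))"
  using assms(3)
\<comment> \<open>The degree of 0 is 0, so the measure is shifted by one to make the zero polynomial
  smaller than a nonzero constant.\<close>
proof (induction "if a = 0 then 0 else Suc (degree a)" arbitrary: a rule: less_induct)
  case less
  interpret P: subring_of "polys_over R" by (rule subring_polys_over)
  show ?case
  proof (cases "a = 0 \<or> degree a < degree g")
    case True
    then show ?thesis
      using less(2) by (intro bexI[of _ 1] conjI bexI[of _ 0] bexI[of _ a]) auto
  next
    case False
    define k where "k = degree a - degree g"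
    define m where "m = monom (lead_coeff a) k"
    define b where "b = smult (lead_coeff g) a - g * m"
    have cl: "lead_coeff a \<in> R" "lead_coeff g \<in> R" "m \<in> polys_over R"
      using less(2) assms(1) by (auto simp: polys_over_def m_def)
    have b: "b \<in> polys_over R" unfolding b_def using less(2) assms(1) cl smult_over by blast
    have a0: "a \<noteq> 0" and deg: "degree g \<le> degree a" using False by auto
    have m0: "m \<noteq> 0" "degree m = k" "lead_coeff m = lead_coeff a"
      using a0 by (auto simp: m_def degree_monom_eq)
    have dgm: "degree (g * m) = degree a"
      using deg assms(2) m0 by (simp add: degree_mult_eq k_def)
    have "coeff (g * m) (degree a) = lead_coeff g * lead_coeff a"
      using lead_coeff_mult[of g m] dgm m0 by simp
    then have "coeff b (degree a) = 0" by (simp add: b_def)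
    moreover have "degree b \<le> degree a"
      unfolding b_def using dgm by (intro degree_diff_le) auto
    ultimately have "b = 0 \<or> degree b < degree a"
      by (metis le_neq_implies_less leading_coeff_0_iff)
    then have "(if b = 0 then 0 else Suc (degree b)) < (if a = 0 then 0 else Suc (degree a))"
      using a0 by auto
    from less(1)[OF this b] obtain c q r where c: "c \<in> R" "c \<noteq> 0" "q \<in> polys_over R"
      "r \<in> polys_over R" "smult c b = g * q + r" "r = 0 \<or> degree r < degree g" by blast
    have "smult (c * lead_coeff g) a = g * (q + smult c m) + r"
      using c(5) by (simp add: b_def smult_diff_right algebra_simps)
    moreover have "c * lead_coeff g \<in> R" "c * lead_coeff g \<noteq> 0" "q + smult c m \<in> polys_over R"
      using c cl assms(2) smult_over[OF c(1) cl(3)] P.add_closed[OF c(3)] by auto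
    ultimately show ?thesis using c(4,6) by blast
  qed
qed

text \<open>Trivial content, expressed through primes so that no gcd has to be chosen.\<close>

definition primitive :: "'a poly \<Rightarrow> bool" where
  "primitive p \<longleftrightarrow> (\<forall>c. prime_in R c \<longrightarrow> \<not> rdvd (polys_over R) [:c:] p)"

text \<open>This stands in for passing to the fraction field: every prime of c divides p * h but not
  p, hence divides h, and is cancelled.\<close>

lemma primitive_cancel:
  assumes "prime_product R n c" "primitive p" "p \<in> polys_over R" "h \<in> polys_over R"
    "b \<in> polys_over R" "p * h = smult c b"
  shows "rdvd (polys_over R) p b"
  using assms
proof (induction arbitrary: h rule: prime_product.induct)
  case (unit u)
  then obtain v where v: "v \<in> R" "1 = u * v" by (auto simp: rdvd_def)
  have "b = smult v (smult u b)" using v by (simp add: mult.commute)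
  also have "\<dots> = p * smult v h" using unit(7) by simp
  finally show ?case using smult_over[OF v(1) unit(5)] unfolding rdvd_def by blast
next
  case (prime q n r)
  interpret P: subring_of "polys_over R" by (rule subring_polys_over)
  note q = P.prime_inD[OF prime_in_polys_over[OF prime(1)]]
  have r: "r \<in> R" using prime_product_closed[OF prime(2)] by blast
  have eq: "p * h = [:q:] * smult r b" using prime(8) by (simp add: mult.commute)
  then have "rdvd (polys_over R) [:q:] (p * h)"
    using P.rdvd_triv smult_over[OF r prime(7)] by metis
  then have "rdvd (polys_over R) [:q:] h"
    using q(4) prime(1,4,5,6) unfolding primitive_def by blast
  then obtain h' where h': "h' \<in> polys_over R" "h = [:q:] * h'" by (auto simp: rdvd_def)
  have "[:q:] * (p * h') = [:q:] * smult r b"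
    using eq h'(2) by (metis mult.left_commute)
  then have "p * h' = smult r b" using q(2) by (metis mult_left_cancel)
  then show ?case using prime.IH prime h' by blast
qed

end

section \<open>Factorization of primitive polynomials\<close>

context factorial_subring
begin

text \<open>Extracting a prime constant from p also removes a prime factor from the leading
  coefficient, so the number of prime factors of the latter bounds the number of
  extractions.\<close>

lemma primitive_part:
  assumes "p \<in> polys_over R" "p \<noteq> 0"
  shows "\<exists>c\<in>R. \<exists>q\<in>polys_over R. c \<noteq> 0 \<and> p = smult c q \<and> primitive q"
proof -
  obtain n where "prime_product R n (lead_coeff p)"
    using prime_product_exists[of "lead_coeff p"] assms by (auto simp: polys_over_def)
  then show ?thesis using assms
  proof (induction n arbitrary: p rule: less_induct)
    case (less n)
    show ?case
    proof (cases "primitive p")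
      case True
      then show ?thesis using less by (intro bexI[of _ 1] bexI[of _ p]) auto
    next
      case False
      then obtain c where c: "prime_in R c" "rdvd (polys_over R) [:c:] p"
        unfolding primitive_def by blast
      then obtain q where q: "q \<in> polys_over R" "p = smult c q" by (auto simp: rdvd_def)
      have "lead_coeff p = c * lead_coeff q" using q by simp
      moreover have "lead_coeff q \<in> R" using q by (auto simp: polys_over_def)
      ultimately obtain m where "m < n" "prime_product R m (lead_coeff q)"
        using prime_product_cancel[OF less(2) c(1)] by blast
      moreover have "q \<noteq> 0" using q less by auto
      ultimately obtain d q' where "d \<in> R" "q' \<in> polys_over R" "d \<noteq> 0" "q = smult d q'" "primitive q'"
        using less(1) q(1) by blast
      then show ?thesis using q prime_inD[OF c(1)]
        by (intro bexI[of _ "c * d"] bexI[of _ q']) auto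
    qed
  qed
qed

lemma primitive_const_unit:
  assumes "[:c:] \<in> polys_over R" "c \<noteq> 0" "primitive [:c:]"
  shows "rdvd (polys_over R) [:c:] 1"
proof -
  obtain n where n: "prime_product R n c" using assms prime_product_exists pCons_over by blast
  then show ?thesis
  proof cases
    case unit
    then show ?thesis using rdvd_const_const[OF one_closed] by (simp add: pCons_one)
  next
    case (prime p n r)
    then have "rdvd R p c" using rdvd_triv prime_product_closed by blast
    then show ?thesis
      using assms prime rdvd_const_const pCons_over unfolding primitive_def by blast
  qed
qed

text \<open>If p divides a * b, the primitive part d' of a nonzero element of least degree in the
  ideal (p, a) divides both p and a. By irreducibility either d' is a unit, which leads to p
  dividing b, or d' is associated to p, so that p divides a.\<close>

lemma primitive_irreducible_prime:
  assumes p: "p \<in> polys_over R" "primitive p" "degree p > 0"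
    and irr: "\<And>a b. a \<in> polys_over R \<Longrightarrow> b \<in> polys_over R \<Longrightarrow> p = a * b \<Longrightarrow>
      rdvd (polys_over R) a 1 \<or> rdvd (polys_over R) b 1"
  shows "prime_in (polys_over R) p"
proof -
  interpret P: subring_of "polys_over R" by (rule subring_polys_over)
  have "rdvd (polys_over R) p a \<or> rdvd (polys_over R) p b"
    if ab: "a \<in> polys_over R" "b \<in> polys_over R" "rdvd (polys_over R) p (a * b)" for a b
  proof -
    \<comment> \<open>a nonzero element of least degree in the ideal (p, a) plays the part of a gcd of p and a
      over the fraction field\<close>
    define J where "J = {p * u + a * v | u v. u \<in> polys_over R \<and> v \<in> polys_over R}"
    have J: "x * z - y * w \<in> J" if "x \<in> J" "y \<in> J" "z \<in> polys_over R" "w \<in> polys_over R" for x y z w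
    proof -
      obtain u v u' v' where "x = p * u + a * v" "y = p * u' + a * v'"
        "u \<in> polys_over R" "v \<in> polys_over R" "u' \<in> polys_over R" "v' \<in> polys_over R"
        using \<open>x \<in> J\<close> \<open>y \<in> J\<close> unfolding J_def by blast
      moreover then have "x * z - y * w = p * (u * z - u' * w) + a * (v * z - v' * w)"
        by (simp add: algebra_simps)
      ultimately show ?thesis
        using that unfolding J_def by blast
    qed
    have JP: "x \<in> polys_over R" if "x \<in> J" for x using that p ab unfolding J_def by blast
    have pJ: "p \<in> J" unfolding J_def by (intro CollectI exI[of _ 1] exI[of _ 0]) auto
    have aJ: "a \<in> J" unfolding J_def by (intro CollectI exI[of _ 1] exI[of _ 0]) auto
    have "\<exists>x. x \<in> J \<and> x \<noteq> 0" using pJ p(3) by (intro exI[of _ p]) auto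
    then obtain d where d: "d \<in> J" "d \<noteq> 0" "\<And>x. x \<in> J \<Longrightarrow> x \<noteq> 0 \<Longrightarrow> degree d \<le> degree x"
      using ex_has_least_nat[of "\<lambda>x. x \<in> J \<and> x \<noteq> 0" _ degree] by blast
    obtain c d' where c: "c \<in> R" "c \<noteq> 0" and d': "d' \<in> polys_over R" "d = smult c d'" "primitive d'"
      using primitive_part[OF JP[OF d(1)] d(2)] by blast
    \<comment> \<open>The pseudo-remainder lies in J and vanishes by minimality, so d' divides a
      constant multiple of x; primitivity of d' removes the constant.\<close>
    have dvd: "rdvd (polys_over R) d' x" if x: "x \<in> J" for x
    proof -
      obtain e q r where e: "e \<in> R" "e \<noteq> 0" "q \<in> polys_over R" "r \<in> polys_over R"
        "smult e x = d * q + r" "r = 0 \<or> degree r < degree d"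
        using pseudo_division[OF JP[OF d(1)] d(2) JP[OF x]] by blast
      have "r = x * [:e:] - d * q" using e(5) by simp
      then have "r \<in> J" using J[OF x d(1) _ e(3), of "[:e:]"] e(1) pCons_over by metis
      then have "r = 0" using e(6) d(3)[of r] by (meson leD)
      then have "d' * smult c q = smult e x" using e(5) d'(2) by simp
      moreover obtain k where "prime_product R k e" using e prime_product_exists by blast
      ultimately show ?thesis
        using primitive_cancel[of k e d' "smult c q" x] d' JP[OF x] smult_over[OF c(1) e(3)] by blast
    qed
    obtain q where q: "q \<in> polys_over R" "p = d' * q" using dvd[OF pJ] by (auto simp: rdvd_def)
    from irr[OF d'(1) q(1) q(2)] show ?thesis
    proof
      \<comment> \<open>Now the constant c itself is a combination of p and a. Multiplied by b it
        becomes a multiple of p, and primitivity of p removes c.\<close>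
      assume "rdvd (polys_over R) d' 1"
      then obtain w where w: "w \<in> polys_over R" "1 = d' * w" by (auto simp: rdvd_def)
      have cJ: "[:c:] \<in> J"
      proof -
        have "[:c:] = d * w - p * 0" using w d'(2) by (simp flip: w(2))
        then show ?thesis using J[OF d(1) pJ w(1), of 0] by simp
      qed
      then obtain u v where uv: "[:c:] = p * u + a * v" "u \<in> polys_over R" "v \<in> polys_over R"
        unfolding J_def by blast
      obtain h where h: "h \<in> polys_over R" "a * b = p * h" using ab(3) by (auto simp: rdvd_def)
      have "smult c b = [:c:] * b" by simp
      also have "\<dots> = p * u * b + (a * b) * v" unfolding uv by (simp add: algebra_simps)
      also have "\<dots> = p * (u * b + h * v)" unfolding h by (simp add: algebra_simps)
      finally have "p * (u * b + h * v) = smult c b" by simp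
      moreover obtain k where "prime_product R k c" using c prime_product_exists by blast
      moreover have "u * b + h * v \<in> polys_over R" using uv h ab by blast
      ultimately have "rdvd (polys_over R) p b"
        using primitive_cancel[of k c p "u * b + h * v" b] p ab by simp
      then show ?thesis ..
    next
      assume "rdvd (polys_over R) q 1"
      then obtain w where w: "w \<in> polys_over R" "1 = q * w" by (auto simp: rdvd_def)
      have "p * w = d'" using w(2) q(2) by (metis mult.assoc mult_1_right)
      then have "rdvd (polys_over R) p d'" using w(1) by (auto simp: rdvd_def)
      then have "rdvd (polys_over R) p a" using dvd[OF aJ] P.rdvd_trans by blast
      then show ?thesis ..
    qed
  qed
  moreover have "\<not> rdvd (polys_over R) p 1"
  proof
    assume "rdvd (polys_over R) p 1"
    then obtain w where "p * w = 1" by (auto simp: rdvd_def)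
    then have "degree p + degree w = 0" by (metis degree_1 degree_mult_eq mult_eq_0_iff zero_neq_one)
    then show False using p(3) by simp
  qed
  ultimately show ?thesis using p unfolding prime_in_def by auto
qed

text \<open>Factors of a primitive polynomial are primitive, and a nonzero primitive constant is a
  unit; so in a splitting into two nonunits both degrees drop.\<close>

lemma primitive_prime_product:
  assumes "p \<in> polys_over R" "p \<noteq> 0" "primitive p"
  shows "\<exists>n. prime_product (polys_over R) n p"
  using assms
proof (induction "degree p" arbitrary: p rule: less_induct)
  case less
  interpret P: subring_of "polys_over R" by (rule subring_polys_over)
  show ?case
  proof (cases "degree p = 0")
    case True
    then obtain c where "p = [:c:]" by (metis degree_eq_zeroE)
    then show ?thesis using less primitive_const_unit prime_product.unit by (metis pCons_0_0)
  next
    case False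
    show ?thesis
    proof (cases "\<exists>a\<in>polys_over R. \<exists>b\<in>polys_over R. p = a * b \<and>
        \<not> rdvd (polys_over R) a 1 \<and> \<not> rdvd (polys_over R) b 1")
      case True
      then obtain a b where ab: "a \<in> polys_over R" "b \<in> polys_over R" "p = a * b"
        "\<not> rdvd (polys_over R) a 1" "\<not> rdvd (polys_over R) b 1" by blast
      have ab0: "a \<noteq> 0" "b \<noteq> 0" using ab less by auto
      have prim: "primitive a" "primitive b"
        using less(4) ab unfolding primitive_def by (auto intro: P.rdvd_mult P.rdvd_mult2)
      have "degree x \<noteq> 0" if "x \<in> polys_over R" "x \<noteq> 0" "primitive x" "\<not> rdvd (polys_over R) x 1" for x
        using that primitive_const_unit by (metis degree_eq_zeroE pCons_0_0)
      then have "degree a \<noteq> 0" "degree b \<noteq> 0" using ab ab0 prim by blast+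
      moreover have "degree p = degree a + degree b" using ab ab0 by (simp add: degree_mult_eq)
      ultimately have "degree a < degree p" "degree b < degree p" by auto
      then obtain n m where "prime_product (polys_over R) n a" "prime_product (polys_over R) m b"
        using less(1) ab ab0 prim by meson
      then show ?thesis using P.prime_product_mult ab(3) by blast
    next
      case no: False
      have "prime_in (polys_over R) p"
        by (rule primitive_irreducible_prime) (use less False no in auto)
      moreover have "prime_product (polys_over R) 0 1" by (rule prime_product.unit) auto
      ultimately have "prime_product (polys_over R) (Suc 0) (p * 1)" by (rule prime_product.prime)
      then show ?thesis by auto
    qed
  qed
qed

theorem factorial_polys_over: "factorial_subring (polys_over R)"
proof -
  interpret P: subring_of "polys_over R" by (rule subring_polys_over)
  show ?thesis
  proof
    fix p assume "p \<in> polys_over R" "p \<noteq> 0"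
    then obtain c q where c: "c \<in> R" "c \<noteq> 0" "q \<in> polys_over R" "p = [:c:] * q" "primitive q"
      using primitive_part[of p] by auto
    moreover obtain n where "prime_product R n c" using c prime_product_exists by blast
    moreover have "q \<noteq> 0" using \<open>p \<noteq> 0\<close> c by auto
    ultimately show "\<exists>n. prime_product (polys_over R) n p"
      using primitive_prime_product[of q] prime_product_polys_over P.prime_product_mult by metis
  qed
qed

end

text \<open>Bijectivity is asked on A only: the map in question, evaluation at the next variable, is
  not injective on the whole polynomial type.\<close>

lemma factorial_subring_transfer:
  fixes \<phi> :: "'a::idom \<Rightarrow> 'b::idom"
  assumes "factorial_subring A" and bij: "bij_betw \<phi> A B"
    and add: "\<And>x y. x \<in> A \<Longrightarrow> y \<in> A \<Longrightarrow> \<phi> (x + y) = \<phi> x + \<phi> y"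
    and mult: "\<And>x y. x \<in> A \<Longrightarrow> y \<in> A \<Longrightarrow> \<phi> (x * y) = \<phi> x * \<phi> y"
    and one: "\<phi> 1 = 1"
  shows "factorial_subring B"
proof -
  interpret A: factorial_subring A by fact
  have B: "B = \<phi> ` A" and inj: "inj_on \<phi> A" using bij by (auto simp: bij_betw_def)
  have zero: "\<phi> 0 = 0" using add[OF A.zero_closed A.zero_closed] by (metis add.right_neutral add_left_cancel)
  have um: "\<phi> (- x) = - \<phi> x" if "x \<in> A" for x
    using add[of x "- x"] that zero by (simp add: A.uminus_closed eq_neg_iff_add_eq_0 add.commute)
  interpret B: subring_of B
  proof
    show "0 \<in> B" unfolding B using zero A.zero_closed by (metis imageI)
    show "1 \<in> B" unfolding B using one A.one_closed by (metis imageI)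
    show "a + b \<in> B" if "a \<in> B" "b \<in> B" for a b
      using that unfolding B using add A.add_closed by (metis (no_types, lifting) imageE imageI)
    show "a * b \<in> B" if "a \<in> B" "b \<in> B" for a b
      using that unfolding B using mult A.mult_closed by (metis (no_types, lifting) imageE imageI)
    show "- a \<in> B" if "a \<in> B" for a
      using that unfolding B using um A.uminus_closed by (metis (no_types, lifting) imageE imageI)
  qed
  have dvd: "rdvd B (\<phi> x) (\<phi> y) \<longleftrightarrow> rdvd A x y" if "x \<in> A" "y \<in> A" for x y
  proof
    assume "rdvd B (\<phi> x) (\<phi> y)"
    then obtain c where c: "c \<in> A" "\<phi> y = \<phi> x * \<phi> c" by (auto simp: rdvd_def B)
    then have "\<phi> y = \<phi> (x * c)" using mult that by simp
    then have "y = x * c" using inj that c A.mult_closed by (meson inj_onD)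
    then show "rdvd A x y" using c by (auto simp: rdvd_def)
  next
    assume "rdvd A x y"
    then obtain c where c: "c \<in> A" "y = x * c" by (auto simp: rdvd_def)
    then show "rdvd B (\<phi> x) (\<phi> y)" using mult that by (auto simp: rdvd_def B)
  qed
  have primeB: "prime_in B (\<phi> p)" if "prime_in A p" for p
  proof -
    note p = A.prime_inD[OF that]
    have "\<phi> p \<noteq> 0" using inj_onD[OF inj, of p 0] p zero by auto
    moreover have "\<not> rdvd B (\<phi> p) 1" using dvd[of p 1] p one by simp
    moreover have "rdvd B (\<phi> p) (\<phi> a) \<or> rdvd B (\<phi> p) (\<phi> b)"
      if "a \<in> A" "b \<in> A" "rdvd B (\<phi> p) (\<phi> a * \<phi> b)" for a b
      using that p dvd[of p "a * b"] dvd[of p a] dvd[of p b] mult[of a b] A.mult_closed by simp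
    ultimately show ?thesis using p(1) unfolding prime_in_def B by blast
  qed
  have pp: "prime_product A n r \<Longrightarrow> prime_product B n (\<phi> r)" for n r
  proof (induction rule: prime_product.induct)
    case (unit u)
    then show ?case using dvd[of u 1] one by (intro prime_product.unit) (auto simp: B)
  next
    case (prime p n r)
    have "p \<in> A" "r \<in> A"
      using A.prime_inD(1)[OF prime(1)] A.prime_product_closed[OF prime(2)] by auto
    then show ?case
      using prime_product.prime[OF primeB[OF prime(1)] prime(3)] mult by simp
  qed
  show ?thesis
  proof
    fix r assume "r \<in> B" "r \<noteq> 0"
    then obtain a where "a \<in> A" "r = \<phi> a" "a \<noteq> 0" using zero by (auto simp: B)
    then show "\<exists>n. prime_product B n r" using A.prime_product_exists pp by blast
  qed
qed


section \<open>Multivariate polynomials\<close>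

abbreviation monomial :: "(nat \<Rightarrow>\<^sub>0 nat) \<Rightarrow> 'k \<Rightarrow> 'k::zero mpoly" where
  "monomial \<equiv> Poly_Mapping.single"

lemma sum_monomials: "(\<Sum>m\<in>Poly_Mapping.keys p. monomial m (Poly_Mapping.lookup p m)) = p"
  by (rule poly_mapping_eqI)
     (auto simp: lookup_sum lookup_single when_def not_in_keys_iff_lookup_eq_zero)

lemma mpoly_induct [case_names monomial add]:
  fixes p :: "'k::comm_monoid_add mpoly"
  assumes "\<And>m c. P (monomial m c)" "\<And>p q. P p \<Longrightarrow> P q \<Longrightarrow> P (p + q)"
  shows "P p"
proof -
  have "P (\<Sum>m\<in>A. monomial m (Poly_Mapping.lookup p m))" if "finite A" for A
    using that
  proof (induction A)
    case empty
    show ?case using assms(1)[of 0 0] by simp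
  qed (auto intro: assms)
  then show ?thesis using sum_monomials[of p] finite_keys by metis
qed

lemma lookup_mult_monomial:
  fixes p :: "'k::comm_semiring_0 mpoly"
  shows "Poly_Mapping.lookup (p * monomial t c) (k + t) = Poly_Mapping.lookup p k * c"
proof (induction p rule: mpoly_induct)
  case (monomial m d)
  then show ?case by (auto simp: mult_single lookup_single when_def)
qed (simp add: lookup_add algebra_simps)

text \<open>Indexed by the number of variables rather than by the largest index, so that the
  induction on variables can start at the constants.\<close>

definition mpolys :: "nat \<Rightarrow> 'k::field_char_0 mpoly set" where
  "mpolys m = {p. \<forall>k\<in>Poly_Mapping.keys p. Poly_Mapping.keys k \<subseteq> {..<m}}"

lemma carrier_poly_ring: "carrier (poly_ring n) = mpolys (Suc n)"
  unfolding poly_ring_def mpolys_def by (auto simp: lessThan_Suc_atMost atMost_atLeast0)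

lemma mpolys_keysD: "p \<in> mpolys m \<Longrightarrow> k \<in> Poly_Mapping.keys p \<Longrightarrow> i \<in> Poly_Mapping.keys k \<Longrightarrow> i < m"
  by (auto simp: mpolys_def)

lemma monomial_mem_mpolys:
  "monomial k c \<in> mpolys m \<longleftrightarrow> c = 0 \<or> Poly_Mapping.keys k \<subseteq> {..<m}"
  by (simp add: mpolys_def)

interpretation mpolys: subring_of "mpolys m"
proof
  fix p q :: "'a mpoly" assume pq: "p \<in> mpolys m" "q \<in> mpolys m"
  show "p + q \<in> mpolys m"
    using pq Poly_Mapping.keys_add[of p q] by (fastforce simp: mpolys_def)
  show "p * q \<in> mpolys m"
  proof -
    have "Poly_Mapping.keys k \<subseteq> {..<m}" if k: "k \<in> Poly_Mapping.keys (p * q)" for k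
    proof -
      from k Poly_Mapping.keys_mult[of p q] obtain a b
        where "k = a + b" "a \<in> Poly_Mapping.keys p" "b \<in> Poly_Mapping.keys q" by blast
      then show ?thesis
        using pq Poly_Mapping.keys_add[of a b] by (fastforce simp: mpolys_def)
    qed
    then show ?thesis by (simp add: mpolys_def)
  qed
qed (auto simp: mpolys_def)

lemma mvar_power: "mvar m ^ i = monomial (Poly_Mapping.single m i) 1"
  by (induction i) (auto simp: mvar_def mult_single single_add[symmetric])

lemma mvar_mem: "i < m \<Longrightarrow> mvar i \<in> mpolys m"
  by (auto simp: mvar_def monomial_mem_mpolys)

lemma mpolys_mono: "p \<in> mpolys m \<Longrightarrow> m \<le> m' \<Longrightarrow> p \<in> mpolys m'"
  by (fastforce simp: mpolys_def)

text \<open>As c does not involve the variable of index m, the exponent of that variable in a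
  monomial tells which power of \<open>mvar m\<close> it comes from. This makes the coefficients of
  a univariate polynomial recoverable from its value at \<open>mvar m\<close>.\<close>

lemma lookup_mult_mvar_power:
  assumes "c \<in> mpolys m" "Poly_Mapping.lookup u m = i"
  shows "Poly_Mapping.lookup (c * mvar m ^ j) u =
    (if i = j then Poly_Mapping.lookup c (u - Poly_Mapping.single m i) else 0)"
proof (cases "i = j")
  case True
  have "u = (u - Poly_Mapping.single m i) + Poly_Mapping.single m i"
    by (rule poly_mapping_eqI) (use assms(2) in \<open>auto simp: lookup_add lookup_minus lookup_single when_def\<close>)
  then show ?thesis
    using True lookup_mult_monomial[of c "Poly_Mapping.single m i" 1 "u - Poly_Mapping.single m i"]
    by (simp add: mvar_power)
next
  case False
  have "u \<notin> Poly_Mapping.keys (c * mvar m ^ j)"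
  proof
    assume "u \<in> Poly_Mapping.keys (c * mvar m ^ j)"
    then obtain a b where ab: "u = a + b" "a \<in> Poly_Mapping.keys c"
      "b \<in> Poly_Mapping.keys (mvar m ^ j :: 'a mpoly)"
      using Poly_Mapping.keys_mult[of c "mvar m ^ j"] by blast
    then have "b = Poly_Mapping.single m j" by (simp add: mvar_power split: if_splits)
    moreover have "Poly_Mapping.lookup a m = 0"
      using mpolys_keysD[OF assms(1) ab(2), of m] by (auto simp: in_keys_iff)
    ultimately show False using False assms(2) ab(1) by (simp add: lookup_add)
  qed
  then show ?thesis using False by (simp add: in_keys_iff)
qed

lemma lookup_poly_mvar:
  assumes "P \<in> polys_over (mpolys m)"
  shows "Poly_Mapping.lookup (poly P (mvar m)) u =
    Poly_Mapping.lookup (coeff P (Poly_Mapping.lookup u m)) (u - Poly_Mapping.single m (Poly_Mapping.lookup u m))"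
proof -
  have P: "coeff P i \<in> mpolys m" for i using assms by (auto simp: polys_over_def)
  have "Poly_Mapping.lookup (poly P (mvar m)) u =
    (\<Sum>i\<le>degree P. if Poly_Mapping.lookup u m = i
       then Poly_Mapping.lookup (coeff P (Poly_Mapping.lookup u m)) (u - Poly_Mapping.single m (Poly_Mapping.lookup u m)) else 0)"
    unfolding poly_altdef lookup_sum by (intro sum.cong) (auto simp: lookup_mult_mvar_power[OF P])
  then show ?thesis using coeff_eq_0[of P] by (auto simp: sum.delta)
qed

lemma inj_on_poly_mvar: "inj_on (\<lambda>P. poly P (mvar m)) (polys_over (mpolys m :: 'k::field_char_0 mpoly set))"
proof (rule inj_onI)
  fix P Q :: "'k mpoly poly"
  assume PQ: "P \<in> polys_over (mpolys m)" "Q \<in> polys_over (mpolys m)"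
    and eq: "poly P (mvar m) = poly Q (mvar m)"
  have "Poly_Mapping.lookup (coeff P i) k = Poly_Mapping.lookup (coeff Q i) k" for i k
  proof (cases "Poly_Mapping.lookup k m = 0")
    case True
    have "Poly_Mapping.lookup (k + Poly_Mapping.single m i) m = i"
      using True by (simp add: lookup_add)
    then show ?thesis
      using lookup_poly_mvar[OF PQ(1), of "k + Poly_Mapping.single m i"]
        lookup_poly_mvar[OF PQ(2), of "k + Poly_Mapping.single m i"] eq by simp
  next
    case False
    then have "m \<in> Poly_Mapping.keys k" by (simp add: in_keys_iff)
    then have "k \<notin> Poly_Mapping.keys (coeff P i)" "k \<notin> Poly_Mapping.keys (coeff Q i)"
      using PQ mpolys_keysD less_irrefl unfolding polys_over_def by blast+
    then show ?thesis by (simp add: in_keys_iff)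
  qed
  then show "P = Q" by (intro poly_eqI poly_mapping_eqI)
qed

lemma poly_mvar_image: "(\<lambda>P. poly P (mvar m)) ` polys_over (mpolys m) = mpolys (Suc m)" (is "?\<phi> ` ?A = _")
proof (intro equalityI subsetI)
  fix p assume "p \<in> ?\<phi> ` ?A"
  then obtain P where P: "\<And>i. coeff P i \<in> mpolys m" "p = poly P (mvar m)" by (auto simp: polys_over_def)
  show "p \<in> mpolys (Suc m)"
    unfolding P poly_altdef
    by (intro mpolys.sum_closed mpolys.mult_closed mpolys.power_closed mvar_mem mpolys_mono[OF P(1)]) auto
next
  fix p :: "'a mpoly" assume p: "p \<in> mpolys (Suc m)"
  interpret A: subring_of ?A by (rule mpolys.subring_polys_over)
  have "\<exists>P\<in>?A. monomial k c = ?\<phi> P" if k: "k \<in> Poly_Mapping.keys p" for k c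
  proof
    define i where "i = Poly_Mapping.lookup k m"
    define l where "l = k - Poly_Mapping.single m i"
    have kl: "k = l + Poly_Mapping.single m i"
      unfolding l_def i_def
      by (rule poly_mapping_eqI) (auto simp: lookup_add lookup_minus lookup_single when_def)
    have "Poly_Mapping.keys l \<subseteq> {..<m}"
    proof
      fix x assume x: "x \<in> Poly_Mapping.keys l"
      then have "x \<in> Poly_Mapping.keys k" "x \<noteq> m"
        by (auto simp: in_keys_iff l_def i_def lookup_minus lookup_single when_def split: if_splits)
      moreover have "Poly_Mapping.keys k \<subseteq> {..<Suc m}" using p k by (auto simp: mpolys_def)
      ultimately show "x \<in> {..<m}" by (auto simp: less_Suc_eq)
    qed
    then show "monom (monomial l c) i \<in> ?A"
      by (intro mpolys.monom_over) (auto simp: monomial_mem_mpolys)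
    show "monomial k c = ?\<phi> (monom (monomial l c) i)"
      by (simp add: poly_monom mvar_power mult_single kl)
  qed
  then have "\<forall>k\<in>Poly_Mapping.keys p. \<exists>P. P \<in> ?A \<and> monomial k (Poly_Mapping.lookup p k) = ?\<phi> P"
    by blast
  from bchoice[OF this] obtain g where g: "\<forall>k\<in>Poly_Mapping.keys p.
      g k \<in> ?A \<and> monomial k (Poly_Mapping.lookup p k) = ?\<phi> (g k)" ..
  have "p = ?\<phi> (\<Sum>k\<in>Poly_Mapping.keys p. g k)"
    using sum_monomials[of p] g by (simp add: poly_sum)
  moreover have "(\<Sum>k\<in>Poly_Mapping.keys p. g k) \<in> ?A" using g by (intro A.sum_closed) auto
  ultimately show "p \<in> ?\<phi> ` ?A" by blast
qed

lemma constant_unit: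
  assumes "p \<in> mpolys m" "p \<noteq> 0" "Poly_Mapping.keys p \<subseteq> {0}"
  shows "rdvd (mpolys m) p 1"
proof -
  define c where "c = Poly_Mapping.lookup p 0"
  have p: "p = monomial 0 c"
    by (rule poly_mapping_eqI) (use assms(3) in \<open>auto simp: c_def lookup_single when_def in_keys_iff\<close>)
  then have "c \<noteq> 0" using assms(2) by auto
  then have "1 = p * monomial 0 (inverse c)" by (simp add: p mult_single)
  then show ?thesis unfolding rdvd_def by (intro bexI) (auto simp: monomial_mem_mpolys)
qed

text \<open>Without variables every nonzero element is a unit. Evaluation at \<open>mvar m\<close>
  identifies univariate polynomials over m variables with polynomials in m + 1 variables, so Gauss's
  theorem gives the induction step.\<close>

lemma factorial_mpolys: "factorial_subring (mpolys m :: 'k::field_char_0 mpoly set)"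
proof (induction m)
  case 0
  show ?case
  proof
    fix p :: "'k mpoly" assume p: "p \<in> mpolys 0" "p \<noteq> 0"
    then have "rdvd (mpolys 0) p 1" by (intro constant_unit) (auto simp: mpolys_def)
    then show "\<exists>n. prime_product (mpolys 0) n p" using p prime_product.unit by blast
  qed
next
  case (Suc m)
  show ?case
  proof (rule factorial_subring_transfer)
    show "factorial_subring (polys_over (mpolys m :: 'k mpoly set))"
      using Suc by (rule factorial_subring.factorial_polys_over)
    show "bij_betw (\<lambda>P. poly P (mvar m)) (polys_over (mpolys m :: 'k mpoly set)) (mpolys (Suc m))"
      using inj_on_poly_mvar poly_mvar_image by (auto simp: bij_betw_def)
  qed auto
qed

interpretation mpolys: factorial_subring "mpolys m"
  by (rule factorial_mpolys)


section \<open>Partial derivatives\<close>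

text \<open>Truncated subtraction can send several monomials to m, but those without x_i carry the
  factor 0, so only the monomial m times x_i contributes.\<close>

lemma lookup_partial_deriv:
  "Poly_Mapping.lookup (partial_deriv i p) m =
     of_nat (Suc (Poly_Mapping.lookup m i)) * Poly_Mapping.lookup p (m + Poly_Mapping.single i 1)"
proof -
  let ?t = "m + Poly_Mapping.single i 1"
  have "Poly_Mapping.lookup (partial_deriv i p) m =
    (\<Sum>k\<in>Poly_Mapping.keys p. of_nat (Poly_Mapping.lookup k i) * Poly_Mapping.lookup p k
       when k - Poly_Mapping.single i 1 = m)"
    unfolding partial_deriv_def lookup_sum by (simp add: lookup_single)
  also have "\<dots> = (\<Sum>k\<in>Poly_Mapping.keys p. if k = ?t
      then of_nat (Poly_Mapping.lookup ?t i) * Poly_Mapping.lookup p ?t else 0)"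
  proof (rule sum.cong[OF refl])
    fix k
    have "k - Poly_Mapping.single i 1 = m \<longleftrightarrow> k = ?t" if "Poly_Mapping.lookup k i \<noteq> 0"
    proof
      assume m: "k - Poly_Mapping.single i 1 = m"
      show "k = ?t"
        using that unfolding m[symmetric]
        by (intro poly_mapping_eqI) (auto simp: lookup_add lookup_minus lookup_single when_def)
    qed simp
    moreover have "k \<noteq> ?t" if "Poly_Mapping.lookup k i = 0"
      using that by (auto simp: lookup_add)
    ultimately show "(of_nat (Poly_Mapping.lookup k i) * Poly_Mapping.lookup p k
       when k - Poly_Mapping.single i 1 = m) = (if k = ?t
      then of_nat (Poly_Mapping.lookup ?t i) * Poly_Mapping.lookup p ?t else 0)"
      by (cases "Poly_Mapping.lookup k i = 0") simp_all
  qed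
  also have "\<dots> = of_nat (Poly_Mapping.lookup ?t i) * Poly_Mapping.lookup p ?t"
    by (simp add: in_keys_iff)
  finally show ?thesis by (simp add: lookup_add)
qed

lemma partial_deriv_add: "partial_deriv i (p + q) = partial_deriv i p + partial_deriv i q"
  by (rule poly_mapping_eqI) (simp add: lookup_partial_deriv lookup_add algebra_simps)

lemma partial_deriv_monomial:
  "partial_deriv i (monomial m c) =
     monomial (m - Poly_Mapping.single i 1) (of_nat (Poly_Mapping.lookup m i) * c)"
  by (cases "c = 0") (simp_all add: partial_deriv_def)

lemma partial_deriv_mult:
  "partial_deriv i (p * q) = partial_deriv i p * q + p * partial_deriv i q"
proof (induction p rule: mpoly_induct)
  case (monomial m c)
  show ?case
  proof (induction q rule: mpoly_induct)
    case (monomial k d)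
    let ?e = "Poly_Mapping.single i (1::nat)"
    \<comment> \<open>Truncated subtraction commutes with addition only if x_i occurs; if it does
      not, the coefficient in question is 0.\<close>
    have shift: "a + b - ?e = (a - ?e) + b" if "Poly_Mapping.lookup a i \<noteq> 0" for a b
      using that by (intro poly_mapping_eqI) (auto simp: lookup_add lookup_minus lookup_single when_def)
    have 1: "monomial (m + k - ?e) (of_nat (Poly_Mapping.lookup m i) * c * d) =
        monomial (m - ?e + k) (of_nat (Poly_Mapping.lookup m i) * c * d)"
      using shift[of m k] by (cases "Poly_Mapping.lookup m i = 0") auto
    have 2: "monomial (m + k - ?e) (c * (of_nat (Poly_Mapping.lookup k i) * d)) =
        monomial (m + (k - ?e)) (c * (of_nat (Poly_Mapping.lookup k i) * d))"
      using shift[of k m] by (cases "Poly_Mapping.lookup k i = 0") (auto simp: add.commute)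
    show ?case
      unfolding mult_single partial_deriv_monomial 1[symmetric] 2[symmetric] single_add[symmetric]
      by (simp add: lookup_add algebra_simps)
  qed (simp add: partial_deriv_add algebra_simps)
qed (simp add: partial_deriv_add algebra_simps)

lemma partial_deriv_closed:
  assumes "p \<in> mpolys m"
  shows "partial_deriv i p \<in> mpolys m"
  unfolding mpolys_def
proof (intro CollectI ballI)
  fix k assume "k \<in> Poly_Mapping.keys (partial_deriv i p)"
  then have "k + Poly_Mapping.single i 1 \<in> Poly_Mapping.keys p"
    by (auto simp: in_keys_iff lookup_partial_deriv)
  then have "Poly_Mapping.keys (k + Poly_Mapping.single i 1) \<subseteq> {..<m}"
    using assms by (auto simp: mpolys_def)
  moreover have "Poly_Mapping.keys k \<subseteq> Poly_Mapping.keys (k + Poly_Mapping.single i 1)"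
    by (auto simp: in_keys_iff lookup_add)
  ultimately show "Poly_Mapping.keys k \<subseteq> {..<m}" by blast
qed

text \<open>The linear order of the library on exponent vectors is a monomial order, so leading
  monomials multiply.\<close>

lemma Max_keys_mult:
  fixes p q :: "'k::field_char_0 mpoly"
  assumes "p \<noteq> 0" "q \<noteq> 0"
  shows "Max (Poly_Mapping.keys p) + Max (Poly_Mapping.keys q) \<in> Poly_Mapping.keys (p * q)"
proof -
  define A where "A = Max (Poly_Mapping.keys p)"
  define B where "B = Max (Poly_Mapping.keys q)"
  define p' where "p' = p - monomial A (Poly_Mapping.lookup p A)"
  define q' where "q' = q - monomial B (Poly_Mapping.lookup q B)"
  have A: "A \<in> Poly_Mapping.keys p" "\<And>k. k \<in> Poly_Mapping.keys p \<Longrightarrow> k \<le> A"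
    unfolding A_def using assms(1) by (auto intro!: Max_in Max_ge)
  have B: "B \<in> Poly_Mapping.keys q" "\<And>k. k \<in> Poly_Mapping.keys q \<Longrightarrow> k \<le> B"
    unfolding B_def using assms(2) by (auto intro!: Max_in Max_ge)
  have p': "k < A" if "k \<in> Poly_Mapping.keys p'" for k
    using that A(2)[of k] unfolding p'_def
    by (auto simp: in_keys_iff lookup_minus lookup_single when_def order.strict_iff_order split: if_splits)
  have q': "k < B" if "k \<in> Poly_Mapping.keys q'" for k
    using that B(2)[of k] unfolding q'_def
    by (auto simp: in_keys_iff lookup_minus lookup_single when_def order.strict_iff_order split: if_splits)
  have "A + B \<notin> Poly_Mapping.keys (p' * q)"
    using Poly_Mapping.keys_mult[of p' q] p' B(2) add_less_le_mono
    by (smt (verit) less_irrefl mem_Collect_eq subsetD)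
  moreover have "A + B \<notin> Poly_Mapping.keys (monomial A (Poly_Mapping.lookup p A) * q')"
    using Poly_Mapping.keys_mult[of "monomial A (Poly_Mapping.lookup p A)" q'] q'
    by (fastforce split: if_splits)
  moreover have "p * q = p' * q + (monomial A (Poly_Mapping.lookup p A) * q' +
      monomial (A + B) (Poly_Mapping.lookup p A * Poly_Mapping.lookup q B))"
    by (simp add: p'_def q'_def algebra_simps mult_single[symmetric])
  ultimately have "Poly_Mapping.lookup (p * q) (A + B) =
      Poly_Mapping.lookup p A * Poly_Mapping.lookup q B"
    by (simp add: lookup_add in_keys_iff)
  then show ?thesis using A(1) B(1) unfolding A_def[symmetric] B_def[symmetric]
    by (simp add: in_keys_iff)
qed

text \<open>A nonzero derivative equal to p * c would have a leading monomial at least that of p;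
  multiplied by x_j it would be a monomial of p above the maximal one.\<close>

lemma dvd_partial_deriv_eq_0:
  assumes "rdvd (mpolys m) p (partial_deriv j p)"
  shows "partial_deriv j p = 0"
proof (rule ccontr)
  assume nz: "partial_deriv j p \<noteq> 0"
  obtain c where c: "partial_deriv j p = p * c" using assms by (auto simp: rdvd_def)
  then have "p \<noteq> 0" "c \<noteq> 0" using nz by auto
  define K where "K = Max (Poly_Mapping.keys p) + Max (Poly_Mapping.keys c)"
  define e where "e = Poly_Mapping.single j (1::nat)"
  have pos: "0 < e"
    unfolding e_def less_poly_mapping.rep_eq less_fun_def
    by (intro exI[of _ j]) (auto simp: lookup_single when_def)
  \<comment> \<open>Exponent vectors are compared at the least index where they differ, so a nonzero
    vector is positive because of its least key.\<close>
  have nonneg: "0 \<le> k" for k :: "nat \<Rightarrow>\<^sub>0 nat"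
  proof (cases "k = 0")
    case False
    then have ne: "Poly_Mapping.keys k \<noteq> {}" by simp
    define i where "i = Min (Poly_Mapping.keys k)"
    have "0 < Poly_Mapping.lookup k i"
      using Min_in[OF finite_keys ne] by (simp add: i_def in_keys_iff)
    moreover have "Poly_Mapping.lookup k j = 0" if "j < i" for j
      using that Min_le[OF finite_keys, of j k] unfolding i_def not_in_keys_iff_lookup_eq_zero[symmetric]
      by (meson leD)
    ultimately have "0 < k"
      unfolding less_poly_mapping.rep_eq less_fun_def by (intro exI[of _ i]) simp
    then show ?thesis by simp
  qed simp
  have "K \<in> Poly_Mapping.keys (partial_deriv j p)"
    unfolding c K_def using \<open>p \<noteq> 0\<close> \<open>c \<noteq> 0\<close> by (rule Max_keys_mult)
  then have "K + e \<in> Poly_Mapping.keys p"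
    by (auto simp: in_keys_iff lookup_partial_deriv e_def)
  then have "K + e \<le> Max (Poly_Mapping.keys p)" by simp
  also have "\<dots> \<le> K" unfolding K_def using add_left_mono[OF nonneg] by fastforce
  also have "\<dots> < K + e" using add_strict_left_mono[OF pos, of K] by simp
  finally show False by simp
qed

text \<open>Characteristic 0 enters here: differentiating a monomial in a variable it contains
  multiplies its coefficient by a positive exponent, which is nonzero in the field.\<close>

lemma partial_derivs_eq_0_constant:
  assumes "p \<in> mpolys (Suc n)" "\<And>j. j \<le> n \<Longrightarrow> partial_deriv j p = 0"
  shows "Poly_Mapping.keys p \<subseteq> {0}"
proof
  fix k assume k: "k \<in> Poly_Mapping.keys p"
  have "Poly_Mapping.keys k = {}"
  proof (rule ccontr)
    assume "Poly_Mapping.keys k \<noteq> {}"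
    then obtain j where j: "j \<in> Poly_Mapping.keys k" by blast
    then have "j < Suc n" using k assms(1) by (auto simp: mpolys_def)
    moreover have "k - Poly_Mapping.single j 1 + Poly_Mapping.single j 1 = k"
      using j by (intro poly_mapping_eqI)
        (auto simp: lookup_add lookup_minus lookup_single when_def in_keys_iff)
    then have "Poly_Mapping.lookup (partial_deriv j p) (k - Poly_Mapping.single j 1) \<noteq> 0"
      using k unfolding lookup_partial_deriv by (simp add: in_keys_iff del: of_nat_Suc)
    ultimately show False using assms(2)[of j] by simp
  qed
  then show "k \<in> {0}" by simp
qed

text \<open>Write f = p * q. If p divided all partial derivatives of f, the product rule would make
  it divide those of p times q. It does not divide q since f is reduced, so it would divide its own
  derivatives, all of which then vanish, and p would be constant.\<close>

lemma reduced_coprime_partial_derivs: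
  assumes "reduced_poly n f" "prime_in (mpolys (Suc n)) p" "rdvd (mpolys (Suc n)) p f"
  shows "\<exists>j\<le>n. \<not> rdvd (mpolys (Suc n)) p (partial_deriv j f)"
proof (rule ccontr)
  assume "\<not> ?thesis"
  then have all: "\<And>j. j \<le> n \<Longrightarrow> rdvd (mpolys (Suc n)) p (partial_deriv j f)" by blast
  note p = mpolys.prime_inD[OF assms(2)]
  obtain q where q: "q \<in> mpolys (Suc n)" "f = p * q" using assms(3) by (auto simp: rdvd_def)
  have not: "\<not> rdvd (mpolys (Suc n)) p q"
  proof
    assume "rdvd (mpolys (Suc n)) p q"
    then have "(p \<otimes>\<^bsub>poly_ring n\<^esub> p) divides\<^bsub>poly_ring n\<^esub> f"
      unfolding q by (auto simp: factor_def rdvd_def carrier_poly_ring mult.assoc)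
    then have "p \<in> Units (poly_ring n)"
      using assms(1) p(1) by (auto simp: reduced_poly_def carrier_poly_ring)
    then show False using p(3) by (auto simp: Units_def rdvd_def carrier_poly_ring)
  qed
  have "partial_deriv j p = 0" if "j \<le> n" for j
  proof -
    have "rdvd (mpolys (Suc n)) p (partial_deriv j f - p * partial_deriv j q)"
      using all[OF that] q(1) by (intro mpolys.rdvd_diff mpolys.rdvd_triv partial_deriv_closed)
    then have "rdvd (mpolys (Suc n)) p (partial_deriv j p * q)"
      by (simp add: q(2) partial_deriv_mult)
    then show ?thesis
      using p(4)[of "partial_deriv j p" q] not q(1) p(1) partial_deriv_closed dvd_partial_deriv_eq_0 by blast
  qed
  then have "Poly_Mapping.keys p \<subseteq> {0}" using partial_derivs_eq_0_constant p(1) by blast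
  then show False using constant_unit p by blast
qed


section \<open>Weighted degrees\<close>

lemma wdeg_superset:
  "finite A \<Longrightarrow> Poly_Mapping.keys m \<subseteq> A \<Longrightarrow> wdeg \<omega> m = (\<Sum>i\<in>A. Poly_Mapping.lookup m i * \<omega> i)"
  unfolding wdeg_def by (rule sum.mono_neutral_left) (auto simp: in_keys_iff)

lemma wdeg_add: "wdeg \<omega> (k + m) = wdeg \<omega> k + wdeg \<omega> m"
proof -
  let ?A = "Poly_Mapping.keys k \<union> Poly_Mapping.keys m"
  show ?thesis
    using Poly_Mapping.keys_add[of k m]
    by (simp add: wdeg_superset[of ?A] lookup_add sum.distrib algebra_simps)
qed

lemma wdeg_single [simp]: "wdeg \<omega> (Poly_Mapping.single i c) = c * \<omega> i"
  by (cases "c = 0") (simp_all add: wdeg_def)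

lemma wdeg_0 [simp]: "wdeg \<omega> 0 = 0"
  by (simp add: wdeg_def)

lemma wdeg_eq_0_iff:
  assumes "\<And>i. i \<in> Poly_Mapping.keys k \<Longrightarrow> \<omega> i > 0"
  shows "wdeg \<omega> k = 0 \<longleftrightarrow> k = 0"
proof -
  have "wdeg \<omega> k = 0 \<longleftrightarrow> (\<forall>i\<in>Poly_Mapping.keys k. Poly_Mapping.lookup k i * \<omega> i = 0)"
    unfolding wdeg_def by simp
  also have "\<dots> \<longleftrightarrow> (\<forall>i\<in>Poly_Mapping.keys k. False)"
    using assms by (intro ball_cong) (auto simp: in_keys_iff)
  also have "\<dots> \<longleftrightarrow> Poly_Mapping.keys k = {}" by blast
  finally show ?thesis by simp
qed

lemma weighted_homogeneous_0 [simp]: "weighted_homogeneous \<omega> a 0"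
  by (simp add: weighted_homogeneous_def)

lemma weighted_homogeneous_monomial:
  "weighted_homogeneous \<omega> a (monomial m c) \<longleftrightarrow> c = 0 \<or> int (wdeg \<omega> m) = a"
  by (simp add: weighted_homogeneous_def)

lemma weighted_homogeneous_add:
  "weighted_homogeneous \<omega> a p \<Longrightarrow> weighted_homogeneous \<omega> a q \<Longrightarrow> weighted_homogeneous \<omega> a (p + q)"
  using Poly_Mapping.keys_add[of p q] unfolding weighted_homogeneous_def by blast

lemma weighted_homogeneous_uminus:
  "weighted_homogeneous \<omega> a p \<Longrightarrow> weighted_homogeneous \<omega> a (- p)"
  by (simp add: weighted_homogeneous_def)

lemma weighted_homogeneous_diff:
  "weighted_homogeneous \<omega> a p \<Longrightarrow> weighted_homogeneous \<omega> a q \<Longrightarrow> weighted_homogeneous \<omega> a (p - q)"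
  using weighted_homogeneous_add[of \<omega> a p "- q"] weighted_homogeneous_uminus[of \<omega> a q] by simp

lemma weighted_homogeneous_sum:
  "(\<And>i. i \<in> I \<Longrightarrow> weighted_homogeneous \<omega> a (f i)) \<Longrightarrow> weighted_homogeneous \<omega> a (sum f I)"
  by (induction I rule: infinite_finite_induct) (auto intro: weighted_homogeneous_add)

lemma weighted_homogeneous_mult:
  assumes "weighted_homogeneous \<omega> a p" "weighted_homogeneous \<omega> b q"
  shows "weighted_homogeneous \<omega> (a + b) (p * q)"
  unfolding weighted_homogeneous_def
proof
  fix k assume "k \<in> Poly_Mapping.keys (p * q)"
  then obtain x y where "k = x + y" "x \<in> Poly_Mapping.keys p" "y \<in> Poly_Mapping.keys q"
    using Poly_Mapping.keys_mult[of p q] by blast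
  then show "int (wdeg \<omega> k) = a + b"
    using assms by (simp add: weighted_homogeneous_def wdeg_add)
qed

lemma weighted_homogeneous_prod:
  "(\<And>i. i \<in> I \<Longrightarrow> weighted_homogeneous \<omega> (a i) (f i)) \<Longrightarrow>
    weighted_homogeneous \<omega> (sum a I) (prod f I)"
proof (induction I rule: infinite_finite_induct)
  case (insert i I)
  then show ?case by (simp add: weighted_homogeneous_mult)
qed (simp_all add: weighted_homogeneous_def)

lemma weighted_homogeneous_partial_deriv:
  assumes "weighted_homogeneous \<omega> a p"
  shows "weighted_homogeneous \<omega> (a - int (\<omega> i)) (partial_deriv i p)"
  unfolding weighted_homogeneous_def
proof
  fix k assume "k \<in> Poly_Mapping.keys (partial_deriv i p)"
  then have "k + Poly_Mapping.single i 1 \<in> Poly_Mapping.keys p"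
    by (auto simp: in_keys_iff lookup_partial_deriv)
  then show "int (wdeg \<omega> k) = a - int (\<omega> i)"
    using assms by (fastforce simp: weighted_homogeneous_def wdeg_add)
qed

section \<open>Weighted homogeneous components\<close>

definition hcomp :: "(nat \<Rightarrow> nat) \<Rightarrow> int \<Rightarrow> 'k::field_char_0 mpoly \<Rightarrow> 'k mpoly" where
  "hcomp \<omega> a p = (\<Sum>m\<in>Poly_Mapping.keys p.
     if int (wdeg \<omega> m) = a then monomial m (Poly_Mapping.lookup p m) else 0)"

lemma lookup_hcomp:
  "Poly_Mapping.lookup (hcomp \<omega> a p) m = (if int (wdeg \<omega> m) = a then Poly_Mapping.lookup p m else 0)"
proof -
  have "Poly_Mapping.lookup (hcomp \<omega> a p) m = (\<Sum>k\<in>Poly_Mapping.keys p. if k = m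
      then (if int (wdeg \<omega> m) = a then Poly_Mapping.lookup p m else 0) else 0)"
    unfolding hcomp_def lookup_sum by (intro sum.cong) (auto simp: lookup_single when_def)
  then show ?thesis by (simp add: in_keys_iff)
qed

lemma hcomp_0 [simp]: "hcomp \<omega> a 0 = 0"
  by (simp add: hcomp_def)

lemma hcomp_add: "hcomp \<omega> a (p + q) = hcomp \<omega> a p + hcomp \<omega> a q"
  by (rule poly_mapping_eqI) (simp add: lookup_hcomp lookup_add)

lemma hcomp_sum: "hcomp \<omega> a (sum f I) = (\<Sum>i\<in>I. hcomp \<omega> a (f i))"
  by (induction I rule: infinite_finite_induct) (simp_all add: hcomp_add)

lemma weighted_homogeneous_hcomp: "weighted_homogeneous \<omega> a (hcomp \<omega> a p)"
  by (auto simp: weighted_homogeneous_def in_keys_iff lookup_hcomp split: if_splits)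

lemma hcomp_closed: "p \<in> mpolys m \<Longrightarrow> hcomp \<omega> a p \<in> mpolys m"
  by (auto simp: mpolys_def in_keys_iff lookup_hcomp split: if_splits)

lemma hcomp_id: "weighted_homogeneous \<omega> a p \<Longrightarrow> hcomp \<omega> a p = p"
  by (rule poly_mapping_eqI) (auto simp: lookup_hcomp weighted_homogeneous_def in_keys_iff)

text \<open>The device by which coefficients in a relation between homogeneous elements are replaced
  by homogeneous ones. Degrees are integers, so b - a may be negative; both sides are then
  0.\<close>

lemma hcomp_mult:
  assumes "weighted_homogeneous \<omega> a p"
  shows "hcomp \<omega> b (p * q) = p * hcomp \<omega> (b - a) q"
proof -
  have mono: "hcomp \<omega> b (monomial k c * q) = monomial k c * hcomp \<omega> (b - int (wdeg \<omega> k)) q" for k c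
  proof (induction q rule: mpoly_induct)
    case (monomial m d)
    have "hcomp \<omega> x (monomial u y) = (if int (wdeg \<omega> u) = x then monomial u y else 0)" for x u and y :: 'a
      by (rule poly_mapping_eqI) (auto simp: lookup_hcomp lookup_single when_def)
    then show ?case by (auto simp: mult_single wdeg_add)
  qed (simp add: hcomp_add algebra_simps)
  have "hcomp \<omega> b (p * q) = hcomp \<omega> b (\<Sum>k\<in>Poly_Mapping.keys p. monomial k (Poly_Mapping.lookup p k) * q)"
    by (simp add: sum_distrib_right[symmetric] sum_monomials)
  also have "\<dots> = (\<Sum>k\<in>Poly_Mapping.keys p. monomial k (Poly_Mapping.lookup p k) * hcomp \<omega> (b - a) q)"
    unfolding hcomp_sum mono using assms by (intro sum.cong) (auto simp: weighted_homogeneous_def)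
  also have "\<dots> = p * hcomp \<omega> (b - a) q"
    by (simp add: sum_distrib_right[symmetric] sum_monomials)
  finally show ?thesis .
qed

lemma euler_formula:
  assumes "f \<in> mpolys (Suc n)" "weighted_homogeneous \<omega> (int d) f"
  shows "apply_der n (euler n \<omega>) f = of_nat d * f"
proof (rule poly_mapping_eqI)
  fix k
  have summand: "Poly_Mapping.lookup (euler n \<omega> j * partial_deriv j f) k =
      of_nat (Poly_Mapping.lookup k j * \<omega> j) * Poly_Mapping.lookup f k" if "j \<le> n" for j
  proof -
    have eq: "euler n \<omega> j * partial_deriv j f =
        (partial_deriv j f * monomial (Poly_Mapping.single j 1) (of_nat (\<omega> j)))"
    proof -
      have "of_nat (\<omega> j) * mvar j = monomial (Poly_Mapping.single j 1) (of_nat (\<omega> j) :: 'a)"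
        by (simp add: mvar_def single_of_nat[symmetric] mult_single del: single_of_nat)
      then show ?thesis using that by (simp add: euler_def mult.commute)
    qed
    show ?thesis
    proof (cases "Poly_Mapping.lookup k j = 0")
      case True
      have "k \<notin> Poly_Mapping.keys (partial_deriv j f * monomial (Poly_Mapping.single j 1) (of_nat (\<omega> j)))"
        using Poly_Mapping.keys_mult[of "partial_deriv j f" "monomial (Poly_Mapping.single j 1) (of_nat (\<omega> j))"] True
        by (auto simp: lookup_add split: if_splits)
      then show ?thesis unfolding eq using True by (simp add: in_keys_iff)
    next
      case False
      have k: "k = (k - Poly_Mapping.single j 1) + Poly_Mapping.single j 1"
        using False by (intro poly_mapping_eqI) (auto simp: lookup_add lookup_minus lookup_single when_def)
      have "Poly_Mapping.lookup (euler n \<omega> j * partial_deriv j f) k =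
          Poly_Mapping.lookup (partial_deriv j f) (k - Poly_Mapping.single j 1) * of_nat (\<omega> j)"
        unfolding eq by (subst k) (rule lookup_mult_monomial)
      also have "\<dots> = of_nat (Suc (Poly_Mapping.lookup (k - Poly_Mapping.single j 1) j)) * Poly_Mapping.lookup f k * of_nat (\<omega> j)"
        unfolding lookup_partial_deriv using k by simp
      also have "Suc (Poly_Mapping.lookup (k - Poly_Mapping.single j 1) j) = Poly_Mapping.lookup k j"
        using False by (simp add: lookup_minus)
      finally show ?thesis by (simp add: mult.commute mult.left_commute)
    qed
  qed
  have "Poly_Mapping.lookup (apply_der n (euler n \<omega>) f) k =
      of_nat (\<Sum>j=0..n. Poly_Mapping.lookup k j * \<omega> j) * Poly_Mapping.lookup f k"
    unfolding apply_der_def lookup_sum of_nat_sum sum_distrib_right by (intro sum.cong) (simp_all add: summand)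
  also have "\<dots> = of_nat d * Poly_Mapping.lookup f k"
  proof (cases "k \<in> Poly_Mapping.keys f")
    case True
    then have "Poly_Mapping.keys k \<subseteq> {0..n}" using assms(1) by (fastforce simp: mpolys_def)
    then have "(\<Sum>j=0..n. Poly_Mapping.lookup k j * \<omega> j) = wdeg \<omega> k" by (simp add: wdeg_superset[of "{0..n}"])
    moreover have "wdeg \<omega> k = d" using True assms(2) by (simp add: weighted_homogeneous_def)
    ultimately show ?thesis by simp
  qed (simp add: in_keys_iff)
  also have "\<dots> = Poly_Mapping.lookup (of_nat d * f) k"
    using lookup_mult_monomial[of f 0 "of_nat d" k]
    by (simp add: mult.commute)
  finally show "Poly_Mapping.lookup (apply_der n (euler n \<omega>) f) k = Poly_Mapping.lookup (of_nat d * f) k" .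
qed

section \<open>Ideals of height two\<close>

lemma ideal_mpolysI:
  assumes "J \<subseteq> mpolys (Suc n)" "0 \<in> J" "\<And>x y. x \<in> J \<Longrightarrow> y \<in> J \<Longrightarrow> x + y \<in> J"
    "\<And>a x. a \<in> mpolys (Suc n) \<Longrightarrow> x \<in> J \<Longrightarrow> a * x \<in> J"
  shows "ideal J (poly_ring n)"
proof -
  interpret R: cring "poly_ring n :: 'a mpoly ring" by (rule cring_poly_ring)
  have neg: "- x \<in> J" if "x \<in> J" for x
    using assms(4)[OF mpolys.uminus_closed[OF mpolys.one_closed] that] by simp
  show ?thesis
  proof (rule idealI[OF R.ring_axioms])
    show "subgroup J (add_monoid (poly_ring n))"
    proof (rule R.add.subgroupI)
      show "\<ominus>\<^bsub>poly_ring n\<^esub> x \<in> J" if "x \<in> J" for x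
      proof -
        have "\<ominus>\<^bsub>poly_ring n\<^esub> x = - x"
          by (rule R.minus_equality) (use that neg assms(1) in \<open>auto simp: carrier_poly_ring\<close>)
        then show ?thesis using neg that by simp
      qed
    qed (use assms in \<open>auto simp: carrier_poly_ring\<close>)
    show "a \<otimes>\<^bsub>poly_ring n\<^esub> x \<in> J" if "a \<in> J" "x \<in> carrier (poly_ring n)" for a x
      using assms(4)[of x a] that by (simp add: carrier_poly_ring mult.commute)
  qed (use assms in \<open>auto simp: carrier_poly_ring\<close>)
qed

lemma Idl_mpolys:
  fixes c :: "nat \<Rightarrow> 'k::field_char_0 mpoly"
  assumes "\<And>k. k \<le> n \<Longrightarrow> c k \<in> mpolys (Suc n)"
  shows "Idl\<^bsub>poly_ring n\<^esub> (c ` {..n}) = {\<Sum>k\<le>n. h k * c k | h. \<forall>k\<le>n. h k \<in> mpolys (Suc n)}"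
    (is "?I = ?J")
proof
  interpret R: cring "poly_ring n :: 'k mpoly ring" by (rule cring_poly_ring)
  show "?I \<subseteq> ?J"
  proof (rule R.genideal_minimal)
    show "ideal ?J (poly_ring n)"
    proof (rule ideal_mpolysI)
      show "?J \<subseteq> mpolys (Suc n)" using assms by (auto intro!: mpolys.sum_closed mpolys.mult_closed)
      show "0 \<in> ?J" by (intro CollectI exI[of _ "\<lambda>_. 0"]) auto
      show "x + y \<in> ?J" if xy: "x \<in> ?J" "y \<in> ?J" for x y
      proof -
        obtain h g where "x = (\<Sum>k\<le>n. h k * c k)" "y = (\<Sum>k\<le>n. g k * c k)"
          "\<forall>k\<le>n. h k \<in> mpolys (Suc n)" "\<forall>k\<le>n. g k \<in> mpolys (Suc n)" using xy by blast
        then show ?thesis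
          by (intro CollectI exI[of _ "\<lambda>k. h k + g k"]) (auto simp: sum.distrib distrib_right)
      qed
      show "a * x \<in> ?J" if ax: "a \<in> mpolys (Suc n)" "x \<in> ?J" for a x
      proof -
        obtain h where "x = (\<Sum>k\<le>n. h k * c k)" "\<forall>k\<le>n. h k \<in> mpolys (Suc n)" using ax by blast
        then show ?thesis using ax
          by (intro CollectI exI[of _ "\<lambda>k. a * h k"]) (auto simp: sum_distrib_left mult.assoc)
      qed
    qed
    show "c ` {..n} \<subseteq> ?J"
    proof
      fix x assume "x \<in> c ` {..n}"
      then obtain k where k: "k \<le> n" "x = c k" by blast
      then have "x = (\<Sum>j\<le>n. (if j = k then 1 else 0) * c j)"
        by (simp add: if_distrib[of "\<lambda>t. t * _"] cong: if_cong)
      then show "x \<in> ?J" by (intro CollectI exI[of _ "\<lambda>j. if j = k then 1 else 0"]) auto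
    qed
  qed
  have sub: "c ` {..n} \<subseteq> carrier (poly_ring n)" using assms by (auto simp: carrier_poly_ring)
  interpret I: ideal ?I "poly_ring n" by (rule R.genideal_ideal[OF sub])
  show "?J \<subseteq> ?I"
  proof clarify
    fix h :: "nat \<Rightarrow> 'k mpoly" assume h: "\<forall>k\<le>n. h k \<in> mpolys (Suc n)"
    have "(\<Sum>k\<in>K. h k * c k) \<in> ?I" if "finite K" "K \<subseteq> {..n}" for K
      using that
    proof (induction K)
      case empty
      show ?case using I.zero_closed by simp
    next
      case (insert k K)
      have "c k \<in> ?I" using R.genideal_self[OF sub] insert by auto
      then have "h k * c k \<in> ?I"
        using I.I_l_closed[of "c k" "h k"] h insert by (simp add: carrier_poly_ring)
      then show ?case using I.a_closed[of "h k * c k"] insert by simp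
    qed
    then show "(\<Sum>k\<le>n. h k * c k) \<in> ?I" by blast
  qed
qed

text \<open>In a chain with at least two steps the member just below P strictly contains another
  prime, so it is a nonzero prime and would have to equal P. The form of the premise also covers P =
  0.\<close>

lemma prime_height_le_1:
  assumes "\<And>Q. primeideal Q R \<Longrightarrow> Q \<subseteq> P \<Longrightarrow> Q \<noteq> {\<zero>\<^bsub>R\<^esub>} \<Longrightarrow> Q = P"
  shows "prime_height R P \<le> 1"
  unfolding prime_height_def
proof (rule Sup_least)
  fix x assume "x \<in> {enat k | k. \<exists>Q. (\<forall>i\<le>k. primeideal (Q i) R) \<and>
    (\<forall>i<k. Q i \<subset> Q (Suc i)) \<and> Q k = P}"
  then obtain k Q where Q: "x = enat k" "\<forall>i\<le>k. primeideal (Q i) R"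
    "\<forall>i<k. Q i \<subset> Q (Suc i)" "Q k = P" by blast
  have "k \<le> 1"
  proof (rule ccontr)
    assume "\<not> k \<le> 1"
    then obtain l where k: "k = Suc (Suc l)" by (metis One_nat_def not0_implies_Suc le0 le_Suc_eq)
    have "primeideal (Q l) R" using Q(2) k by simp
    then have "\<zero>\<^bsub>R\<^esub> \<in> Q l"
      by (simp add: primeideal_def ideal_def additive_subgroup.zero_closed)
    then have "Q (Suc l) \<noteq> {\<zero>\<^bsub>R\<^esub>}" using Q(3) k by (metis less_Suc_eq psubsetE singletonD subsetI subset_singletonD)
    moreover have "Q (Suc l) \<subset> P" "primeideal (Q (Suc l)) R" using Q k by auto
    ultimately show False using assms by blast
  qed
  then show "x \<le> 1" using Q(1) by (simp add: one_enat_def)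
qed

lemma domain_poly_ring: "domain (poly_ring n :: 'k::field_char_0 mpoly ring)"
proof -
  interpret R: cring "poly_ring n :: 'k mpoly ring" by (rule cring_poly_ring)
  show ?thesis by unfold_locales auto
qed

lemma primeideal_multiples:
  assumes "prime_in (mpolys (Suc n)) p"
  shows "primeideal {x \<in> mpolys (Suc n). rdvd (mpolys (Suc n)) p x} (poly_ring n)" (is "primeideal ?P _")
proof (rule primeidealI)
  note p = mpolys.prime_inD[OF assms]
  show "ideal ?P (poly_ring n)"
    by (rule ideal_mpolysI) (auto intro: mpolys.rdvd_add mpolys.rdvd_mult2)
  show "cring (poly_ring n :: 'a mpoly ring)" by (rule cring_poly_ring)
  show "carrier (poly_ring n) \<noteq> ?P" using p(3) by (auto simp: carrier_poly_ring)
  show "a \<in> ?P \<or> b \<in> ?P" if "a \<in> carrier (poly_ring n)" "b \<in> carrier (poly_ring n)"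
    "a \<otimes>\<^bsub>poly_ring n\<^esub> b \<in> ?P" for a b
    using that p(4)[of a b] by (auto simp: carrier_poly_ring)
qed

text \<open>The factorial case of Krull's principal ideal theorem, by descent: an element of Q is p
  * s, and Q contains p or s, where s has fewer prime factors. So a nonzero Q contains p.\<close>

lemma prime_height_multiples:
  assumes "prime_in (mpolys (Suc n)) p"
  shows "prime_height (poly_ring n) {x \<in> mpolys (Suc n). rdvd (mpolys (Suc n)) p x} \<le> 1"
    (is "prime_height _ ?P \<le> 1")
proof (rule prime_height_le_1)
  fix Q assume Q: "primeideal Q (poly_ring n)" "Q \<subseteq> ?P" "Q \<noteq> {\<zero>\<^bsub>poly_ring n\<^esub>}"
  interpret Q: primeideal Q "poly_ring n" by fact
  note p = mpolys.prime_inD[OF assms]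
  have "p \<in> Q" if "prime_product (mpolys (Suc n)) k a" "a \<in> Q" for k a
    using that
  proof (induction k arbitrary: a rule: less_induct)
    case (less k)
    then obtain s where s: "s \<in> mpolys (Suc n)" "a = p * s" using Q(2) by (auto simp: rdvd_def)
    then have "p \<in> Q \<or> s \<in> Q"
      using Q.I_prime[of p s] less(3) p(1) by (simp add: carrier_poly_ring)
    moreover obtain m where "m < k" "prime_product (mpolys (Suc n)) m s"
      using mpolys.prime_product_cancel[OF less(2) assms s(2,1)] by blast
    ultimately show ?case using less(1) by blast
  qed
  moreover obtain a where a: "a \<in> Q" "a \<noteq> 0"
    using Q(3) additive_subgroup.zero_closed[OF Q.additive_subgroup_axioms] by auto
  moreover have "a \<in> mpolys (Suc n)" using a Q.a_subset by (auto simp: carrier_poly_ring)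
  ultimately have "p \<in> Q" using mpolys.prime_product_exists by blast
  then have "?P \<subseteq> Q"
    using Q.I_r_closed by (auto simp: rdvd_def carrier_poly_ring)
  then show "Q = ?P" using Q(2) by blast
qed

lemma ideal_height_le:
  "primeideal P R \<Longrightarrow> I \<subseteq> P \<Longrightarrow> ideal_height R I \<le> prime_height R P"
  unfolding ideal_height_def by (rule Inf_lower) blast

section \<open>What height two says about the generators\<close>

context
  fixes n :: nat and c :: "nat \<Rightarrow> 'k::field_char_0 mpoly"
  assumes c: "\<And>k. k \<le> n \<Longrightarrow> c k \<in> mpolys (Suc n)"
    and height: "ideal_height (poly_ring n) (Idl\<^bsub>poly_ring n\<^esub> (c ` {..n})) = 2"
begin

lemma height_2_not_subset:
  assumes "primeideal P (poly_ring n)" "prime_height (poly_ring n) P \<le> 1"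
  shows "\<exists>k\<le>n. c k \<notin> P"
proof (rule ccontr)
  assume all: "\<not> ?thesis"
  interpret R: cring "poly_ring n :: 'k mpoly ring" by (rule cring_poly_ring)
  have "Idl\<^bsub>poly_ring n\<^esub> (c ` {..n}) \<subseteq> P"
    using assms(1) all by (intro R.genideal_minimal primeideal.axioms(1)) auto
  then have "(2::enat) \<le> 1"
    using ideal_height_le[OF assms(1)] assms(2) height order_trans by metis
  then show False by (simp add: numeral_eq_enat one_enat_def)
qed

lemma height_2_coprime:
  assumes "prime_in (mpolys (Suc n)) p"
  shows "\<exists>k\<le>n. \<not> rdvd (mpolys (Suc n)) p (c k)"
  using height_2_not_subset[OF primeideal_multiples[OF assms] prime_height_multiples[OF assms]] c
  by auto

lemma height_2_nonzero: "\<exists>k\<le>n. c k \<noteq> 0"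
proof -
  have "prime_height (poly_ring n) {0 :: 'k mpoly} \<le> 1"
  proof (rule prime_height_le_1)
    fix Q :: "'k mpoly set"
    assume Q: "primeideal Q (poly_ring n)" "Q \<subseteq> {0}" "Q \<noteq> {\<zero>\<^bsub>poly_ring n\<^esub>}"
    interpret Q: primeideal Q "poly_ring n" by fact
    show "Q = {0}" using additive_subgroup.zero_closed[OF Q.additive_subgroup_axioms] Q(2) by auto
  qed
  then show ?thesis
    using height_2_not_subset[of "{0}"] domain.zeroprimeideal[OF domain_poly_ring[of n]] by simp
qed

text \<open>The unit ideal has height infinity by convention, so height exactly 2 excludes it. This
  is what rules out a constant f in the ideal.\<close>

lemma height_2_proper: "1 \<notin> Idl\<^bsub>poly_ring n\<^esub> (c ` {..n})" (is "_ \<notin> ?I")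
proof
  assume 1: "1 \<in> ?I"
  have "\<not> (primeideal P (poly_ring n) \<and> ?I \<subseteq> P)" for P
  proof
    assume P: "primeideal P (poly_ring n) \<and> ?I \<subseteq> P"
    then interpret P: primeideal P "poly_ring n" by simp
    have "P = carrier (poly_ring n)" using P.one_imp_carrier 1 P by auto
    then show False using P.I_notcarr by simp
  qed
  then have "{prime_height (poly_ring n) P | P. primeideal P (poly_ring n) \<and> ?I \<subseteq> P} = {}" by blast
  then have "ideal_height (poly_ring n) ?I = \<infinity>"
    unfolding ideal_height_def by (simp only: Inf_empty top_enat_def)
  then show False using height by simp
qed

end


section \<open>Determinants\<close>

text \<open>A matrix is given by its family of rows, so that replacing a row is a function update
  \<open>\<rho>(i := y)\<close>. Rows and columns run from 0 to n.\<close>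

definition row_mat :: "nat \<Rightarrow> (nat \<Rightarrow> nat \<Rightarrow> 'a) \<Rightarrow> 'a mat" where
  "row_mat n \<rho> = mat (Suc n) (Suc n) (\<lambda>(i, j). \<rho> i j)"

lemma row_mat_carrier [simp]: "row_mat n \<rho> \<in> carrier_mat (Suc n) (Suc n)"
  by (simp add: row_mat_def)

lemma row_mat_index [simp]: "i \<le> n \<Longrightarrow> j \<le> n \<Longrightarrow> row_mat n \<rho> $$ (i, j) = \<rho> i j"
  by (simp add: row_mat_def)

lemma cofactor_mult_rows:
  fixes \<rho> :: "nat \<Rightarrow> nat \<Rightarrow> 'a::comm_ring_1"
  assumes "j \<le> n" "l \<le> n"
  shows "(\<Sum>i\<le>n. cofactor (row_mat n \<rho>) i j * \<rho> i l) = (if j = l then det (row_mat n \<rho>) else 0)"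
proof -
  have "(adj_mat (row_mat n \<rho>) * row_mat n \<rho>) $$ (j, l) = (\<Sum>i\<le>n. cofactor (row_mat n \<rho>) i j * \<rho> i l)"
    using assms by (auto simp: adj_mat_def scalar_prod_def row_mat_def atLeast0LessThan lessThan_Suc_atMost
        intro!: sum.cong)
  then show ?thesis using assms adj_mat(3)[OF row_mat_carrier[of n \<rho>]] by (cases "j = l") simp_all
qed

lemma rows_mult_cofactor:
  fixes \<rho> :: "nat \<Rightarrow> nat \<Rightarrow> 'a::comm_ring_1"
  assumes "i \<le> n" "l \<le> n"
  shows "(\<Sum>j\<le>n. \<rho> i j * cofactor (row_mat n \<rho>) l j) = (if i = l then det (row_mat n \<rho>) else 0)"
proof -
  have "(row_mat n \<rho> * adj_mat (row_mat n \<rho>)) $$ (i, l) = (\<Sum>j\<le>n. \<rho> i j * cofactor (row_mat n \<rho>) l j)"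
    using assms by (auto simp: adj_mat_def scalar_prod_def row_mat_def atLeast0LessThan lessThan_Suc_atMost
        intro!: sum.cong)
  then show ?thesis using assms adj_mat(2)[OF row_mat_carrier[of n \<rho>]] by (cases "i = l") simp_all
qed

text \<open>The cofactors along the last row do not see that row, so the maximal minors of the
  eigenscheme stay the same whichever row completes the matrix.\<close>

lemma cofactor_last_cong:
  assumes "\<And>i. i < n \<Longrightarrow> \<rho> i = \<sigma> i"
  shows "cofactor (row_mat n \<rho>) n k = cofactor (row_mat n \<sigma>) n k"
proof -
  have "mat_delete (row_mat n \<rho>) n k = mat_delete (row_mat n \<sigma>) n k"
    by (rule eq_matI) (auto simp: mat_delete_def row_mat_def assms)
  then show ?thesis by (simp add: cofactor_def)
qed

lemma rows_independent:
  fixes \<rho> :: "nat \<Rightarrow> nat \<Rightarrow> 'a::idom"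
  assumes "det (row_mat n \<rho>) \<noteq> 0" "\<And>j. j \<le> n \<Longrightarrow> (\<Sum>i\<le>n. b i * \<rho> i j) = 0" "l \<le> n"
  shows "b l = 0"
proof -
  let ?c = "\<lambda>j. cofactor (row_mat n \<rho>) l j"
  have "0 = (\<Sum>j\<le>n. (\<Sum>i\<le>n. b i * \<rho> i j) * ?c j)" using assms(2) by simp
  also have "\<dots> = (\<Sum>i\<le>n. b i * (\<Sum>j\<le>n. \<rho> i j * ?c j))"
    unfolding sum_distrib_right sum_distrib_left by (subst sum.swap) (simp add: mult.assoc)
  also have "\<dots> = (\<Sum>i\<le>n. if i = l then b l * det (row_mat n \<rho>) else 0)"
    by (intro sum.cong) (auto simp: rows_mult_cofactor assms(3))
  also have "\<dots> = b l * det (row_mat n \<rho>)" using assms(3) by simp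
  finally show ?thesis using assms(1) by simp
qed

lemma det_replace_row:
  fixes \<rho> :: "nat \<Rightarrow> nat \<Rightarrow> 'a::comm_ring_1"
  assumes "i \<le> n"
  shows "det (row_mat n (\<rho>(i := y))) = (\<Sum>k\<le>n. y k * cofactor (row_mat n \<rho>) i k)"
proof -
  have "mat_delete (row_mat n (\<rho>(i := y))) i k = mat_delete (row_mat n \<rho>) i k" for k
    by (rule eq_matI) (auto simp: mat_delete_def row_mat_def)
  then have "cofactor (row_mat n (\<rho>(i := y))) i k = cofactor (row_mat n \<rho>) i k" for k
    by (simp add: cofactor_def)
  then show ?thesis
    using rows_mult_cofactor[OF assms assms, of "\<rho>(i := y)"] by simp
qed

text \<open>Exhibits a cofactor as a determinant, so that facts about determinants, such as
  homogeneity or independence of rows, reach the minors.\<close>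

lemma det_unit_row:
  fixes \<rho> :: "nat \<Rightarrow> nat \<Rightarrow> 'a::comm_ring_1"
  assumes "i \<le> n" "k \<le> n"
  shows "det (row_mat n (\<rho>(i := (\<lambda>j. if j = k then 1 else 0)))) = cofactor (row_mat n \<rho>) i k"
  unfolding det_replace_row[OF assms(1)] using assms(2)
  by (simp add: if_distrib[of "\<lambda>t. t * _"] cong: if_cong)

lemma cramer:
  fixes \<rho> :: "nat \<Rightarrow> nat \<Rightarrow> 'a::comm_ring_1"
  assumes "j \<le> n"
  shows "(\<Sum>i\<le>n. det (row_mat n (\<rho>(i := y))) * \<rho> i j) = det (row_mat n \<rho>) * y j"
proof -
  have "(\<Sum>i\<le>n. det (row_mat n (\<rho>(i := y))) * \<rho> i j) =
      (\<Sum>i\<le>n. \<Sum>k\<le>n. y k * (cofactor (row_mat n \<rho>) i k * \<rho> i j))"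
    by (intro sum.cong) (simp_all add: det_replace_row sum_distrib_right mult.assoc)
  also have "\<dots> = (\<Sum>k\<le>n. y k * (\<Sum>i\<le>n. cofactor (row_mat n \<rho>) i k * \<rho> i j))"
    unfolding sum_distrib_left by (rule sum.swap)
  also have "\<dots> = (\<Sum>k\<le>n. if k = j then y j * det (row_mat n \<rho>) else 0)"
    by (intro sum.cong) (auto simp: cofactor_mult_rows assms)
  also have "\<dots> = det (row_mat n \<rho>) * y j" using assms by (simp add: mult.commute)
  finally show ?thesis .
qed

text \<open>With g the gradient of f, the inner sums are the values of the row derivations on f; the
  adjugate turns them into the determinant times the gradient.\<close>

lemma cofactor_mult_apply:
  fixes \<rho> :: "nat \<Rightarrow> nat \<Rightarrow> 'a::comm_ring_1"
  assumes "l \<le> n"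
  shows "(\<Sum>i\<le>n. cofactor (row_mat n \<rho>) i l * (\<Sum>j\<le>n. \<rho> i j * g j)) = det (row_mat n \<rho>) * g l"
proof -
  let ?c = "\<lambda>i. cofactor (row_mat n \<rho>) i l"
  have "(\<Sum>i\<le>n. ?c i * (\<Sum>j\<le>n. \<rho> i j * g j)) = (\<Sum>j\<le>n. (\<Sum>i\<le>n. ?c i * \<rho> i j) * g j)"
    unfolding sum_distrib_left sum_distrib_right by (subst sum.swap) (simp add: mult.assoc)
  also have "\<dots> = (\<Sum>j\<le>n. if l = j then det (row_mat n \<rho>) * g l else 0)"
    by (intro sum.cong) (auto simp: cofactor_mult_rows assms)
  also have "\<dots> = det (row_mat n \<rho>) * g l" using assms by simp
  finally show ?thesis .
qed

context subring_of
begin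

lemma det_closed:
  assumes "A \<in> carrier_mat m m" "\<And>i j. i < m \<Longrightarrow> j < m \<Longrightarrow> A $$ (i, j) \<in> R"
  shows "det A \<in> R"
  unfolding det_def'[OF assms(1)]
proof (intro sum_closed mult_closed prod_closed)
  fix p assume "p \<in> {p. p permutes {0..<m}}"
  then have p: "p permutes {0..<m}" by simp
  show "signof p \<in> R" by (auto simp: sign_def)
  fix i assume "i \<in> {0..<m}"
  then show "A $$ (i, p i) \<in> R" using assms(2) permutes_in_image[OF p, of i] by simp
qed

lemma cofactor_closed:
  assumes "\<And>i j. i \<le> n \<Longrightarrow> j \<le> n \<Longrightarrow> \<rho> i j \<in> R" "i \<le> n" "j \<le> n"
  shows "cofactor (row_mat n \<rho>) i j \<in> R"
  unfolding cofactor_def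
proof (intro mult_closed power_closed det_closed[of _ n])
  show "mat_delete (row_mat n \<rho>) i j $$ (a, b) \<in> R" if "a < n" "b < n" for a b
    using that by (auto simp: mat_delete_def row_mat_def intro!: assms(1))
qed (auto simp: mat_delete_def row_mat_def)

text \<open>Nothing is known of row n; setting it to zero does not affect the cofactor.\<close>

lemma cofactor_last_closed:
  assumes "\<And>i j. i < n \<Longrightarrow> j \<le> n \<Longrightarrow> \<rho> i j \<in> R" "k \<le> n"
  shows "cofactor (row_mat n \<rho>) n k \<in> R"
proof -
  have "cofactor (row_mat n (\<rho>(n := (\<lambda>_. 0)))) n k \<in> R"
    using assms by (intro cofactor_closed) auto
  then show ?thesis using cofactor_last_cong[of n \<rho> "\<rho>(n := (\<lambda>_. 0))" k] by simp
qed

lemma det_row_mat_closed: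
  assumes "\<And>i j. i \<le> n \<Longrightarrow> j \<le> n \<Longrightarrow> \<rho> i j \<in> R"
  shows "det (row_mat n \<rho>) \<in> R"
  using assms by (intro det_closed[OF row_mat_carrier]) auto

lemma rdvd_det_mult:
  assumes "\<And>i j. i \<le> n \<Longrightarrow> j \<le> n \<Longrightarrow> \<rho> i j \<in> R"
    and "\<And>i. i \<le> n \<Longrightarrow> rdvd R f (\<Sum>j\<le>n. \<rho> i j * g j)" "l \<le> n"
  shows "rdvd R f (det (row_mat n \<rho>) * g l)"
proof -
  let ?c = "\<lambda>i. cofactor (row_mat n \<rho>) i l"
  have "rdvd R f (\<Sum>i\<le>n. ?c i * (\<Sum>j\<le>n. \<rho> i j * g j))"
  proof (rule rdvd_sum)
    fix i assume "i \<in> {..n}"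
    then show "rdvd R f (?c i * (\<Sum>j\<le>n. \<rho> i j * g j))"
      using assms cofactor_closed[of n \<rho> i l] rdvd_mult2[OF assms(2)[of i]] by simp
  qed
  then show ?thesis unfolding cofactor_mult_apply[OF assms(3)] .
qed

end

text \<open>As the determinant vanishes, the cofactors of each column k give a relation: C k times
  the last row is a combination of the other rows with coefficients b k i. The relations for k and l
  agree up to the factors C k and C l, the first n rows being independent. Hence C k divides b k i *
  C l for all l, and coprimality of the C l lets C k be divided out.\<close>

lemma (in factorial_subring) last_row_combination:
  assumes \<rho>: "\<And>i j. i \<le> n \<Longrightarrow> j \<le> n \<Longrightarrow> \<rho> i j \<in> R"
    and det0: "det (row_mat n \<rho>) = 0"
    and nonzero: "\<exists>k\<le>n. cofactor (row_mat n \<rho>) n k \<noteq> 0"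
    and coprime: "\<And>p. prime_in R p \<Longrightarrow> \<exists>k\<le>n. \<not> rdvd R p (cofactor (row_mat n \<rho>) n k)"
  shows "\<exists>c. (\<forall>i<n. c i \<in> R) \<and> (\<forall>j\<le>n. \<rho> n j = (\<Sum>i<n. c i * \<rho> i j))"
proof -
  define C where "C k = cofactor (row_mat n \<rho>) n k" for k
  define b where "b k i = - cofactor (row_mat n \<rho>) i k" for k i
  have cl: "C k \<in> R" "i \<le> n \<Longrightarrow> b k i \<in> R" if "k \<le> n" for i k
    using that \<rho> unfolding C_def b_def by (auto intro: cofactor_closed)
  have rel: "C k * \<rho> n l = (\<Sum>i<n. b k i * \<rho> i l)" if "k \<le> n" "l \<le> n" for k l
  proof -
    have "(\<Sum>i<n. cofactor (row_mat n \<rho>) i k * \<rho> i l) + C k * \<rho> n l = 0"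
      using cofactor_mult_rows[OF that, of \<rho>] det0 by (simp add: C_def lessThan_Suc_atMost[symmetric])
    then show ?thesis
      by (simp add: b_def sum_negf eq_neg_iff_add_eq_0 add.commute)
  qed
  obtain k where k: "k \<le> n" "C k \<noteq> 0" using nonzero unfolding C_def by blast
  have cross: "C l * b k i = C k * b l i" if "l \<le> n" "i < n" for l i
  proof -
    \<comment> \<open>Completing the first n rows by the unit vector at k gives a matrix of
      determinant C k, which is nonzero; this is what makes these rows independent. The relation x
      is 0 at the added row.\<close>
    let ?\<sigma> = "\<rho>(n := (\<lambda>j. if j = k then 1 else 0))"
    define x where "x i = (if i < n then C l * b k i - C k * b l i else 0)" for i
    have "x i = 0"
    proof (rule rows_independent)
      show "det (row_mat n ?\<sigma>) \<noteq> 0" 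
        using k by (simp add: C_def det_unit_row)
      show "(\<Sum>i\<le>n. x i * ?\<sigma> i j) = 0" if j: "j \<le> n" for j
      proof -
        have "(\<Sum>i\<le>n. x i * ?\<sigma> i j) = (\<Sum>i<n. C l * (b k i * \<rho> i j) - C k * (b l i * \<rho> i j))"
          by (simp add: lessThan_Suc_atMost[symmetric] x_def algebra_simps)
        also have "\<dots> = C l * (C k * \<rho> n j) - C k * (C l * \<rho> n j)"
          unfolding sum_subtractf sum_distrib_left[symmetric] rel[OF k(1) j] rel[OF \<open>l \<le> n\<close> j] ..
        finally show ?thesis by simp
      qed
    qed (use that in auto)
    then show ?thesis using that by (simp add: x_def)
  qed
  have "rdvd R (C k) (b k i)" if i: "i < n" for i
  proof -
    obtain m where "prime_product R m (C k)" using prime_product_exists cl k by blast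
    then show ?thesis
    proof (rule coprime_cancel)
      show "rdvd R (C k) (b k i * C l)" if "l \<in> {..n}" for l
      proof -
        have "b k i * C l = C k * b l i" using cross[of l i] that i by (simp add: mult.commute)
        then show ?thesis using rdvd_triv cl that i by simp
      qed
      show "\<exists>j\<in>{..n}. \<not> rdvd R p (C j)" if "prime_in R p" for p
        using coprime[OF that] unfolding C_def by auto
    qed (use cl k i in auto)
  qed
  then have "\<forall>i\<in>{..<n}. \<exists>c. c \<in> R \<and> b k i = C k * c" unfolding rdvd_def by blast
  from bchoice[OF this] obtain c where c: "\<And>i. i < n \<Longrightarrow> c i \<in> R \<and> b k i = C k * c i" by auto
  have "\<rho> n j = (\<Sum>i<n. c i * \<rho> i j)" if "j \<le> n" for j
  proof -
    have "C k * \<rho> n j = C k * (\<Sum>i<n. c i * \<rho> i j)"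
      unfolding rel[OF k(1) that] sum_distrib_left using c by (intro sum.cong) (auto simp: mult.assoc)
    then show ?thesis using k(2) by simp
  qed
  then show ?thesis using c by blast
qed

text \<open>A permutation meets every row and every column once, so entry degrees of the form a i -
  b j give all terms of the expansion the same degree.\<close>

lemma weighted_homogeneous_det:
  assumes "\<And>i j. i \<le> n \<Longrightarrow> j \<le> n \<Longrightarrow> weighted_homogeneous \<omega> (a i - b j) (\<rho> i j)"
  shows "weighted_homogeneous \<omega> (sum a {..n} - sum b {..n}) (det (row_mat n \<rho>))"
  unfolding det_def'[OF row_mat_carrier]
proof (rule weighted_homogeneous_sum)
  fix p assume "p \<in> {p. p permutes {0..<Suc n}}"
  then have p: "p permutes {..n}" by (simp add: atLeast0LessThan lessThan_Suc_atMost)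
  have hom: "weighted_homogeneous \<omega> (\<Sum>i\<le>n. a i - b (p i)) (\<Prod>i\<le>n. \<rho> i (p i))"
  proof (intro weighted_homogeneous_prod assms)
    fix i assume i: "i \<in> {..n}"
    then show "i \<le> n" "p i \<le> n" using permutes_in_image[OF p, of i] by auto
  qed
  have deg: "(\<Sum>i\<le>n. a i - b (p i)) = sum a {..n} - sum b {..n}"
    unfolding sum_subtractf using sum.permute[OF p, of b] by (simp add: comp_def)
  have "(\<Prod>i = 0..<Suc n. row_mat n \<rho> $$ (i, p i)) = (\<Prod>i\<le>n. \<rho> i (p i))"
  proof (rule prod.cong)
    show "{0..<Suc n} = {..n}" by (simp only: atLeast0LessThan lessThan_Suc_atMost)
    fix i assume i: "i \<in> {..n}"
    then have "p i \<in> {..n}" using permutes_in_image[OF p, of i] by blast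
    then show "row_mat n \<rho> $$ (i, p i) = \<rho> i (p i)" using i by simp
  qed
  moreover have "signof p = (1 :: 'a mpoly) \<or> signof p = (- 1 :: 'a mpoly)" by (simp add: sign_def)
  ultimately show "weighted_homogeneous \<omega> (sum a {..n} - sum b {..n})
      (signof p * (\<Prod>i = 0..<Suc n. row_mat n \<rho> $$ (i, p i)))"
    using hom weighted_homogeneous_uminus[OF hom] unfolding deg
    by (elim disjE) (simp_all only: mult_1_left mult_minus1)
qed


section \<open>Linear systems with more unknowns than equations\<close>

text \<open>Gaussian elimination, by induction on the equations: equation t is solved for an unknown
  r occurring in it, and both are removed.\<close>

lemma underdetermined_system:
  fixes a :: "'s \<Rightarrow> 't \<Rightarrow> 'k::field"
  assumes "finite A" "finite B" "card B < card A"
  shows "\<exists>v. (\<exists>s\<in>A. v s \<noteq> 0) \<and> (\<forall>t\<in>B. (\<Sum>s\<in>A. v s * a s t) = 0)"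
  using assms(2,1,3)
proof (induction B arbitrary: A a rule: finite_induct)
  case empty
  then obtain s where "s \<in> A" by fastforce
  then show ?case by (intro exI[of _ "\<lambda>_. 1"]) auto
next
  case (insert t B)
  show ?case
  proof (cases "\<exists>s\<in>A. a s t \<noteq> 0")
    case False
    obtain v where "\<exists>s\<in>A. v s \<noteq> 0" "\<forall>t\<in>B. (\<Sum>s\<in>A. v s * a s t) = 0"
      using insert.IH[of A a] insert.prems insert.hyps by auto
    then show ?thesis using False by (intro exI[of _ v]) auto
  next
    case True
    then obtain r where r: "r \<in> A" "a r t \<noteq> 0" by blast
    \<comment> \<open>The coefficients left in the other equations after substituting for r.\<close>
    define a' where "a' s u = a s u - a s t / a r t * a r u" for s u
    have "card B < card (A - {r})" using insert.prems insert.hyps r by simp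
    then obtain v where v: "\<exists>s\<in>A - {r}. v s \<noteq> 0" "\<forall>u\<in>B. (\<Sum>s\<in>A - {r}. v s * a' s u) = 0"
      using insert.IH[of "A - {r}" a'] insert.prems by auto
    define w where "w = v(r := - (\<Sum>s\<in>A - {r}. v s * a s t) / a r t)"
    have w: "(\<Sum>s\<in>A. w s * a s u) = (\<Sum>s\<in>A - {r}. v s * a' s u)" for u
    proof -
      have "(\<Sum>s\<in>A. w s * a s u) = w r * a r u + (\<Sum>s\<in>A - {r}. w s * a s u)"
        using r insert.prems by (simp add: sum.remove)
      also have "(\<Sum>s\<in>A - {r}. w s * a s u) = (\<Sum>s\<in>A - {r}. v s * a s u)"
        by (intro sum.cong) (auto simp: w_def)
      also have "w r * a r u = - (\<Sum>s\<in>A - {r}. v s * (a s t / a r t * a r u))"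
        by (simp add: w_def sum_distrib_right sum_divide_distrib mult.assoc)
      finally show ?thesis by (simp add: a'_def right_diff_distrib sum_subtractf)
    qed
    have "(\<Sum>s\<in>A. w s * a s t) = 0" using r(2) by (simp add: w a'_def)
    moreover have "\<exists>s\<in>A. w s \<noteq> 0" using v(1) by (auto simp: w_def)
    ultimately show ?thesis using v(2) w by (intro exI[of _ w]) auto
  qed
qed

section \<open>Derivations preserving a hypersurface\<close>

lemma apply_der_atMost: "apply_der n g p = (\<Sum>j\<le>n. g j * partial_deriv j p)"
  by (simp add: apply_der_def atMost_atLeast0)

lemma apply_der_lincomb:
  "apply_der n (\<lambda>j. \<Sum>i\<in>I. c i * \<theta> i j) f = (\<Sum>i\<in>I. c i * apply_der n (\<theta> i) f)"
  unfolding apply_der_def sum_distrib_left sum_distrib_right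
  by (subst sum.swap) (simp add: mult.assoc)

lemma apply_der_add_mult:
  "apply_der n (\<lambda>j. g j + q * h j) f = apply_der n g f + q * apply_der n h f"
  unfolding apply_der_def by (simp add: sum.distrib sum_distrib_left algebra_simps)

lemma Der_all_iff: "g \<in> Der_all n \<longleftrightarrow> (\<forall>j. g j \<in> mpolys (Suc n)) \<and> (\<forall>j>n. g j = 0)"
proof
  assume g: "g \<in> Der_all n"
  have "g j \<in> mpolys (Suc n)" for j
    using g by (cases "j \<le> n") (auto simp: Der_all_def carrier_poly_ring)
  then show "(\<forall>j. g j \<in> mpolys (Suc n)) \<and> (\<forall>j>n. g j = 0)" using g by (simp add: Der_all_def)
qed (simp add: Der_all_def carrier_poly_ring)

lemma Der_iff: "g \<in> Der n f \<longleftrightarrow> g \<in> Der_all n \<and> rdvd (mpolys (Suc n)) f (apply_der n g f)"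
  unfolding Der_def cgenideal_def rdvd_def carrier_poly_ring by (auto simp: mult.commute)

lemma Der0_subset_Der: "Der0 n f \<subseteq> Der n f"
  by (auto simp: Der0_def Der_iff)

lemma Der0_lincomb:
  assumes "\<And>i. i \<in> I \<Longrightarrow> c i \<in> mpolys (Suc n)" "\<And>i. i \<in> I \<Longrightarrow> \<theta> i \<in> Der0 n f"
  shows "(\<lambda>j. \<Sum>i\<in>I. c i * \<theta> i j) \<in> Der0 n f"
  using assms unfolding Der0_def Der_all_iff
  by (auto simp: apply_der_lincomb intro!: mpolys.sum_closed mpolys.mult_closed sum.neutral)

lemma euler_in_Der_all: "euler n \<omega> \<in> Der_all n"
  by (auto simp: Der_all_iff euler_def intro!: mpolys.mult_closed mvar_mem)

lemma euler_in_Der: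
  assumes "f \<in> mpolys (Suc n)" "weighted_homogeneous \<omega> (int d) f"
  shows "euler n \<omega> \<in> Der n f"
  using euler_in_Der_all by (simp add: Der_iff euler_formula[OF assms] mpolys.rdvd_mult2)

lemma homogeneous_euler: "homogeneous_der n \<omega> 1 (euler n \<omega>)"
proof -
  have "of_nat (\<omega> j) * mvar j = monomial (Poly_Mapping.single j 1) (of_nat (\<omega> j) :: 'a)" for j
    by (simp add: mvar_def single_of_nat[symmetric] mult_single del: single_of_nat)
  then show ?thesis
    by (simp add: homogeneous_der_def euler_def weighted_homogeneous_monomial)
qed

lemma weighted_homogeneous_apply_der:
  assumes "homogeneous_der n \<omega> a g" "weighted_homogeneous \<omega> b f"
  shows "weighted_homogeneous \<omega> (a - 1 + b) (apply_der n g f)"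
  unfolding apply_der_def
proof (rule weighted_homogeneous_sum)
  fix j assume "j \<in> {0..n}"
  then have "weighted_homogeneous \<omega> ((a - (1 - int (\<omega> j))) + (b - int (\<omega> j))) (g j * partial_deriv j f)"
    using assms by (intro weighted_homogeneous_mult weighted_homogeneous_partial_deriv)
      (auto simp: homogeneous_der_def)
  then show "weighted_homogeneous \<omega> (a - 1 + b) (g j * partial_deriv j f)"
    by (simp add: algebra_simps)
qed

text \<open>If g(f) = f * x, Euler's formula shows that x / d times the Euler derivation has the
  same value on f. Taking the component of x in degree a - 1 keeps the difference
  homogeneous.\<close>

lemma Der_split:
  assumes f: "f \<in> mpolys (Suc n)" "weighted_homogeneous \<omega> (int d) f" and d: "d > 0"
    and g: "g \<in> Der n f" "homogeneous_der n \<omega> a g"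
  shows "\<exists>q\<in>mpolys (Suc n). (\<lambda>j. g j - q * euler n \<omega> j) \<in> Der0 n f \<and>
    homogeneous_der n \<omega> a (\<lambda>j. g j - q * euler n \<omega> j)"
proof -
  obtain x where x: "x \<in> mpolys (Suc n)" "apply_der n g f = f * x"
    using g(1) by (auto simp: Der_iff rdvd_def)
  have "f * x = hcomp \<omega> (a - 1 + int d) (f * x)"
    using hcomp_id[OF weighted_homogeneous_apply_der[OF g(2) f(2)]] x(2) by simp
  then have fx: "f * x = f * hcomp \<omega> (a - 1) x" using hcomp_mult[OF f(2)] by simp
  define q where "q = monomial 0 (inverse (of_nat d)) * hcomp \<omega> (a - 1) x"
  have inv: "monomial 0 (inverse (of_nat d)) * of_nat d = (1 :: 'a mpoly)"
    using d by (simp add: single_of_nat[symmetric] mult_single del: single_of_nat)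
  have q: "q \<in> mpolys (Suc n)"
    unfolding q_def using x(1) by (intro mpolys.mult_closed hcomp_closed) (auto simp: monomial_mem_mpolys)
  have "weighted_homogeneous \<omega> (0 + (a - 1)) q"
    unfolding q_def
    by (intro weighted_homogeneous_mult weighted_homogeneous_hcomp) (simp add: weighted_homogeneous_monomial)
  then have qhom: "weighted_homogeneous \<omega> (a - 1) q" by simp
  have hom: "weighted_homogeneous \<omega> (a - (1 - int (\<omega> j))) (q * euler n \<omega> j)" if "j \<le> n" for j
  proof -
    have "weighted_homogeneous \<omega> (1 - (1 - int (\<omega> j))) (euler n \<omega> j :: 'a mpoly)"
      using homogeneous_euler[of n \<omega>] that unfolding homogeneous_der_def by blast
    with qhom have "weighted_homogeneous \<omega> (a - 1 + (1 - (1 - int (\<omega> j)))) (q * euler n \<omega> j)"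
      by (rule weighted_homogeneous_mult)
    then show ?thesis by (simp add: algebra_simps)
  qed
  have "apply_der n (\<lambda>j. g j + (- q) * euler n \<omega> j) f = 0"
    unfolding apply_der_add_mult x(2) fx euler_formula[OF f] q_def
    using inv by (simp add: algebra_simps)
  moreover have "(\<lambda>j. g j - q * euler n \<omega> j) \<in> Der_all n"
    using g(1) euler_in_Der_all[of n \<omega>] q by (auto simp: Der_iff Der_all_iff)
  ultimately have "(\<lambda>j. g j - q * euler n \<omega> j) \<in> Der0 n f"
    by (simp add: Der0_def)
  moreover have "homogeneous_der n \<omega> a (\<lambda>j. g j - q * euler n \<omega> j)"
    using g(2) hom unfolding homogeneous_der_def by (blast intro: weighted_homogeneous_diff)
  ultimately show ?thesis using q by blast
qed

text \<open>Directness of the sum of the Euler part and Der_0. Rewriting each \<rho> k through its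
  correction collects a total Euler coefficient s; applied to f, everything else vanishes and s * d
  * f = 0 remains.\<close>

lemma euler_elimination:
  assumes f: "f \<in> mpolys (Suc n)" "f \<noteq> 0" "weighted_homogeneous \<omega> (int d) f" and d: "d > 0"
    and \<eta>: "\<eta> \<in> Der0 n f" and \<theta>: "\<And>k. k \<in> K \<Longrightarrow> (\<lambda>j. \<rho> k j - q k * euler n \<omega> j) \<in> Der0 n f"
    and comb: "\<And>j. j \<le> n \<Longrightarrow> \<eta> j = c' * euler n \<omega> j + (\<Sum>k\<in>K. c k * \<rho> k j)"
  shows "\<eta> = (\<lambda>j. \<Sum>k\<in>K. c k * (\<rho> k j - q k * euler n \<omega> j))"
proof -
  define s where "s = c' + (\<Sum>k\<in>K. c k * q k)"
  let ?\<theta> = "\<lambda>k j. \<rho> k j - q k * euler n \<omega> j"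
  have eq: "\<eta> j = (\<Sum>k\<in>K. c k * ?\<theta> k j) + s * euler n \<omega> j" if "j \<le> n" for j
    unfolding comb[OF that] s_def
    by (simp add: algebra_simps sum_subtractf sum_distrib_left sum_distrib_right)
  have "0 = apply_der n \<eta> f" using \<eta> by (simp add: Der0_def)
  also have "\<dots> = apply_der n (\<lambda>j. (\<Sum>k\<in>K. c k * ?\<theta> k j) + s * euler n \<omega> j) f"
    unfolding apply_der_def using eq by (intro sum.cong) auto
  also have "\<dots> = (\<Sum>k\<in>K. c k * apply_der n (?\<theta> k) f) + s * (of_nat d * f)"
    unfolding apply_der_add_mult apply_der_lincomb euler_formula[OF f(1,3)] ..
  also have "(\<Sum>k\<in>K. c k * apply_der n (?\<theta> k) f) = 0"
    using \<theta> by (intro sum.neutral) (auto simp: Der0_def)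
  finally have "s = 0" using f(2) d by simp
  show ?thesis
  proof
    fix j
    show "\<eta> j = (\<Sum>k\<in>K. c k * ?\<theta> k j)"
    proof (cases "j \<le> n")
      case True
      then show ?thesis using eq \<open>s = 0\<close> by simp
    next
      case False
      then have "?\<theta> k j = 0" if "k \<in> K" for k using \<theta>[OF that] by (simp add: Der0_def Der_all_iff)
      then show ?thesis using False \<eta> by (simp add: Der0_def Der_all_iff)
    qed
  qed
qed

lemma Der_det_divisible:
  assumes "reduced_poly n f" "\<And>i. i \<le> n \<Longrightarrow> \<rho> i \<in> Der n f"
  shows "rdvd (mpolys (Suc n)) f (det (row_mat n \<rho>))"
proof -
  have f: "f \<in> mpolys (Suc n)" "f \<noteq> 0" using assms(1) by (auto simp: reduced_poly_def carrier_poly_ring)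
  have \<rho>: "\<rho> i j \<in> mpolys (Suc n)" if "i \<le> n" for i j
    using assms(2)[OF that] by (simp add: Der_iff Der_all_iff)
  obtain m where "prime_product (mpolys (Suc n)) m f" using mpolys.prime_product_exists f by blast
  then show ?thesis
  proof (rule mpolys.coprime_cancel)
    show "det (row_mat n \<rho>) \<in> mpolys (Suc n)" using \<rho> by (intro mpolys.det_row_mat_closed)
    show "rdvd (mpolys (Suc n)) f (det (row_mat n \<rho>) * partial_deriv l f)" if "l \<in> {..n}" for l
      using \<rho> assms(2) that
      by (intro mpolys.rdvd_det_mult) (auto simp: Der_iff apply_der_atMost)
    show "\<exists>j\<in>{..n}. \<not> rdvd (mpolys (Suc n)) p (partial_deriv j f)"
      if "prime_in (mpolys (Suc n)) p" "rdvd (mpolys (Suc n)) p f" for p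
      using reduced_coprime_partial_derivs[OF assms(1) that] by auto
  qed (auto intro: partial_deriv_closed f)
qed


section \<open>Bases\<close>

text \<open>Independence is required over the whole polynomial type; a nonzero determinant of rows
  provides it in that strength.\<close>

lemma module_basisI:
  assumes "set \<theta>s \<subseteq> M"
    and span: "\<And>\<eta>. \<eta> \<in> M \<Longrightarrow> \<exists>c. (\<forall>k<length \<theta>s. c k \<in> mpolys (Suc n)) \<and>
      \<eta> = (\<lambda>j. \<Sum>k<length \<theta>s. c k * (\<theta>s ! k) j)"
    and indep: "\<And>b k. (\<And>j. (\<Sum>k<length \<theta>s. b k * (\<theta>s ! k) j) = 0) \<Longrightarrow> k < length \<theta>s \<Longrightarrow> b k = 0"
  shows "module_basis n \<theta>s M"
  unfolding module_basis_def carrier_poly_ring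
proof (intro conjI ballI ex_ex1I)
  fix \<eta> assume "\<eta> \<in> M"
  then obtain c where c: "\<forall>k<length \<theta>s. c k \<in> mpolys (Suc n)"
    "\<eta> = (\<lambda>j. \<Sum>k<length \<theta>s. c k * (\<theta>s ! k) j)" using span by blast
  show "\<exists>cs. length cs = length \<theta>s \<and> set cs \<subseteq> mpolys (Suc n) \<and>
      \<eta> = (\<lambda>j. \<Sum>k<length \<theta>s. cs ! k * (\<theta>s ! k) j)"
    using c by (intro exI[of _ "map c [0..<length \<theta>s]"]) auto
next
  fix \<eta> cs ds
  assume cs: "length cs = length \<theta>s \<and> set cs \<subseteq> mpolys (Suc n) \<and>
      \<eta> = (\<lambda>j. \<Sum>k<length \<theta>s. cs ! k * (\<theta>s ! k) j)"
    and ds: "length ds = length \<theta>s \<and> set ds \<subseteq> mpolys (Suc n) \<and>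
      \<eta> = (\<lambda>j. \<Sum>k<length \<theta>s. ds ! k * (\<theta>s ! k) j)"
  have "(\<Sum>k<length \<theta>s. (cs ! k - ds ! k) * (\<theta>s ! k) j) = \<eta> j - \<eta> j" for j
    using cs ds by (auto simp: left_diff_distrib sum_subtractf dest: fun_cong[of _ _ j])
  then have "cs ! k - ds ! k = 0" if "k < length \<theta>s" for k
    using indep[of "\<lambda>k. cs ! k - ds ! k"] that by simp
  then show "cs = ds" using cs ds by (intro nth_equalityI) auto
qed (use assms in auto)

lemma module_basis_span:
  assumes "module_basis n \<theta>s M" "\<eta> \<in> M"
  shows "\<exists>c. (\<forall>k<length \<theta>s. c k \<in> mpolys (Suc n)) \<and> \<eta> = (\<lambda>j. \<Sum>k<length \<theta>s. c k * (\<theta>s ! k) j)"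
proof -
  obtain cs where "length cs = length \<theta>s" "set cs \<subseteq> mpolys (Suc n)"
    "\<eta> = (\<lambda>j. \<Sum>k<length \<theta>s. cs ! k * (\<theta>s ! k) j)"
    using assms unfolding module_basis_def carrier_poly_ring by (metis (lifting) ext)
  then show ?thesis by (intro exI[of _ "\<lambda>k. cs ! k"]) auto
qed

lemma module_basis_independent:
  assumes "module_basis n \<theta>s M" "(\<lambda>_. 0) \<in> M" "\<And>k. k < length \<theta>s \<Longrightarrow> b k \<in> mpolys (Suc n)"
    and "\<And>j. (\<Sum>k<length \<theta>s. b k * (\<theta>s ! k) j) = 0" "k < length \<theta>s"
  shows "b k = 0"
proof -
  let ?P = "\<lambda>cs. length cs = length \<theta>s \<and> set cs \<subseteq> mpolys (Suc n) \<and>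
    (\<lambda>_. 0) = (\<lambda>j. \<Sum>k<length \<theta>s. cs ! k * (\<theta>s ! k) j)"
  have "\<exists>!cs. ?P cs" using assms(1,2) unfolding module_basis_def carrier_poly_ring by blast
  moreover have "?P (map b [0..<length \<theta>s])" using assms(3,4) by auto
  moreover have "?P (replicate (length \<theta>s) 0)" by auto
  ultimately have "map b [0..<length \<theta>s] = replicate (length \<theta>s) 0" by blast
  then have "map b [0..<length \<theta>s] ! k = replicate (length \<theta>s) 0 ! k" by (rule arg_cong)
  then show ?thesis using assms(5) by simp
qed

text \<open>Positive weights bound each exponent by w, so the graded pieces are finite dimensional
  and can be counted.\<close>

lemma finite_wdeg:
  assumes "\<And>i. i \<le> n \<Longrightarrow> \<omega> i > 0"
  shows "finite {m. Poly_Mapping.keys m \<subseteq> {..n} \<and> wdeg \<omega> m = w}" (is "finite ?M")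
proof (rule finite_imageD)
  let ?F = "{g. \<forall>i. (i \<in> {..n} \<longrightarrow> g i \<in> {..w}) \<and> (i \<notin> {..n} \<longrightarrow> g i = 0)}"
  have "Poly_Mapping.lookup m \<in> ?F" if m: "m \<in> ?M" for m
  proof (intro CollectI allI conjI impI)
    fix i assume i: "i \<in> {..n}"
    have "Poly_Mapping.lookup m i \<le> Poly_Mapping.lookup m i * \<omega> i" using assms[of i] i by simp
    also have "\<dots> \<le> (\<Sum>j\<le>n. Poly_Mapping.lookup m j * \<omega> j)"
      using i by (intro member_le_sum) auto
    also have "\<dots> = wdeg \<omega> m" using m wdeg_superset[of "{..n}" m \<omega>] by simp
    finally show "Poly_Mapping.lookup m i \<in> {..w}" using m by simp
  next
    fix i assume "i \<notin> {..n}"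
    then have "i \<notin> Poly_Mapping.keys m" using m by blast
    then show "Poly_Mapping.lookup m i = 0" by (simp add: in_keys_iff)
  qed
  then have "Poly_Mapping.lookup ` ?M \<subseteq> ?F" by (rule image_subsetI)
  moreover have "finite ?F" by (rule finite_set_of_finite_funs) simp_all
  ultimately show "finite (Poly_Mapping.lookup ` ?M)" by (rule finite_subset)
  show "inj_on Poly_Mapping.lookup ?M" by (rule inj_onI) simp
qed

text \<open>The Hilbert function of the free module with one more generator is larger in the degree
  of that generator, so it is not exhausted by the span of the other family.\<close>

lemma homogeneous_element_outside_span:
  fixes \<theta> \<zeta> :: "nat \<Rightarrow> 'k::field_char_0 derivation"
  assumes \<omega>: "\<And>i. i \<le> n \<Longrightarrow> \<omega> i > 0"
    and \<theta>: "\<And>k. k \<le> N \<Longrightarrow> homogeneous_der n \<omega> (\<alpha> k) (\<theta> k)"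
    and \<theta>0: "\<And>k j. k \<le> N \<Longrightarrow> j > n \<Longrightarrow> \<theta> k j = 0"
    and \<zeta>: "\<And>i. i < N \<Longrightarrow> homogeneous_der n \<omega> (\<alpha> i) (\<zeta> i)"
    and \<zeta>0: "\<And>i j. i < N \<Longrightarrow> j > n \<Longrightarrow> \<zeta> i j = 0"
    and indep: "\<And>b k. (\<And>k. k \<le> N \<Longrightarrow> b k \<in> mpolys (Suc n)) \<Longrightarrow>
      (\<And>j. (\<Sum>k\<le>N. b k * \<theta> k j) = 0) \<Longrightarrow> k \<le> N \<Longrightarrow> b k = 0"
  shows "\<exists>k\<le>N. \<exists>x\<in>mpolys (Suc n). homogeneous_der n \<omega> (\<alpha> N) (\<lambda>j. x * \<theta> k j) \<and>
    \<not> (\<exists>c. (\<forall>i<N. c i \<in> mpolys (Suc n)) \<and> (\<forall>j\<le>n. x * \<theta> k j = (\<Sum>i<N. c i * \<zeta> i j)))"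
proof (rule ccontr)
  assume contra: "\<not> ?thesis"
  \<comment> \<open>The monomials by which \<theta> k or \<zeta> k is multiplied to reach degree
    \<alpha> N. For k = N they include 1, with exponent vector 0, and this pair (N, 0) is what makes
    A larger than B.\<close>
  define M where "M k = {m. Poly_Mapping.keys m \<subseteq> {..n} \<and> int (wdeg \<omega> m) = \<alpha> N - \<alpha> k}" for k
  have finM: "finite (M k)" for k
  proof (rule finite_subset)
    show "M k \<subseteq> {m. Poly_Mapping.keys m \<subseteq> {..n} \<and> wdeg \<omega> m = nat (\<alpha> N - \<alpha> k)}"
      by (auto simp: M_def)
  qed (rule finite_wdeg[OF \<omega>])
  define A where "A = (SIGMA k:{..N}. M k)"
  define B where "B = (SIGMA k:{..<N}. M k)"
  have fin: "finite A" "finite B" unfolding A_def B_def using finM by auto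
  have "(N, 0) \<in> A - B" by (auto simp: A_def B_def M_def)
  moreover have "B \<subseteq> A" by (auto simp: A_def B_def)
  ultimately have card: "card B < card A" using fin by (intro psubset_card_mono) auto
  have Mcl: "monomial m x \<in> mpolys (Suc n)" if "m \<in> M k" for m k and x :: 'k
    using that by (auto simp: M_def monomial_mem_mpolys)
  have "\<exists>c. (\<forall>i<N. c i \<in> mpolys (Suc n) \<and> weighted_homogeneous \<omega> (\<alpha> N - \<alpha> i) (c i)) \<and>
      (\<forall>j\<le>n. monomial m 1 * \<theta> k j = (\<Sum>i<N. c i * \<zeta> i j))" if s: "(k, m) \<in> A" for k m
  proof -
    have k: "k \<le> N" "m \<in> M k" using s by (auto simp: A_def)
    have hom: "weighted_homogeneous \<omega> (\<alpha> N - (1 - int (\<omega> j))) (monomial m 1 * \<theta> k j)" if "j \<le> n" for j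
    proof -
      have "weighted_homogeneous \<omega> ((\<alpha> N - \<alpha> k) + (\<alpha> k - (1 - int (\<omega> j)))) (monomial m 1 * \<theta> k j)"
        using \<theta>[OF k(1)] k(2) that
        by (intro weighted_homogeneous_mult)
           (auto simp: homogeneous_der_def weighted_homogeneous_monomial M_def)
      moreover have "(\<alpha> N - \<alpha> k) + (\<alpha> k - (1 - int (\<omega> j))) = \<alpha> N - (1 - int (\<omega> j))" by simp
      ultimately show ?thesis by metis
    qed
    then have "homogeneous_der n \<omega> (\<alpha> N) (\<lambda>j. monomial m 1 * \<theta> k j)"
      by (simp add: homogeneous_der_def)
    then obtain c where c: "\<forall>i<N. c i \<in> mpolys (Suc n)"
      "\<forall>j\<le>n. monomial m 1 * \<theta> k j = (\<Sum>i<N. c i * \<zeta> i j)"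
      using contra k(1) Mcl[OF k(2), of 1] by blast
    \<comment> \<open>Homogeneous coefficients are supported on M i, so that finitely many scalars,
      indexed by B, describe them.\<close>
    define c' where "c' i = hcomp \<omega> (\<alpha> N - \<alpha> i) (c i)" for i
    have "monomial m 1 * \<theta> k j = (\<Sum>i<N. c' i * \<zeta> i j)" if j: "j \<le> n" for j
    proof -
      have "monomial m 1 * \<theta> k j = hcomp \<omega> (\<alpha> N - (1 - int (\<omega> j))) (\<Sum>i<N. \<zeta> i j * c i)"
        using hcomp_id[OF hom[OF j]] c(2) j by (simp add: mult.commute)
      also have "\<dots> = (\<Sum>i<N. \<zeta> i j * c' i)"
        unfolding hcomp_sum
      proof (rule sum.cong[OF refl])
        fix i assume "i \<in> {..<N}"
        then have "weighted_homogeneous \<omega> (\<alpha> i - (1 - int (\<omega> j))) (\<zeta> i j)"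
          using \<zeta> j by (simp add: homogeneous_der_def)
        then show "hcomp \<omega> (\<alpha> N - (1 - int (\<omega> j))) (\<zeta> i j * c i) = \<zeta> i j * c' i"
          by (simp add: hcomp_mult c'_def)
      qed
      finally show ?thesis by (simp add: mult.commute)
    qed
    moreover have "c' i \<in> mpolys (Suc n) \<and> weighted_homogeneous \<omega> (\<alpha> N - \<alpha> i) (c' i)" if "i < N" for i
      unfolding c'_def using c(1) that hcomp_closed weighted_homogeneous_hcomp by blast
    ultimately show ?thesis by blast
  qed
  then have "\<forall>s\<in>A. \<exists>c. (\<forall>i<N. c i \<in> mpolys (Suc n) \<and> weighted_homogeneous \<omega> (\<alpha> N - \<alpha> i) (c i)) \<and>
      (\<forall>j\<le>n. monomial (snd s) 1 * \<theta> (fst s) j = (\<Sum>i<N. c i * \<zeta> i j))" by auto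
  from bchoice[OF this] obtain c where
    c: "\<And>s i. s \<in> A \<Longrightarrow> i < N \<Longrightarrow> c s i \<in> mpolys (Suc n)"
      "\<And>s i. s \<in> A \<Longrightarrow> i < N \<Longrightarrow> weighted_homogeneous \<omega> (\<alpha> N - \<alpha> i) (c s i)"
      "\<And>s j. s \<in> A \<Longrightarrow> j \<le> n \<Longrightarrow> monomial (snd s) 1 * \<theta> (fst s) j = (\<Sum>i<N. c s i * \<zeta> i j)" by blast
  \<comment> \<open>One unknown for each element of A and one equation for each element of B: some
    nontrivial combination of the multiples indexed by A has all its coefficients against the
    \<zeta> i equal to 0.\<close>
  obtain v where v: "\<exists>s\<in>A. v s \<noteq> 0"
    "\<forall>t\<in>B. (\<Sum>s\<in>A. v s * Poly_Mapping.lookup (c s (fst t)) (snd t)) = 0"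
    using underdetermined_system[OF fin card, of "\<lambda>s t. Poly_Mapping.lookup (c s (fst t)) (snd t)"] by blast
  have zero: "(\<Sum>s\<in>A. c s i * monomial 0 (v s)) = 0" if i: "i < N" for i
  proof (rule poly_mapping_eqI)
    fix m
    have "Poly_Mapping.lookup (\<Sum>s\<in>A. c s i * monomial 0 (v s)) m = (\<Sum>s\<in>A. v s * Poly_Mapping.lookup (c s i) m)"
      unfolding lookup_sum
    proof (rule sum.cong[OF refl])
      fix s
      show "Poly_Mapping.lookup (c s i * monomial 0 (v s)) m = v s * Poly_Mapping.lookup (c s i) m"
        using lookup_mult_monomial[of "c s i" 0 "v s" m] by (simp only: add_0_right mult.commute)
    qed
    also have "\<dots> = 0"
    proof (cases "m \<in> M i")
      case True
      then show ?thesis using v(2) i by (auto simp: B_def)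
    next
      case False
      have "Poly_Mapping.lookup (c s i) m = 0" if "s \<in> A" for s
      proof (rule ccontr)
        assume "Poly_Mapping.lookup (c s i) m \<noteq> 0"
        then have "m \<in> Poly_Mapping.keys (c s i)" by (simp add: in_keys_iff)
        then have "m \<in> M i"
          using c(1)[OF that i] c(2)[OF that i] by (auto simp: M_def mpolys_def weighted_homogeneous_def lessThan_Suc_atMost)
        then show False using False by simp
      qed
      then show ?thesis by simp
    qed
    finally show "Poly_Mapping.lookup (\<Sum>s\<in>A. c s i * monomial 0 (v s)) m = Poly_Mapping.lookup 0 m" by simp
  qed
  \<comment> \<open>Collected by k, the combination becomes a relation among the \<theta> k. The
    monomials in M k are distinct, so b k = 0 forces the scalars v to vanish.\<close>
  define b where "b k = (\<Sum>m\<in>M k. monomial m (v (k, m)))" for k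
  have "b k = 0" if "k \<le> N" for k
  proof (rule indep)
    show "b l \<in> mpolys (Suc n)" for l unfolding b_def using Mcl by (intro mpolys.sum_closed) auto
    show "(\<Sum>k\<le>N. b k * \<theta> k j) = 0" for j
    proof (cases "j \<le> n")
      case j: True
      have "(\<Sum>k\<le>N. b k * \<theta> k j) = (\<Sum>k\<le>N. \<Sum>m\<in>M k. monomial m (v (k, m)) * \<theta> k j)"
        by (simp add: b_def sum_distrib_right)
      also have "\<dots> = (\<Sum>(k, m)\<in>A. monomial m (v (k, m)) * \<theta> k j)"
        unfolding A_def using finM by (intro sum.Sigma) auto
      also have "\<dots> = (\<Sum>s\<in>A. monomial 0 (v s) * (monomial (snd s) 1 * \<theta> (fst s) j))"
        by (intro sum.cong) (simp_all add: mult.assoc[symmetric] mult_single case_prod_beta)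
      also have "\<dots> = (\<Sum>s\<in>A. \<Sum>i<N. c s i * monomial 0 (v s) * \<zeta> i j)"
        by (intro sum.cong) (simp_all only: c(3)[OF _ j] sum_distrib_left mult_ac)
      also have "\<dots> = (\<Sum>i<N. (\<Sum>s\<in>A. c s i * monomial 0 (v s)) * \<zeta> i j)"
        unfolding sum_distrib_right by (rule sum.swap)
      also have "\<dots> = 0" using zero by simp
      finally show ?thesis .
    qed (use \<theta>0 in auto)
  qed fact
  moreover obtain k m where km: "k \<le> N" "m \<in> M k" "v (k, m) \<noteq> 0" using v(1) by (auto simp: A_def)
  ultimately have "Poly_Mapping.lookup (b k) m = 0" by simp
  moreover have "Poly_Mapping.lookup (b k) m = v (k, m)"
    using finM km by (simp add: b_def lookup_sum lookup_single when_def)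
  ultimately show False using km by simp
qed

section \<open>The freeness criterion\<close>

locale weighted_eigenscheme =
  fixes n d :: nat
    and \<omega> :: "nat \<Rightarrow> nat"
    and f :: "'k::field_char_0 mpoly"
    and \<delta> :: "nat \<Rightarrow> 'k derivation"
    and e :: "nat \<Rightarrow> int"
  assumes n: "n > 0"
    and \<omega>: "\<And>i. i \<le> n \<Longrightarrow> \<omega> i > 0"
    and reduced: "reduced_poly n f"
    and homf: "weighted_homogeneous \<omega> (int d) f"
    and \<delta>: "\<And>i. i \<in> {1..n - 1} \<Longrightarrow> \<delta> i \<in> Der n f"
    and hom\<delta>: "\<And>i. i \<in> {1..n - 1} \<Longrightarrow> homogeneous_der n \<omega> (e i) (\<delta> i)"
    and height: "ideal_height (poly_ring n) (eigen_ideal n \<omega> \<delta>) = 2"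
begin

abbreviation "R \<equiv> mpolys (Suc n) :: 'k mpoly set"

definition last_exponent :: int where
  "last_exponent = int d + (\<Sum>i=0..n. 1 - int (\<omega> i)) - (\<Sum>i=1..n - 1. e i) - 1"

text \<open>Rows 0 to n - 1 are those of the eigenscheme matrix. Row n is arbitrary here; it is
  overwritten, as in \<open>\<rho>(n := y)\<close>, or ignored by the cofactors along it.\<close>

definition \<rho> :: "nat \<Rightarrow> 'k derivation" where
  "\<rho> i = (if i = 0 then euler n \<omega> else \<delta> i)"

text \<open>The row degrees of the completed matrix. Exponent number k of the list is the degree of
  row Suc k, since the Euler row is not counted among the exponents.\<close>

definition deg :: "nat \<Rightarrow> int" where
  "deg i = (if i = 0 then 1 else if i < n then e i else last_exponent)"

text \<open>The maximal minors with the signs that make the determinant with last row y equal to the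
  sum of the y k * C k. Signs are units, so the ideal is the same.\<close>

definition C :: "nat \<Rightarrow> 'k mpoly" where
  "C k = cofactor (row_mat n \<rho>) n k"

lemma nth_exponents: "k < n \<Longrightarrow> (map e [1..<n] @ [last_exponent]) ! k = deg (Suc k)"
  by (auto simp: nth_append deg_def less_Suc_eq not_less)

lemma f: "f \<in> R" "f \<noteq> 0"
  using reduced by (auto simp: reduced_poly_def carrier_poly_ring)

lemma \<rho>_Der: "i < n \<Longrightarrow> \<rho> i \<in> Der n f"
  using \<delta>[of i] euler_in_Der[OF f(1) homf] by (auto simp: \<rho>_def)

lemma \<rho>_closed: "i < n \<Longrightarrow> \<rho> i j \<in> R"
  using \<rho>_Der[of i] by (simp add: Der_iff Der_all_iff)

lemma C_closed: "k \<le> n \<Longrightarrow> C k \<in> R"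
  unfolding C_def by (rule mpolys.cofactor_last_closed) (auto intro: \<rho>_closed)

lemma hom\<rho>: "i < n \<Longrightarrow> homogeneous_der n \<omega> (deg i) (\<rho> i)"
  using hom\<delta>[of i] homogeneous_euler by (auto simp: \<rho>_def deg_def)

lemma sum_deg: "(\<Sum>i<n. deg i) = 1 + (\<Sum>i=1..n - 1. e i)"
proof -
  have "{..<n} = insert 0 {1..n - 1}" using n by auto
  then have "(\<Sum>i<n. deg i) = deg 0 + (\<Sum>i=1..n - 1. deg i)" by simp
  also have "(\<Sum>i=1..n - 1. deg i) = (\<Sum>i=1..n - 1. e i)"
    using n by (intro sum.cong) (auto simp: deg_def)
  finally show ?thesis by (simp add: deg_def)
qed

lemma eigen_ideal_eq: "eigen_ideal n \<omega> \<delta> = Idl\<^bsub>poly_ring n\<^esub> (C ` {..n})"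
proof -
  define M where "M k = det (mat n n (\<lambda>(i, j). eigen_matrix n \<omega> \<delta> $$ (i, insert_index k j)))" for k
  have CM: "C k = (- 1) ^ (n + k) * M k" if "k \<le> n" for k
  proof -
    have "mat_delete (row_mat n \<rho>) n k = mat n n (\<lambda>(i, j). eigen_matrix n \<omega> \<delta> $$ (i, insert_index k j))"
      by (rule eq_matI)
        (auto simp: mat_delete_def row_mat_def eigen_matrix_def insert_index_def \<rho>_def)
    then show ?thesis by (simp add: C_def cofactor_def M_def)
  qed
  have sgn: "(- 1) ^ (n + k) * ((- 1) ^ (n + k) * x) = x" for k and x :: "'k mpoly"
    by (simp add: mult.assoc[symmetric] power_mult_distrib[symmetric])
  have scl: "(- 1) ^ (n + k) \<in> R" for k
    by (intro mpolys.power_closed mpolys.uminus_closed mpolys.one_closed)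
  have MC: "M k = (- 1) ^ (n + k) * C k" if "k \<le> n" for k
    using CM[OF that] sgn by simp
  have Mcl: "M k \<in> R" if "k \<le> n" for k
    unfolding MC[OF that] using C_closed[OF that] scl by blast
  have "eigen_ideal n \<omega> \<delta> = Idl\<^bsub>poly_ring n\<^esub> (M ` {..n})"
    unfolding eigen_ideal_def M_def by (rule arg_cong[of _ _ "genideal _"]) auto
  also have "\<dots> = {\<Sum>k\<le>n. h k * M k | h. \<forall>k\<le>n. h k \<in> R}"
    by (rule Idl_mpolys) (rule Mcl)
  also have "\<dots> = {\<Sum>k\<le>n. h k * C k | h. \<forall>k\<le>n. h k \<in> R}"
  proof (intro equalityI subsetI)
    fix x assume "x \<in> {\<Sum>k\<le>n. h k * M k | h. \<forall>k\<le>n. h k \<in> R}"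
    then obtain h where h: "x = (\<Sum>k\<le>n. h k * M k)" "\<forall>k\<le>n. h k \<in> R" by blast
    have "x = (\<Sum>k\<le>n. (h k * (- 1) ^ (n + k)) * C k)"
      unfolding h(1) by (intro sum.cong) (auto simp: MC mult.assoc)
    then show "x \<in> {\<Sum>k\<le>n. h k * C k | h. \<forall>k\<le>n. h k \<in> R}"
      using h(2) scl by (intro CollectI exI[of _ "\<lambda>k. h k * (- 1) ^ (n + k)"]) auto
  next
    fix x assume "x \<in> {\<Sum>k\<le>n. h k * C k | h. \<forall>k\<le>n. h k \<in> R}"
    then obtain h where h: "x = (\<Sum>k\<le>n. h k * C k)" "\<forall>k\<le>n. h k \<in> R" by blast
    have "x = (\<Sum>k\<le>n. (h k * (- 1) ^ (n + k)) * M k)"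
      unfolding h(1) by (intro sum.cong) (auto simp: CM mult.assoc)
    then show "x \<in> {\<Sum>k\<le>n. h k * M k | h. \<forall>k\<le>n. h k \<in> R}"
      using h(2) scl by (intro CollectI exI[of _ "\<lambda>k. h k * (- 1) ^ (n + k)"]) auto
  qed
  also have "\<dots> = Idl\<^bsub>poly_ring n\<^esub> (C ` {..n})"
    by (rule Idl_mpolys[symmetric]) (rule C_closed)
  finally show ?thesis .
qed

lemma in_eigen_ideal_iff:
  "x \<in> eigen_ideal n \<omega> \<delta> \<longleftrightarrow> (\<exists>h. (\<forall>k\<le>n. h k \<in> R) \<and> x = (\<Sum>k\<le>n. h k * C k))"
proof -
  have "Idl\<^bsub>poly_ring n\<^esub> (C ` {..n}) = {\<Sum>k\<le>n. h k * C k | h. \<forall>k\<le>n. h k \<in> R}"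
    by (rule Idl_mpolys) (rule C_closed)
  then show ?thesis unfolding eigen_ideal_eq by auto
qed

lemmas height_C = height[unfolded eigen_ideal_eq]

lemma C_coprime: "prime_in R p \<Longrightarrow> \<exists>k\<le>n. \<not> rdvd R p (C k)"
  by (rule height_2_coprime[OF C_closed height_C])

lemma C_nonzero: "\<exists>k\<le>n. C k \<noteq> 0"
  by (rule height_2_nonzero[OF C_closed height_C])

lemma eigen_ideal_proper: "1 \<notin> eigen_ideal n \<omega> \<delta>"
  unfolding eigen_ideal_eq by (rule height_2_proper[OF C_closed height_C])

lemma det_last_row: "det (row_mat n (\<rho>(n := y))) = (\<Sum>k\<le>n. y k * C k)"
  by (simp add: det_replace_row C_def)

text \<open>A row of degree a contributes to the determinant a degree off from d by a -
  \<open>last_exponent\<close>; so \<open>last_exponent\<close> is the row degree at which the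
  determinant can be compared with f.\<close>

lemma hom_det:
  assumes "homogeneous_der n \<omega> a y"
  shows "weighted_homogeneous \<omega> (int d + a - last_exponent) (det (row_mat n (\<rho>(n := y))))"
proof -
  have "weighted_homogeneous \<omega> ((\<Sum>i\<le>n. (deg(n := a)) i) - (\<Sum>j\<le>n. 1 - int (\<omega> j)))
      (det (row_mat n (\<rho>(n := y))))"
    using hom\<rho> assms
    by (intro weighted_homogeneous_det) (auto simp: homogeneous_der_def)
  moreover have "(\<Sum>i\<le>n. (deg(n := a)) i) = (\<Sum>i<n. deg i) + a"
    by (simp add: lessThan_Suc_atMost[symmetric])
  ultimately show ?thesis
    by (simp add: sum_deg last_exponent_def atMost_atLeast0 algebra_simps)
qed

section \<open>Constant f excluded on both sides\<close>

lemma constant_if_d_eq_0: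
  assumes "d = 0"
  shows "rdvd R f 1" "partial_deriv j f = 0"
proof -
  have keys: "Poly_Mapping.keys f \<subseteq> {0}"
  proof
    fix m assume m: "m \<in> Poly_Mapping.keys f"
    have "wdeg \<omega> m = 0" using m homf assms by (simp add: weighted_homogeneous_def)
    moreover have "\<omega> i > 0" if "i \<in> Poly_Mapping.keys m" for i
      using mpolys_keysD[OF f(1) m that] \<omega> by simp
    ultimately show "m \<in> {0}" using wdeg_eq_0_iff[of m \<omega>] by simp
  qed
  then show "rdvd R f 1" using f constant_unit by blast
  show "partial_deriv j f = 0"
  proof (rule poly_mapping_eqI)
    fix m :: "nat \<Rightarrow>\<^sub>0 nat"
    have "m + Poly_Mapping.single j 1 \<noteq> 0"
    proof
      assume 0: "m + Poly_Mapping.single j 1 = 0"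
      have "Poly_Mapping.lookup (m + Poly_Mapping.single j 1) j \<noteq> 0" by (simp add: lookup_add)
      then show False unfolding 0 by simp
    qed
    then have "m + Poly_Mapping.single j 1 \<notin> Poly_Mapping.keys f" using keys by blast
    then show "Poly_Mapping.lookup (partial_deriv j f) m = Poly_Mapping.lookup 0 m"
      by (simp add: lookup_partial_deriv in_keys_iff)
  qed
qed

text \<open>A constant f is a unit and would make the ideal improper.\<close>

lemma d_pos_if_in_ideal:
  assumes "f \<in> eigen_ideal n \<omega> \<delta>"
  shows "d > 0"
proof (rule ccontr)
  assume "\<not> d > 0"
  then obtain c where c: "c \<in> R" "1 = f * c" using constant_if_d_eq_0(1) by (auto simp: rdvd_def)
  obtain h where h: "\<forall>k\<le>n. h k \<in> R" "f = (\<Sum>k\<le>n. h k * C k)" using assms in_eigen_ideal_iff by blast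
  have "1 = (\<Sum>k\<le>n. (c * h k) * C k)"
    unfolding c(2) by (subst h(2)) (simp add: sum_distrib_left sum_distrib_right mult_ac)
  then have "1 \<in> eigen_ideal n \<omega> \<delta>"
    unfolding in_eigen_ideal_iff using c(1) h(1) by (intro exI[of _ "\<lambda>k. c * h k"]) auto
  then show False using eigen_ideal_proper by blast
qed

text \<open>For constant f the module of logarithmic derivations has rank n + 1.\<close>

lemma d_pos_if_free:
  assumes "length \<theta>s = n" "module_basis n \<theta>s (Der0 n f)"
  shows "d > 0"
proof (rule ccontr)
  assume "\<not> d > 0"
  then have "partial_deriv j f = 0" for j using constant_if_d_eq_0(2) by simp
  then have Der0: "Der0 n f = Der_all n" by (auto simp: Der0_def apply_der_def)
  have "\<exists>c. \<forall>j\<le>n. (\<Sum>k<n. c k * (\<theta>s ! k) j) = (if i = j then 1 else 0)" if "i \<le> n" for i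
  proof -
    have "(\<lambda>j. if i = j then 1 else 0) \<in> Der0 n f" using that by (auto simp: Der0 Der_all_iff)
    from module_basis_span[OF assms(2) this] assms(1) obtain c where
      "(\<lambda>j. if i = j then 1 else 0) = (\<lambda>j. \<Sum>k<n. c k * (\<theta>s ! k) j)" by auto
    then show ?thesis by metis
  qed
  then have "\<forall>i\<in>{..n}. \<exists>c. \<forall>j\<le>n. (\<Sum>k<n. c k * (\<theta>s ! k) j) = (if i = j then 1 else 0)" by blast
  from bchoice[OF this] obtain c where
    c: "\<And>i j. i \<le> n \<Longrightarrow> j \<le> n \<Longrightarrow> (\<Sum>k<n. c i k * (\<theta>s ! k) j) = (if i = j then 1 else 0)" by auto
  \<comment> \<open>The n basis elements padded by a zero row. The coefficients c of the n + 1 unit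
    vectors would make this singular square matrix invertible; the arbitrary entries c i n only meet
    the zero row.\<close>
  define \<tau> where "\<tau> i = (if i < n then \<theta>s ! i else (\<lambda>_. 0))" for i
  have "row_mat n c * row_mat n \<tau> = 1\<^sub>m (Suc n)"
  proof (rule eq_matI)
    fix i j assume ij: "i < dim_row (1\<^sub>m (Suc n) :: 'k mpoly mat)" "j < dim_col (1\<^sub>m (Suc n) :: 'k mpoly mat)"
    have "(row_mat n c * row_mat n \<tau>) $$ (i, j) = (\<Sum>k<Suc n. c i k * \<tau> k j)"
      using ij by (auto simp: scalar_prod_def row_mat_def atLeast0LessThan intro!: sum.cong)
    also have "\<dots> = (\<Sum>k<n. c i k * (\<theta>s ! k) j)" by (simp add: \<tau>_def)
    finally show "(row_mat n c * row_mat n \<tau>) $$ (i, j) = 1\<^sub>m (Suc n) $$ (i, j)"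
      using ij c by simp
  qed (auto simp: row_mat_def)
  then have "det (row_mat n c) * det (row_mat n \<tau>) = 1"
    using det_mult[of "row_mat n c" "Suc n" "row_mat n \<tau>"] by simp
  moreover have "det (row_mat n \<tau>) = 0"
  proof -
    have "\<tau>(n := (\<lambda>_. 0)) = \<tau>" by (auto simp: \<tau>_def)
    then show ?thesis using det_replace_row[of n n \<tau> "\<lambda>_. 0"] by simp
  qed
  ultimately show False by simp
qed

section \<open>From freeness to membership\<close>

lemma in_ideal_if_free:
  assumes "free_with_exponents n \<omega> f (map e [1..<n] @ [last_exponent])"
  shows "f \<in> eigen_ideal n \<omega> \<delta>"
proof -
  define N where "N = n - 1"
  have nN: "n = Suc N" using n by (simp add: N_def)
  obtain \<theta>s where \<theta>s: "length \<theta>s = n" "module_basis n \<theta>s (Der0 n f)"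
    and hom: "\<forall>k<n. homogeneous_der n \<omega> ((map e [1..<n] @ [last_exponent]) ! k) (\<theta>s ! k)"
    using assms unfolding free_with_exponents_def by blast
  have d: "d > 0" using \<theta>s by (rule d_pos_if_free)
  define \<alpha> where "\<alpha> k = deg (Suc k)" for k
  have \<alpha>N: "\<alpha> N = last_exponent" using n by (simp add: \<alpha>_def deg_def nN[symmetric])
  have exps: "(map e [1..<n] @ [last_exponent]) ! k = \<alpha> k" if "k < n" for k
    unfolding \<alpha>_def using that by (rule nth_exponents)
  have "\<forall>i\<in>{..<N}. \<exists>q. q \<in> R \<and> (\<lambda>j. \<rho> (Suc i) j - q * euler n \<omega> j) \<in> Der0 n f \<and>
      homogeneous_der n \<omega> (deg (Suc i)) (\<lambda>j. \<rho> (Suc i) j - q * euler n \<omega> j)"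
  proof
    fix i assume "i \<in> {..<N}"
    then have "Suc i < n" using nN by simp
    from Der_split[OF f(1) homf d \<rho>_Der[OF this] hom\<rho>[OF this]]
    show "\<exists>q. q \<in> R \<and> (\<lambda>j. \<rho> (Suc i) j - q * euler n \<omega> j) \<in> Der0 n f \<and>
      homogeneous_der n \<omega> (deg (Suc i)) (\<lambda>j. \<rho> (Suc i) j - q * euler n \<omega> j)" by blast
  qed
  from bchoice[OF this] obtain q where q: "\<And>i. i < N \<Longrightarrow> q i \<in> R"
    "\<And>i. i < N \<Longrightarrow> (\<lambda>j. \<rho> (Suc i) j - q i * euler n \<omega> j) \<in> Der0 n f"
    "\<And>i. i < N \<Longrightarrow> homogeneous_der n \<omega> (\<alpha> i) (\<lambda>j. \<rho> (Suc i) j - q i * euler n \<omega> j)"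
    by (auto simp: \<alpha>_def)
  \<comment> \<open>The \<delta> i corrected to annihilate f: N elements of Der_0 with the degrees
    of the first N basis elements. The basis has one more, of degree
    \<open>last_exponent\<close>.\<close>
  define \<zeta> where "\<zeta> i = (\<lambda>j. \<rho> (Suc i) j - q i * euler n \<omega> j)" for i
  have \<theta>Der0: "\<theta>s ! k \<in> Der0 n f" if "k < n" for k
    using \<theta>s that unfolding module_basis_def by (metis nth_mem subsetD)
  have zero: "(\<lambda>_. 0) \<in> Der0 n f" by (simp add: Der0_def Der_all_iff apply_der_def)
  obtain k x where k: "k \<le> N" "x \<in> R" and y: "homogeneous_der n \<omega> (\<alpha> N) (\<lambda>j. x * (\<theta>s ! k) j)"
    and out: "\<not> (\<exists>c. (\<forall>i<N. c i \<in> R) \<and> (\<forall>j\<le>n. x * (\<theta>s ! k) j = (\<Sum>i<N. c i * \<zeta> i j)))"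
  proof -
    have "\<exists>k\<le>N. \<exists>x\<in>R. homogeneous_der n \<omega> (\<alpha> N) (\<lambda>j. x * (\<theta>s ! k) j) \<and>
      \<not> (\<exists>c. (\<forall>i<N. c i \<in> R) \<and> (\<forall>j\<le>n. x * (\<theta>s ! k) j = (\<Sum>i<N. c i * \<zeta> i j)))"
    proof (rule homogeneous_element_outside_span)
      show "homogeneous_der n \<omega> (\<alpha> k) (\<theta>s ! k)" if "k \<le> N" for k
      proof -
        have "k < n" using that nN by simp
        then show ?thesis using hom exps[of k] by metis
      qed
      show "homogeneous_der n \<omega> (\<alpha> i) (\<zeta> i)" if "i < N" for i
        unfolding \<zeta>_def using that by (rule q(3))
      show "(\<theta>s ! k) j = 0" if "k \<le> N" "j > n" for k j
      proof -
        have "\<theta>s ! k \<in> Der0 n f" using that nN by (intro \<theta>Der0) simp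
        then show ?thesis using that(2) by (simp add: Der0_def Der_all_iff)
      qed
      show "\<zeta> i j = 0" if "i < N" "j > n" for i j
        using q(2)[OF that(1)] that(2) by (simp add: \<zeta>_def Der0_def Der_all_iff)
      show "b k = 0" if "\<And>k. k \<le> N \<Longrightarrow> b k \<in> R" "\<And>j. (\<Sum>k\<le>N. b k * (\<theta>s ! k) j) = 0" "k \<le> N" for b k
      proof (rule module_basis_independent[OF \<theta>s(2) zero])
        have len: "length \<theta>s = Suc N" using \<theta>s(1) nN by simp
        show "b k \<in> R" if "k < length \<theta>s" for k using that len \<open>\<And>k. k \<le> N \<Longrightarrow> b k \<in> R\<close> by simp
        show "(\<Sum>k<length \<theta>s. b k * (\<theta>s ! k) j) = 0" for j
          unfolding len lessThan_Suc_atMost by (rule that(2))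
        show "k < length \<theta>s" using that(3) len by simp
      qed
    qed (rule \<omega>)
    then show ?thesis using that by blast
  qed
  define y where "y = (\<lambda>j. x * (\<theta>s ! k) j)"
  have yDer0: "y \<in> Der0 n f"
    using Der0_lincomb[of "{()}" "\<lambda>_. x" n "\<lambda>_. \<theta>s ! k" f] k \<theta>Der0[of k] nN by (simp add: y_def)
  then have yDer: "y \<in> Der n f" using Der0_subset_Der by blast
  have ycl: "y j \<in> R" for j using yDer by (simp add: Der_iff Der_all_iff)
  let ?D = "det (row_mat n (\<rho>(n := y)))"
  have "rdvd R f ?D"
    using reduced yDer \<rho>_Der by (intro Der_det_divisible) auto
  then obtain c where c: "c \<in> R" "?D = f * c" by (auto simp: rdvd_def)
  have "weighted_homogeneous \<omega> (int d) ?D"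
    using hom_det[of last_exponent y] y \<alpha>N by (simp add: y_def)
  \<comment> \<open>The determinant and f are both homogeneous of degree d, so only the degree 0
    component of the quotient counts.\<close>
  then have D: "?D = f * hcomp \<omega> 0 c"
    using hcomp_id[of \<omega> "int d" ?D] hcomp_mult[OF homf, of "int d" c] c(2) by auto
  define c0 where "c0 = hcomp \<omega> 0 c"
  have c0: "c0 \<in> R" unfolding c0_def using c(1) by (rule hcomp_closed)
  have "c0 \<noteq> 0"
  proof
    assume "c0 = 0"
    then have "?D = 0" using D by (simp add: c0_def)
    have Cy: "cofactor (row_mat n (\<rho>(n := y))) n k = C k" for k
      unfolding C_def by (rule cofactor_last_cong) simp
    have "\<exists>b. (\<forall>i<n. b i \<in> R) \<and> (\<forall>j\<le>n. (\<rho>(n := y)) n j = (\<Sum>i<n. b i * (\<rho>(n := y)) i j))"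
    proof (rule mpolys.last_row_combination[OF _ \<open>?D = 0\<close>])
      show "(\<rho>(n := y)) i j \<in> R" if "i \<le> n" for i j using that ycl \<rho>_closed by auto
    qed (unfold Cy, use C_nonzero C_coprime in auto)
    then obtain b where b: "\<And>i. i < n \<Longrightarrow> b i \<in> R" "\<And>j. j \<le> n \<Longrightarrow> y j = (\<Sum>i<n. b i * \<rho> i j)"
      by auto
    \<comment> \<open>As y annihilates f, the Euler row drops out after the correction, and y
      becomes a combination of the \<zeta> i alone, against its choice.\<close>
    have "y = (\<lambda>j. \<Sum>i<N. b (Suc i) * (\<rho> (Suc i) j - q i * euler n \<omega> j))"
    proof (rule euler_elimination[OF f homf d yDer0])
      show "y j = b 0 * euler n \<omega> j + (\<Sum>i<N. b (Suc i) * \<rho> (Suc i) j)" if "j \<le> n" for j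
      proof -
        have "(\<Sum>i<n. b i * \<rho> i j) = b 0 * \<rho> 0 j + (\<Sum>i<N. b (Suc i) * \<rho> (Suc i) j)"
          by (simp only: nN sum.lessThan_Suc_shift)
        moreover have "\<rho> 0 = euler n \<omega>" by (simp add: \<rho>_def)
        ultimately show ?thesis using b(2)[OF that] by simp
      qed
    qed (use q in auto)
    from fun_cong[OF this] have "\<forall>j\<le>n. x * (\<theta>s ! k) j = (\<Sum>i<N. b (Suc i) * \<zeta> i j)"
      by (simp add: y_def \<zeta>_def)
    moreover have "\<forall>i<N. b (Suc i) \<in> R" using b(1) nN by simp
    ultimately show False using out by (elim notE) (intro exI[of _ "\<lambda>i. b (Suc i)"] conjI)
  qed
  moreover have "Poly_Mapping.keys c0 \<subseteq> {0}"
  proof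
    fix m assume m: "m \<in> Poly_Mapping.keys c0"
    have "wdeg \<omega> m = 0"
      using m weighted_homogeneous_hcomp[of \<omega> 0 c] by (auto simp: c0_def weighted_homogeneous_def)
    moreover have "\<omega> i > 0" if "i \<in> Poly_Mapping.keys m" for i
      using mpolys_keysD[OF c0 m that] \<omega> by simp
    ultimately show "m \<in> {0}" using wdeg_eq_0_iff[of m \<omega>] by simp
  qed
  \<comment> \<open>Positive weights make 1 the only monomial of degree 0, so c0 is a nonzero
    constant.\<close>
  ultimately have "rdvd R c0 1" using c0 constant_unit by blast
  then obtain u where u: "u \<in> R" "1 = c0 * u" by (auto simp: rdvd_def)
  have "f = ?D * u" using u(2) D by (simp add: c0_def mult.assoc)
  also have "\<dots> = (\<Sum>k\<le>n. (y k * u) * C k)"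
    unfolding det_last_row by (simp add: sum_distrib_left sum_distrib_right mult_ac)
  finally show ?thesis
    unfolding in_eigen_ideal_iff using ycl u(1) by (intro exI[of _ "\<lambda>k. y k * u"]) auto
qed

section \<open>From membership to freeness\<close>

lemma free_if_in_ideal:
  assumes "f \<in> eigen_ideal n \<omega> \<delta>"
  shows "free_with_exponents n \<omega> f (map e [1..<n] @ [last_exponent])"
proof -
  have d: "d > 0" using assms by (rule d_pos_if_in_ideal)
  obtain h0 where h0: "\<forall>k\<le>n. h0 k \<in> R" "f = (\<Sum>k\<le>n. h0 k * C k)"
    using assms in_eigen_ideal_iff by blast
  \<comment> \<open>Only the component of h0 k complementary in degree to C k contributes to f.
    Keeping just these turns the coefficients into a homogeneous derivation of degree
    \<open>last_exponent\<close>.\<close>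
  define h where "h k = (if k \<le> n then hcomp \<omega> (last_exponent - (1 - int (\<omega> k))) (h0 k) else 0)" for k
  have hcl: "h \<in> Der_all n" using h0(1) by (auto simp: h_def Der_all_iff hcomp_closed)
  have homh: "homogeneous_der n \<omega> last_exponent h"
    by (simp add: homogeneous_der_def h_def weighted_homogeneous_hcomp)
  \<comment> \<open>C k is the determinant whose last row is the partial derivation in x_k, which
    has degree 1 - \<omega> k.\<close>
  have homC: "weighted_homogeneous \<omega> (int d + (1 - int (\<omega> k)) - last_exponent) (C k)" if k: "k \<le> n" for k
  proof -
    have "homogeneous_der n \<omega> (1 - int (\<omega> k)) (\<lambda>j. if j = k then 1 else 0 :: 'k mpoly)"
      by (auto simp: homogeneous_der_def weighted_homogeneous_def)
    from hom_det[OF this] show ?thesis by (simp add: det_unit_row k C_def)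
  qed
  define \<sigma> where "\<sigma> = \<rho>(n := h)"
  have det: "det (row_mat n \<sigma>) = f"
  proof -
    have "f = hcomp \<omega> (int d) (\<Sum>k\<le>n. C k * h0 k)"
      using hcomp_id[OF homf] h0(2) by (simp add: mult.commute)
    also have "\<dots> = (\<Sum>k\<le>n. h k * C k)"
      unfolding hcomp_sum
    proof (rule sum.cong[OF refl])
      fix k assume "k \<in> {..n}"
      then have k: "k \<le> n" by simp
      have deg: "int d - (int d + (1 - int (\<omega> k)) - last_exponent) = last_exponent - (1 - int (\<omega> k))"
        by simp
      show "hcomp \<omega> (int d) (C k * h0 k) = h k * C k"
        unfolding hcomp_mult[OF homC[OF k]] deg using k by (simp add: h_def)
    qed
    finally show ?thesis by (simp add: \<sigma>_def det_last_row)
  qed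
  have \<sigma>cl: "\<sigma> i j \<in> R" if "i \<le> n" for i j
    using that \<rho>_closed hcl by (auto simp: \<sigma>_def Der_all_iff)
  have hDer: "h \<in> Der n f"
  proof -
    let ?g = "\<lambda>j. partial_deriv j f"
    obtain m where "prime_product R m f" using mpolys.prime_product_exists f by blast
    then have "rdvd R f (apply_der n h f)"
    proof (rule mpolys.coprime_cancel)
      show "apply_der n h f \<in> R"
        unfolding apply_der_def using hcl f
        by (intro mpolys.sum_closed mpolys.mult_closed partial_deriv_closed) (auto simp: Der_all_iff)
      show "rdvd R f (apply_der n h f * C l)" if l: "l \<in> {..n}" for l
      proof -
        \<comment> \<open>Column l of the adjugate, applied to the gradient. The summands add up to
          f times a partial derivative, and those of the rows i < n are divisible by f; hence so is
          the last one, h(f) * C l.\<close>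
        let ?s = "\<lambda>i. cofactor (row_mat n \<sigma>) i l * (\<Sum>j\<le>n. \<sigma> i j * ?g j)"
        have "cofactor (row_mat n \<sigma>) n l = C l"
          unfolding C_def \<sigma>_def by (rule cofactor_last_cong) simp
        then have last: "apply_der n h f * C l = ?s n"
          by (simp add: \<sigma>_def apply_der_atMost mult.commute)
        have split: "(\<Sum>i\<le>n. ?s i) = (\<Sum>i<n. ?s i) + ?s n"
          by (simp only: lessThan_Suc_atMost[symmetric] sum.lessThan_Suc)
        have total: "(\<Sum>i\<le>n. ?s i) = f * ?g l"
          using cofactor_mult_apply[of l n \<sigma> ?g] l det by simp
        have "apply_der n h f * C l = f * ?g l - (\<Sum>i<n. ?s i)"
          unfolding last total[symmetric] split by (rule add_diff_cancel_left'[symmetric])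
        moreover have "rdvd R f (\<Sum>i<n. ?s i)"
        proof (rule mpolys.rdvd_sum)
          fix i assume "i \<in> {..<n}"
          then have i: "i < n" by simp
          have "rdvd R f (\<Sum>j\<le>n. \<sigma> i j * ?g j)"
            using \<rho>_Der[OF i] i by (simp add: \<sigma>_def Der_iff apply_der_atMost)
          moreover have "cofactor (row_mat n \<sigma>) i l \<in> R"
            using \<sigma>cl i l by (intro mpolys.cofactor_closed) auto
          ultimately show "rdvd R f (?s i)" by (rule mpolys.rdvd_mult2)
        qed
        moreover have "rdvd R f (f * ?g l)"
          by (intro mpolys.rdvd_triv partial_deriv_closed f)
        ultimately show ?thesis using mpolys.rdvd_diff by simp
      qed
      show "\<exists>j\<in>{..n}. \<not> rdvd R p (C j)" if "prime_in R p" for p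
        using C_coprime[OF that] by auto
    qed (use C_closed in auto)
    then show ?thesis using hcl by (simp add: Der_iff)
  qed
  have \<sigma>Der: "\<sigma> i \<in> Der n f" if "i \<le> n" for i
    using that \<rho>_Der hDer by (auto simp: \<sigma>_def)
  have hom\<sigma>: "homogeneous_der n \<omega> (deg i) (\<sigma> i)" if "i \<le> n" for i
    using that hom\<rho> homh n by (auto simp: \<sigma>_def deg_def)
  have \<sigma>0: "\<sigma> 0 = euler n \<omega>" using n by (simp add: \<sigma>_def \<rho>_def)
  have "\<forall>k\<in>{..<n}. \<exists>q. q \<in> R \<and> (\<lambda>j. \<sigma> (Suc k) j - q * euler n \<omega> j) \<in> Der0 n f \<and>
      homogeneous_der n \<omega> (deg (Suc k)) (\<lambda>j. \<sigma> (Suc k) j - q * euler n \<omega> j)"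
  proof
    fix k assume "k \<in> {..<n}"
    then have "Suc k \<le> n" by simp
    from Der_split[OF f(1) homf d \<sigma>Der[OF this] hom\<sigma>[OF this]]
    show "\<exists>q. q \<in> R \<and> (\<lambda>j. \<sigma> (Suc k) j - q * euler n \<omega> j) \<in> Der0 n f \<and>
      homogeneous_der n \<omega> (deg (Suc k)) (\<lambda>j. \<sigma> (Suc k) j - q * euler n \<omega> j)" by blast
  qed
  from bchoice[OF this] obtain q where q: "\<And>k. k < n \<Longrightarrow> q k \<in> R"
    "\<And>k. k < n \<Longrightarrow> (\<lambda>j. \<sigma> (Suc k) j - q k * euler n \<omega> j) \<in> Der0 n f"
    "\<And>k. k < n \<Longrightarrow> homogeneous_der n \<omega> (deg (Suc k)) (\<lambda>j. \<sigma> (Suc k) j - q k * euler n \<omega> j)"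
    by auto
  define \<theta> where "\<theta> k = (\<lambda>j. \<sigma> (Suc k) j - q k * euler n \<omega> j)" for k
  define \<theta>s where "\<theta>s = map \<theta> [0..<n]"
  have len: "length \<theta>s = n" and nth: "\<And>k. k < n \<Longrightarrow> \<theta>s ! k = \<theta> k" by (auto simp: \<theta>s_def)
  have "module_basis n \<theta>s (Der0 n f)"
  proof (rule module_basisI)
    show "set \<theta>s \<subseteq> Der0 n f" using q(2) by (auto simp: \<theta>s_def \<theta>_def)
  next
    fix \<eta> assume \<eta>: "\<eta> \<in> Der0 n f"
    have "\<forall>i\<in>{..n}. \<exists>c. c \<in> R \<and> det (row_mat n (\<sigma>(i := \<eta>))) = f * c"
    proof
      fix i assume "i \<in> {..n}"
      have "rdvd R f (det (row_mat n (\<sigma>(i := \<eta>))))"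
        using \<eta> \<sigma>Der Der0_subset_Der by (intro Der_det_divisible[OF reduced]) auto
      then show "\<exists>c. c \<in> R \<and> det (row_mat n (\<sigma>(i := \<eta>))) = f * c" by (auto simp: rdvd_def)
    qed
    from bchoice[OF this] obtain c where
      c: "\<And>i. i \<le> n \<Longrightarrow> c i \<in> R \<and> det (row_mat n (\<sigma>(i := \<eta>))) = f * c i" by auto
    have comb: "\<eta> j = c 0 * euler n \<omega> j + (\<Sum>k<n. c (Suc k) * \<sigma> (Suc k) j)" if "j \<le> n" for j
    proof -
      have "f * \<eta> j = (\<Sum>i\<le>n. f * c i * \<sigma> i j)"
        using cramer[OF that, of \<sigma> \<eta>] c det by simp
      also have "\<dots> = f * (\<Sum>i\<le>n. c i * \<sigma> i j)" by (simp add: sum_distrib_left mult.assoc)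
      finally have "\<eta> j = (\<Sum>i\<le>n. c i * \<sigma> i j)" using f(2) by simp
      then show ?thesis by (simp add: sum.atMost_shift \<sigma>0)
    qed
    have "\<eta> = (\<lambda>j. \<Sum>k<n. c (Suc k) * \<theta> k j)"
      unfolding \<theta>_def by (rule euler_elimination[OF f homf d \<eta> _ comb]) (use q in auto)
    then show "\<exists>c. (\<forall>k<length \<theta>s. c k \<in> R) \<and> \<eta> = (\<lambda>j. \<Sum>k<length \<theta>s. c k * (\<theta>s ! k) j)"
      using c by (intro exI[of _ "\<lambda>k. c (Suc k)"]) (auto simp: len nth)
  next
    fix b k
    assume b: "\<And>j. (\<Sum>k<length \<theta>s. b k * (\<theta>s ! k) j) = 0" and k: "k < length \<theta>s"
    \<comment> \<open>A relation among the corrected derivations is one among the rows of \<sigma>;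
      the Euler row receives the negative of all corrections.\<close>
    define b' where "b' i = (case i of 0 \<Rightarrow> - (\<Sum>k<n. b k * q k) | Suc k \<Rightarrow> b k)" for i
    have "b' (Suc k) = 0"
    proof (rule rows_independent)
      show "det (row_mat n \<sigma>) \<noteq> 0" using det f by simp
      show "(\<Sum>i\<le>n. b' i * \<sigma> i j) = 0" for j
      proof -
        have "(\<Sum>i\<le>n. b' i * \<sigma> i j) = (\<Sum>k<n. b k * \<theta> k j)"
          by (simp add: sum.atMost_shift \<sigma>0 b'_def \<theta>_def algebra_simps sum_subtractf sum_distrib_left
              sum_distrib_right)
        then show ?thesis using b[of j] by (simp add: len nth)
      qed
      show "Suc k \<le> n" using k len by simp
    qed
    then show "b k = 0" by (simp add: b'_def)
  qed
  moreover have "homogeneous_der n \<omega> ((map e [1..<n] @ [last_exponent]) ! k) (\<theta>s ! k)" if k: "k < n" for k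
    unfolding nth_exponents[OF k] nth[OF k] \<theta>_def by (rule q(3)[OF k])
  ultimately show ?thesis
    unfolding free_with_exponents_def using len n by auto
qed

end

theorem theorem4p5:
  fixes n d :: nat
    and \<omega> :: "nat \<Rightarrow> nat"
    and f :: "'k::field_char_0 mpoly"
    and G :: "'k derivation set"
    and \<delta> :: "nat \<Rightarrow> 'k derivation"
    and e :: "nat \<Rightarrow> int"
  assumes "n \<ge> 2"
    and "\<And>i. i \<le> n \<Longrightarrow> \<omega> i > 0"
    and "reduced_poly n f"
    and "weighted_homogeneous \<omega> (int d) f"
    and "system_of_generators n G (Der n f)"
    and "\<And>i. i \<in> {1..n - 1} \<Longrightarrow> \<delta> i \<in> G"
    and "\<And>i. i \<in> {1..n - 1} \<Longrightarrow> homogeneous_der n \<omega> (e i) (\<delta> i)"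
    and "\<And>i j. 1 \<le> i \<Longrightarrow> i \<le> j \<Longrightarrow> j \<le> n - 1 \<Longrightarrow> e i \<le> e j"
    and "ideal_height (poly_ring n) (eigen_ideal n \<omega> \<delta>) = 2"
  shows "free_with_exponents n \<omega> f
      (map e [1..<n] @
        [int d + (\<Sum>i=0..n. 1 - int (\<omega> i)) - (\<Sum>i=1..n - 1. e i) - 1])
    \<longleftrightarrow> f \<in> eigen_ideal n \<omega> \<delta>"
proof -
  have "\<delta> i \<in> Der n f" if "i \<in> {1..n - 1}" for i
    using assms(5) assms(6)[OF that] by (auto simp: system_of_generators_def)
  then interpret weighted_eigenscheme n d \<omega> f \<delta> e
    using assms by unfold_locales auto
  show ?thesis
    using in_ideal_if_free free_if_in_ideal unfolding last_exponent_def by blast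
qed

end
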